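(* Let $\Omega\subset\mathbb{R}^2$ be a Lipschitz polygon with a shape-regular family of meshes of mesh size $h$, let $\Sigma_h\subset\mathbf{H}(\mathrm{div};\Omega)$ be one of the standard mixed finite element families (Raviart--Thomas, Brezzi--Douglas--Marini, etc.) and let $U_h\subset H^1_0(\Omega)$ be a standard finite element space of continuous piecewise polynomials, with no condition relating the polynomial orders of $\Sigma_h$ and $U_h$. Let $\lambda\in\mathbb{R}$ be a simple eigenvalue of the continuous first order least-squares eigenvalue problem (see context) with eigenfunction $u\in H^1_0(\Omega)$, and let $\boldsymbol{\sigma}\in\mathbf{H}(\mathrm{div};\Omega)$ be the other component of the solution. Consider the approximation $\lambda_h$ of $\lambda$ given by the discrete problem, with eigenfunction $u_h\in U_h$ converging to $u$ (obtained by appropriate normalization and choice of sign), and let $\boldsymbol{\sigma}_h\in\Sigma_h$ be the corresponding other component, converging analogously to $\boldsymbol{\sigma}$. Then there is a constant $C$ independent of $h$ such that $$\eta_h\le C\big(\|\boldsymbol{\sigma}-\boldsymbol{\sigma}_h\|_{\mathbf{H}(\mathrm{div};\Omega)}+\|u-u_h\|_{H^1(\Omega)}\big),$$ where $\eta_h$ is the error estimator defined in the context.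
   Context: $(\cdot,\cdot)$ is the $L^2(\Omega)$ (or $L^2(\Omega)^2$) inner product; $\mathbf{H}(\mathrm{div};\Omega)=\{\boldsymbol{\tau}\in L^2(\Omega)^2:\mathrm{div}\,\boldsymbol{\tau}\in L^2(\Omega)\}$ with the graph norm. Continuous eigenvalue problem: find $\lambda$ and $0\ne u\in H^1_0(\Omega)$ such that for some $\boldsymbol{\sigma}\in\mathbf{H}(\mathrm{div};\Omega)$ $$\begin{cases}(\boldsymbol{\sigma},\boldsymbol{\tau})+(\mathrm{div}\,\boldsymbol{\sigma},\mathrm{div}\,\boldsymbol{\tau})-(\nabla u,\boldsymbol{\tau})=-\lambda(u,\mathrm{div}\,\boldsymbol{\tau})&\forall\boldsymbol{\tau}\in\mathbf{H}(\mathrm{div};\Omega)\\ -(\boldsymbol{\sigma},\nabla v)+(\nabla u,\nabla v)=0&\forall v\in H^1_0(\Omega).\end{cases}$$ Discrete problem: find $\lambda_h\in\mathbb{R}$ and $0\neq u_h\in U_h$ such that for some $\boldsymbol{\sigma}_h\in\Sigma_h$ the same equations hold with $\lambda,u,\boldsymbol{\sigma}$ replaced by $\lambda_h,u_h,\boldsymbol{\sigma}_h$ and test functions $\boldsymbol{\tau}\in\Sigma_h$, $v\in U_h$. Estimator: for a mesh element $T$ of diameter $h_T$, $$\eta_T^2=h_T^2\|\mathrm{div}\,\boldsymbol{\sigma}_h-\Delta u_h\|_{L^2(T)}^2+h_T^2\|\mathrm{curl}\,\boldsymbol{\sigma}_h\|_{L^2(T)}^2+\sum_{e\subset\partial T}h_e\Big(\|[\![\boldsymbol{\sigma}_h\cdot\mathbf{t}]\!]\|_{L^2(e)}^2+\|[\![\nabla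 u_h\cdot\mathbf{n}]\!]\|_{L^2(e)}^2\Big),\qquad \eta_h^2=\sum_T\eta_T^2,$$ where $h_e$ is the length of the edge $e$, $\mathbf{t}$ and $\mathbf{n}$ are unit tangent and normal vectors to $e$, $\mathrm{curl}$ is the scalar (two-dimensional) curl, $\Delta u_h$ and $\mathrm{curl}\,\boldsymbol{\sigma}_h$ are computed elementwise, and $[\![\cdot]\!]$ is the jump across $e$. As usual, on edges $e\subset\partial\Omega$ the tangential jump is $\boldsymbol{\sigma}_h\cdot\mathbf{t}$ and the normal jump term is omitted. *)

theory Defs
  imports "HOL-Analysis.Analysis"
begin

type_synonym pt = "real^2"

section \<open>Domains\<close>

(* Near each boundary point the domain is, in suitable orthonormal coordinates (a, b),
   the strict epigraph of a Lipschitz function. *)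
definition lipschitz_domain :: "pt set \<Rightarrow> bool" where
  "lipschitz_domain \<Omega> \<longleftrightarrow> open \<Omega> \<and> connected \<Omega> \<and> bounded \<Omega> \<and> \<Omega> \<noteq> {} \<and>
     (\<forall>p\<in>frontier \<Omega>. \<exists>r>0. \<exists>L. \<exists>\<gamma>::real \<Rightarrow> real. \<exists>a b.
        norm a = 1 \<and> norm b = 1 \<and> a \<bullet> b = 0 \<and> L-lipschitz_on UNIV \<gamma> \<and>
        \<Omega> \<inter> ball p r = {x \<in> ball p r. \<gamma> ((x - p) \<bullet> a) < (x - p) \<bullet> b})"

definition lipschitz_polygon :: "pt set \<Rightarrow> bool" where
  "lipschitz_polygon \<Omega> \<longleftrightarrow> lipschitz_domain \<Omega> \<and>
     (\<exists>E. finite E \<and> frontier \<Omega> = (\<Union>(a, b)\<in>E. closed_segment a b))"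

section \<open>Classical differential operators\<close>

definition pd :: "2 \<Rightarrow> (pt \<Rightarrow> real) \<Rightarrow> pt \<Rightarrow> real" where
  "pd i f x = frechet_derivative f (at x) (axis i 1)"

definition grad :: "(pt \<Rightarrow> real) \<Rightarrow> pt \<Rightarrow> pt" where
  "grad f x = (\<chi> i. pd i f x)"

definition laplacian :: "(pt \<Rightarrow> real) \<Rightarrow> pt \<Rightarrow> real" where
  "laplacian f x = (\<Sum>i\<in>UNIV. pd i (pd i f) x)"

definition curl :: "(pt \<Rightarrow> pt) \<Rightarrow> pt \<Rightarrow> real" where
  "curl \<tau> x = pd 1 (\<lambda>y. \<tau> y $ 2) x - pd 2 (\<lambda>y. \<tau> y $ 1) x"

section \<open>Lebesgue and Sobolev spaces\<close>

(* Elements of the function spaces are representatives of the usual classes modulo null sets. *)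

definition L2 :: "pt set \<Rightarrow> (pt \<Rightarrow> 'b::euclidean_space) set" where
  "L2 A = {f. f \<in> borel_measurable (lebesgue_on A) \<and>
              integrable (lebesgue_on A) (\<lambda>x. (norm (f x))\<^sup>2)}"

definition l2_inner ::
    "pt set \<Rightarrow> (pt \<Rightarrow> 'b::euclidean_space) \<Rightarrow> (pt \<Rightarrow> 'b) \<Rightarrow> real" where
  "l2_inner A f g = (\<integral>x. f x \<bullet> g x \<partial>lebesgue_on A)"

definition l2_norm :: "pt set \<Rightarrow> (pt \<Rightarrow> 'b::euclidean_space) \<Rightarrow> real" where
  "l2_norm A f = sqrt (l2_inner A f f)"

primrec times_cont_diff :: "nat \<Rightarrow> (pt \<Rightarrow> real) \<Rightarrow> bool" where
  "times_cont_diff 0 f \<longleftrightarrow> continuous_on UNIV f"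
| "times_cont_diff (Suc n) f \<longleftrightarrow> (\<forall>x. f differentiable at x) \<and> (\<forall>i. times_cont_diff n (pd i f))"

(* smooth functions with compact support in \<Omega>, extended by zero to the plane *)
definition test_funs :: "pt set \<Rightarrow> (pt \<Rightarrow> real) set" where
  "test_funs \<Omega> = {\<phi>. (\<forall>n. times_cont_diff n \<phi>) \<and>
     compact (closure {x. \<phi> x \<noteq> 0}) \<and> closure {x. \<phi> x \<noteq> 0} \<subseteq> \<Omega>}"

definition has_weak_grad :: "pt set \<Rightarrow> (pt \<Rightarrow> real) \<Rightarrow> (pt \<Rightarrow> pt) \<Rightarrow> bool" where
  "has_weak_grad \<Omega> u g \<longleftrightarrow>
     (\<forall>\<phi>\<in>test_funs \<Omega>. \<forall>i. l2_inner \<Omega> u (pd i \<phi>) = - l2_inner \<Omega> (\<lambda>x. g x $ i) \<phi>)"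

definition has_weak_div :: "pt set \<Rightarrow> (pt \<Rightarrow> pt) \<Rightarrow> (pt \<Rightarrow> real) \<Rightarrow> bool" where
  "has_weak_div \<Omega> \<tau> d \<longleftrightarrow>
     (\<forall>\<phi>\<in>test_funs \<Omega>. l2_inner \<Omega> \<tau> (grad \<phi>) = - l2_inner \<Omega> d \<phi>)"

(* Weak derivatives are determined only almost everywhere; the choice of a representative
   does not affect any of the integrals below. *)
definition weak_grad :: "pt set \<Rightarrow> (pt \<Rightarrow> real) \<Rightarrow> pt \<Rightarrow> pt" where
  "weak_grad \<Omega> u = (SOME g. g \<in> L2 \<Omega> \<and> has_weak_grad \<Omega> u g)"

definition weak_div :: "pt set \<Rightarrow> (pt \<Rightarrow> pt) \<Rightarrow> pt \<Rightarrow> real" where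
  "weak_div \<Omega> \<tau> = (SOME d. d \<in> L2 \<Omega> \<and> has_weak_div \<Omega> \<tau> d)"

definition H1 :: "pt set \<Rightarrow> (pt \<Rightarrow> real) set" where
  "H1 \<Omega> = {u \<in> L2 \<Omega>. \<exists>g\<in>L2 \<Omega>. has_weak_grad \<Omega> u g}"

definition H1_norm :: "pt set \<Rightarrow> (pt \<Rightarrow> real) \<Rightarrow> real" where
  "H1_norm \<Omega> u = sqrt ((l2_norm \<Omega> u)\<^sup>2 + (l2_norm \<Omega> (weak_grad \<Omega> u))\<^sup>2)"

definition H10 :: "pt set \<Rightarrow> (pt \<Rightarrow> real) set" where
  "H10 \<Omega> = {u \<in> H1 \<Omega>. \<forall>\<epsilon>>0. \<exists>\<phi>\<in>test_funs \<Omega>. H1_norm \<Omega> (\<lambda>x. u x - \<phi> x) < \<epsilon>}"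

definition Hdiv :: "pt set \<Rightarrow> (pt \<Rightarrow> pt) set" where
  "Hdiv \<Omega> = {\<tau> \<in> L2 \<Omega>. \<exists>d\<in>L2 \<Omega>. has_weak_div \<Omega> \<tau> d}"

definition Hdiv_norm :: "pt set \<Rightarrow> (pt \<Rightarrow> pt) \<Rightarrow> real" where
  "Hdiv_norm \<Omega> \<tau> = sqrt ((l2_norm \<Omega> \<tau>)\<^sup>2 + (l2_norm \<Omega> (weak_div \<Omega> \<tau>))\<^sup>2)"

section \<open>The least-squares eigenvalue problem\<close>

(* The continuous problem is the case S = Hdiv \<Omega>, U = H10 \<Omega>; finite element
   subspaces S and U give the discrete problem. *)
definition ls_eigen_solution ::
    "pt set \<Rightarrow> (pt \<Rightarrow> pt) set \<Rightarrow> (pt \<Rightarrow> real) set \<Rightarrow> real \<Rightarrow> (pt \<Rightarrow> pt) \<Rightarrow> (pt \<Rightarrow> real) \<Rightarrow> bool" where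
  "ls_eigen_solution \<Omega> S U lam \<sigma> u \<longleftrightarrow>
     \<sigma> \<in> S \<and> u \<in> U \<and> \<not> (AE x in lebesgue_on \<Omega>. u x = 0) \<and>
     (\<forall>\<tau>\<in>S. l2_inner \<Omega> \<sigma> \<tau> + l2_inner \<Omega> (weak_div \<Omega> \<sigma>) (weak_div \<Omega> \<tau>)
              - l2_inner \<Omega> (weak_grad \<Omega> u) \<tau> = - lam * l2_inner \<Omega> u (weak_div \<Omega> \<tau>)) \<and>
     (\<forall>v\<in>U. - l2_inner \<Omega> \<sigma> (weak_grad \<Omega> v)
              + l2_inner \<Omega> (weak_grad \<Omega> u) (weak_grad \<Omega> v) = 0)"

definition ls_eigenfunction :: "pt set \<Rightarrow> real \<Rightarrow> (pt \<Rightarrow> real) \<Rightarrow> bool" where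
  "ls_eigenfunction \<Omega> lam u \<longleftrightarrow> (\<exists>\<sigma>. ls_eigen_solution \<Omega> (Hdiv \<Omega>) (H10 \<Omega>) lam \<sigma> u)"

definition simple_ls_eigenvalue :: "pt set \<Rightarrow> real \<Rightarrow> bool" where
  "simple_ls_eigenvalue \<Omega> lam \<longleftrightarrow> (\<exists>u. ls_eigenfunction \<Omega> lam u) \<and>
     (\<forall>u v. ls_eigenfunction \<Omega> lam u \<and> ls_eigenfunction \<Omega> lam v \<longrightarrow>
        (\<exists>c. AE x in lebesgue_on \<Omega>. v x = c * u x))"

section \<open>Meshes\<close>

(* Mesh elements are closed triangles; triangulation includes conformity, that is,
   two elements meet in a common (possibly empty) face. *)
definition triangle_mesh :: "pt set \<Rightarrow> pt set set \<Rightarrow> bool" where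
  "triangle_mesh \<Omega> \<T> \<longleftrightarrow> triangulation \<T> \<and> (\<forall>T\<in>\<T>. 2 simplex T) \<and> \<Union>\<T> = closure \<Omega>"

definition mesh_size :: "pt set set \<Rightarrow> real" where
  "mesh_size \<T> = Max (diameter ` \<T>)"

(* diameter of the largest disk contained in T *)
definition disk_diam :: "pt set \<Rightarrow> real" where
  "disk_diam T = Sup {2 * r |r. 0 \<le> r \<and> (\<exists>x. cball x r \<subseteq> T)}"

(* The family is indexed by the mesh sizes h in H, which accumulate at 0. *)
definition shape_regular_family :: "pt set \<Rightarrow> real set \<Rightarrow> (real \<Rightarrow> pt set set) \<Rightarrow> bool" where
  "shape_regular_family \<Omega> H \<T> \<longleftrightarrow>
     H \<subseteq> {0<..} \<and> 0 islimpt H \<and>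
     (\<forall>h\<in>H. triangle_mesh \<Omega> (\<T> h) \<and> mesh_size (\<T> h) = h) \<and>
     (\<exists>\<kappa>. \<forall>h\<in>H. \<forall>T\<in>\<T> h. diameter T \<le> \<kappa> * disk_diam T)"

section \<open>Edges\<close>

(* Endpoints in an arbitrary order: reversing it changes the signs of tangent and normal,
   which does not affect the norms of jumps. *)
definition edge_ends :: "pt set \<Rightarrow> pt \<times> pt" where
  "edge_ends e = (SOME (a, b). a \<noteq> b \<and> e = closed_segment a b)"

definition edge_tangent :: "pt set \<Rightarrow> pt" where
  "edge_tangent e = (case edge_ends e of (a, b) \<Rightarrow> (b - a) /\<^sub>R norm (b - a))"

definition edge_normal :: "pt set \<Rightarrow> pt" where
  "edge_normal e = vector [edge_tangent e $ 2, - (edge_tangent e $ 1)]"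

(* squared L2 norm on a segment with respect to arc length; its length is its diameter *)
definition edge_norm_sq :: "pt set \<Rightarrow> (pt \<Rightarrow> real) \<Rightarrow> real" where
  "edge_norm_sq e g =
     (\<integral>s. (g (fst (edge_ends e) + s *\<^sub>R edge_tangent e))\<^sup>2 \<partial>lebesgue_on {0..diameter e})"

definition edge_trace :: "pt set \<Rightarrow> (pt \<Rightarrow> real) \<Rightarrow> pt \<Rightarrow> real" where
  "edge_trace T w x = Lim (at x within interior T) w"

definition neighbour :: "pt set set \<Rightarrow> pt set \<Rightarrow> pt set \<Rightarrow> pt set" where
  "neighbour \<T> T e = (THE T'. T' \<in> \<T> \<and> T' \<noteq> T \<and> e edge_of T')"

definition jump :: "pt set \<Rightarrow> pt set set \<Rightarrow> pt set \<Rightarrow> pt set \<Rightarrow> (pt \<Rightarrow> real) \<Rightarrow> pt \<Rightarrow> real" where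
  "jump \<Omega> \<T> T e w x =
     (if e \<subseteq> frontier \<Omega> then edge_trace T w x
      else edge_trace T w x - edge_trace (neighbour \<T> T e) w x)"

section \<open>Finite element spaces\<close>

definition polys :: "nat \<Rightarrow> (pt \<Rightarrow> real) set" where
  "polys k = {p. \<exists>c :: nat \<Rightarrow> nat \<Rightarrow> real.
     \<forall>x. p x = (\<Sum>(i, j)\<in>{(i, j). i + j \<le> k}. c i j * (x $ 1) ^ i * (x $ 2) ^ j)}"

definition vpolys :: "nat \<Rightarrow> (pt \<Rightarrow> pt) set" where
  "vpolys k = {q. \<forall>i. (\<lambda>x. q x $ i) \<in> polys k}"

(* The part of r of degree below k contributes only elements of vpolys k, so this equals
   the usual sum with homogeneous r of degree k. *)
definition rt_polys :: "nat \<Rightarrow> (pt \<Rightarrow> pt) set" where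
  "rt_polys k = {\<lambda>x. q x + r x *\<^sub>R x |q r. q \<in> vpolys k \<and> r \<in> polys k}"

definition bdfm_polys :: "nat \<Rightarrow> pt set \<Rightarrow> (pt \<Rightarrow> pt) set" where
  "bdfm_polys k T = {q \<in> vpolys (k + 1). \<forall>e. e edge_of T \<longrightarrow>
     (\<exists>p\<in>polys k. \<forall>x\<in>e. q x \<bullet> edge_normal e = p x)}"

(* vector fields in Hdiv \<Omega> whose restriction to each element T lies in P T *)
definition hdiv_fe ::
    "pt set \<Rightarrow> pt set set \<Rightarrow> (pt set \<Rightarrow> (pt \<Rightarrow> pt) set) \<Rightarrow> (pt \<Rightarrow> pt) set" where
  "hdiv_fe \<Omega> \<T> P = {\<tau> \<in> Hdiv \<Omega>. \<forall>T\<in>\<T>. \<exists>q\<in>P T. \<forall>x\<in>interior T. \<tau> x = q x}"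

definition RT_space :: "pt set \<Rightarrow> pt set set \<Rightarrow> nat \<Rightarrow> (pt \<Rightarrow> pt) set" where
  "RT_space \<Omega> \<T> k = hdiv_fe \<Omega> \<T> (\<lambda>T. rt_polys k)"

definition BDM_space :: "pt set \<Rightarrow> pt set set \<Rightarrow> nat \<Rightarrow> (pt \<Rightarrow> pt) set" where
  "BDM_space \<Omega> \<T> k = hdiv_fe \<Omega> \<T> (\<lambda>T. vpolys k)"

definition BDFM_space :: "pt set \<Rightarrow> pt set set \<Rightarrow> nat \<Rightarrow> (pt \<Rightarrow> pt) set" where
  "BDFM_space \<Omega> \<T> k = hdiv_fe \<Omega> \<T> (bdfm_polys k)"

definition fun_subspace :: "(pt \<Rightarrow> pt) set \<Rightarrow> bool" where
  "fun_subspace P \<longleftrightarrow> (\<lambda>x. 0) \<in> P \<and> (\<forall>p\<in>P. \<forall>q\<in>P. (\<lambda>x. p x + q x) \<in> P) \<and>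
     (\<forall>c. \<forall>p\<in>P. (\<lambda>x. c *\<^sub>R p x) \<in> P)"

(* The standard mixed families of index k on triangles have local spaces between RT_k and
   the full vector polynomials of degree k + 1: see the instances RT_k, BDM_{k+1} and BDFM_{k+1}
   below. *)
definition mixed_fe_space :: "pt set \<Rightarrow> pt set set \<Rightarrow> nat \<Rightarrow> (pt \<Rightarrow> pt) set \<Rightarrow> bool" where
  "mixed_fe_space \<Omega> \<T> k S \<longleftrightarrow>
     (\<exists>P. (\<forall>T\<in>\<T>. fun_subspace (P T) \<and> rt_polys k \<subseteq> P T \<and> P T \<subseteq> vpolys (k + 1)) \<and>
          S = hdiv_fe \<Omega> \<T> P)"

(* For continuous piecewise polynomials, membership in H10 \<Omega> is equivalent to
   vanishing on the boundary. *)
definition lagrange_space :: "pt set \<Rightarrow> pt set set \<Rightarrow> nat \<Rightarrow> (pt \<Rightarrow> real) set" where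
  "lagrange_space \<Omega> \<T> m = {v \<in> H10 \<Omega>. continuous_on (closure \<Omega>) v \<and>
     (\<forall>x\<in>frontier \<Omega>. v x = 0) \<and> (\<forall>T\<in>\<T>. \<exists>p\<in>polys m. \<forall>x\<in>T. v x = p x)}"

section \<open>The error estimator\<close>

definition estimator_local_sq ::
    "pt set \<Rightarrow> pt set set \<Rightarrow> (pt \<Rightarrow> pt) \<Rightarrow> (pt \<Rightarrow> real) \<Rightarrow> pt set \<Rightarrow> real" where
  "estimator_local_sq \<Omega> \<T> \<sigma> u T =
     (diameter T)\<^sup>2 * (l2_norm T (\<lambda>x. weak_div \<Omega> \<sigma> x - laplacian u x))\<^sup>2
   + (diameter T)\<^sup>2 * (l2_norm T (curl \<sigma>))\<^sup>2
   + (\<Sum>e | e edge_of T. diameter e *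
        (edge_norm_sq e (jump \<Omega> \<T> T e (\<lambda>x. \<sigma> x \<bullet> edge_tangent e))
         + (if e \<subseteq> frontier \<Omega> then 0
            else edge_norm_sq e (jump \<Omega> \<T> T e (\<lambda>x. grad u x \<bullet> edge_normal e)))))"

definition estimator ::
    "pt set \<Rightarrow> pt set set \<Rightarrow> (pt \<Rightarrow> pt) \<Rightarrow> (pt \<Rightarrow> real) \<Rightarrow> real" where
  "estimator \<Omega> \<T> \<sigma> u = sqrt (\<Sum>T\<in>\<T>. estimator_local_sq \<Omega> \<T> \<sigma> u T)"

section \<open>Raviart-Thomas, BDM and BDFM spaces are mixed finite element spaces\<close>

lemma finite_poly_index: "finite {(i, j). i + j \<le> (k::nat)}"
  by (rule finite_subset[of _ "{..k} \<times> {..k}"]) auto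

lemma polysI:
  "(\<And>x. p x = (\<Sum>(i, j)\<in>{(i, j). i + j \<le> k}. c i j * (x $ 1) ^ i * (x $ 2) ^ j)) \<Longrightarrow> p \<in> polys k"
  unfolding polys_def by blast

lemma polys_zero: "(\<lambda>x. 0) \<in> polys k"
  unfolding polys_def by (auto intro!: exI[of _ "\<lambda>i j. 0"] simp: case_prod_unfold)

lemma polys_add:
  assumes "p \<in> polys k" "q \<in> polys k" shows "(\<lambda>x. p x + q x) \<in> polys k"
proof -
  obtain c d where c: "\<And>x. p x = (\<Sum>(i, j)\<in>{(i, j). i + j \<le> k}. c i j * (x $ 1) ^ i * (x $ 2) ^ j)"
    and d: "\<And>x. q x = (\<Sum>(i, j)\<in>{(i, j). i + j \<le> k}. d i j * (x $ 1) ^ i * (x $ 2) ^ j)"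
    using assms unfolding polys_def by blast
  have "p x + q x = (\<Sum>(i, j)\<in>{(i, j). i + j \<le> k}. (c i j + d i j) * (x $ 1) ^ i * (x $ 2) ^ j)" for x
    unfolding c d sum.distrib[symmetric] by (rule sum.cong) (auto simp: distrib_right)
  then show ?thesis by (rule polysI[where c = "\<lambda>i j. c i j + d i j"])
qed

lemma polys_scale:
  assumes "p \<in> polys k" shows "(\<lambda>x. a * p x) \<in> polys k"
proof -
  obtain c where c: "\<And>x. p x = (\<Sum>(i, j)\<in>{(i, j). i + j \<le> k}. c i j * (x $ 1) ^ i * (x $ 2) ^ j)"
    using assms unfolding polys_def by blast
  have "a * p x = (\<Sum>(i, j)\<in>{(i, j). i + j \<le> k}. (a * c i j) * (x $ 1) ^ i * (x $ 2) ^ j)" for x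
    unfolding c sum_distrib_left by (rule sum.cong) (auto simp: mult.assoc)
  then show ?thesis by (rule polysI[where c = "\<lambda>i j. a * c i j"])
qed

lemma polys_mono:
  assumes "p \<in> polys k" "k \<le> l" shows "p \<in> polys l"
proof -
  obtain c where c: "\<And>x. p x = (\<Sum>(i, j)\<in>{(i, j). i + j \<le> k}. c i j * (x $ 1) ^ i * (x $ 2) ^ j)"
    using assms unfolding polys_def by blast
  have "p x = (\<Sum>(i, j)\<in>{(i, j). i + j \<le> l}.
      (if i + j \<le> k then c i j else 0) * (x $ 1) ^ i * (x $ 2) ^ j)" for x
    unfolding c using assms(2)
    by (intro sum.mono_neutral_cong_left finite_poly_index) (auto split: if_splits)
  then show ?thesis by (rule polysI[where c = "\<lambda>i j. if i + j \<le> k then c i j else 0"])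
qed

lemma polys_mult_coord:
  assumes "p \<in> polys k" shows "(\<lambda>x. p x * x $ n) \<in> polys (k + 1)"
proof -
  obtain c where c: "\<And>x. p x = (\<Sum>(i, j)\<in>{(i, j). i + j \<le> k}. c i j * (x $ 1) ^ i * (x $ 2) ^ j)"
    using assms unfolding polys_def by blast
  consider "n = 1" | "n = 2" using exhaust_2 by blast
  then show ?thesis
  proof cases
    case 1
    have "p x * x $ 1 = (\<Sum>(i, j)\<in>{(i, j). i + j \<le> k + 1}.
        (if i = 0 then 0 else c (i - 1) j) * (x $ 1) ^ i * (x $ 2) ^ j)" for x
    proof -
      have "p x * x $ 1 = (\<Sum>(i, j)\<in>{(i, j). i + j \<le> k}. c i j * (x $ 1) ^ Suc i * (x $ 2) ^ j)"
        unfolding c by (simp add: sum_distrib_right sum_distrib_left case_prod_unfold algebra_simps)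
      also have "\<dots> = (\<Sum>(i, j)\<in>(\<lambda>(i, j). (Suc i, j)) ` {(i, j). i + j \<le> k}.
          (if i = 0 then 0 else c (i - 1) j) * (x $ 1) ^ i * (x $ 2) ^ j)"
        by (subst sum.reindex) (auto simp: inj_on_def case_prod_unfold)
      also have "\<dots> = (\<Sum>(i, j)\<in>{(i, j). i + j \<le> k + 1}.
          (if i = 0 then 0 else c (i - 1) j) * (x $ 1) ^ i * (x $ 2) ^ j)"
      proof (rule sum.mono_neutral_left[OF finite_poly_index])
        have "(a, b) \<in> (\<lambda>(i, j). (Suc i, j)) ` {(i, j). i + j \<le> k}" if "a + b \<le> k + 1" "a \<noteq> 0" for a b
          using that by (intro image_eqI[of _ _ "(a - 1, b)"]) auto
        then show "\<forall>z\<in>{(i, j). i + j \<le> k + 1} - (\<lambda>(i, j). (Suc i, j)) ` {(i, j). i + j \<le> k}.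
            (case z of (i, j) \<Rightarrow> (if i = 0 then 0 else c (i - 1) j) * (x $ 1) ^ i * (x $ 2) ^ j) = 0"
          by fastforce
      qed auto
      finally show ?thesis .
    qed
    then show ?thesis unfolding 1 by (rule polysI[where c = "\<lambda>i j. if i = 0 then 0 else c (i - 1) j"])
  next
    case 2
    have "p x * x $ 2 = (\<Sum>(i, j)\<in>{(i, j). i + j \<le> k + 1}.
        (if j = 0 then 0 else c i (j - 1)) * (x $ 1) ^ i * (x $ 2) ^ j)" for x
    proof -
      have "p x * x $ 2 = (\<Sum>(i, j)\<in>{(i, j). i + j \<le> k}. c i j * (x $ 1) ^ i * (x $ 2) ^ Suc j)"
        unfolding c by (simp add: sum_distrib_right sum_distrib_left case_prod_unfold algebra_simps)
      also have "\<dots> = (\<Sum>(i, j)\<in>(\<lambda>(i, j). (i, Suc j)) ` {(i, j). i + j \<le> k}.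
          (if j = 0 then 0 else c i (j - 1)) * (x $ 1) ^ i * (x $ 2) ^ j)"
        by (subst sum.reindex) (auto simp: inj_on_def case_prod_unfold)
      also have "\<dots> = (\<Sum>(i, j)\<in>{(i, j). i + j \<le> k + 1}.
          (if j = 0 then 0 else c i (j - 1)) * (x $ 1) ^ i * (x $ 2) ^ j)"
      proof (rule sum.mono_neutral_left[OF finite_poly_index])
        have "(a, b) \<in> (\<lambda>(i, j). (i, Suc j)) ` {(i, j). i + j \<le> k}" if "a + b \<le> k + 1" "b \<noteq> 0" for a b
          using that by (intro image_eqI[of _ _ "(a, b - 1)"]) auto
        then show "\<forall>z\<in>{(i, j). i + j \<le> k + 1} - (\<lambda>(i, j). (i, Suc j)) ` {(i, j). i + j \<le> k}.
            (case z of (i, j) \<Rightarrow> (if j = 0 then 0 else c i (j - 1)) * (x $ 1) ^ i * (x $ 2) ^ j) = 0"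
          by fastforce
      qed auto
      finally show ?thesis .
    qed
    then show ?thesis unfolding 2 by (rule polysI[where c = "\<lambda>i j. if j = 0 then 0 else c i (j - 1)"])
  qed
qed

lemma fun_subspace_vpolys: "fun_subspace (vpolys k)"
  unfolding fun_subspace_def vpolys_def by (auto intro: polys_zero polys_add polys_scale)

lemma fun_subspace_rt: "fun_subspace (rt_polys k)"
proof -
  have *: "(\<lambda>x. q x + r x *\<^sub>R x) \<in> rt_polys k" if "q \<in> vpolys k" "r \<in> polys k" for q r
    using that unfolding rt_polys_def by blast
  have V: "fun_subspace (vpolys k)" by (rule fun_subspace_vpolys)
  have "(\<lambda>x. 0) \<in> rt_polys k"
    using *[of "\<lambda>x. 0" "\<lambda>x. 0"] V polys_zero unfolding fun_subspace_def by simp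
  moreover have "(\<lambda>x. p x + p' x) \<in> rt_polys k" if pp: "p \<in> rt_polys k" "p' \<in> rt_polys k" for p p'
  proof -
    obtain q r where 1: "p = (\<lambda>x. q x + r x *\<^sub>R x)" "q \<in> vpolys k" "r \<in> polys k"
      using pp(1) unfolding rt_polys_def by auto
    obtain q' r' where 2: "p' = (\<lambda>x. q' x + r' x *\<^sub>R x)" "q' \<in> vpolys k" "r' \<in> polys k"
      using pp(2) unfolding rt_polys_def by auto
    have "(\<lambda>x. (q x + q' x) + (r x + r' x) *\<^sub>R x) \<in> rt_polys k"
      using V 1 2 polys_add unfolding fun_subspace_def by (intro *) auto
    then show ?thesis unfolding 1 2 by (simp add: algebra_simps)
  qed
  moreover have "(\<lambda>x. c *\<^sub>R p x) \<in> rt_polys k" if pp: "p \<in> rt_polys k" for p c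
  proof -
    obtain q r where 1: "p = (\<lambda>x. q x + r x *\<^sub>R x)" "q \<in> vpolys k" "r \<in> polys k"
      using pp(1) unfolding rt_polys_def by auto
    have "(\<lambda>x. (c *\<^sub>R q x) + (c * r x) *\<^sub>R x) \<in> rt_polys k"
      using V 1 polys_scale unfolding fun_subspace_def by (intro *) auto
    then show ?thesis unfolding 1 by (simp add: algebra_simps)
  qed
  ultimately show ?thesis unfolding fun_subspace_def by blast
qed

lemma rt_subset_vpolys: "rt_polys k \<subseteq> vpolys (k + 1)"
proof
  fix p assume "p \<in> rt_polys k"
  then obtain q r where qr: "p = (\<lambda>x. q x + r x *\<^sub>R x)" "q \<in> vpolys k" "r \<in> polys k"
    unfolding rt_polys_def by auto
  have "(\<lambda>x. q x $ i + r x * x $ i) \<in> polys (k + 1)" for i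
    using qr by (intro polys_add polys_mult_coord polys_mono[of _ k "k + 1"]) (auto simp: vpolys_def)
  then show "p \<in> vpolys (k + 1)" unfolding vpolys_def qr by simp
qed

lemma edge_ends_edge:
  assumes "e edge_of T" "2 simplex T"
  shows "fst (edge_ends e) \<noteq> snd (edge_ends e)"
    "e = closed_segment (fst (edge_ends e)) (snd (edge_ends e))"
proof -
  have e: "e face_of T" "aff_dim e = 1" using assms(1) by (simp_all add: edge_of_def)
  have "polytope e"
    using face_of_polytope_polytope[OF simplex_imp_polytope[OF assms(2)] e(1)] .
  then have "compact e" "convex e" by (auto simp: polytope_imp_compact polytope_imp_convex)
  moreover have "collinear e" using e by (simp add: collinear_aff_dim)
  moreover have "e \<noteq> {}" using e by auto
  ultimately obtain a b where ab: "e = closed_segment a b"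
    using compact_convex_collinear_segment[of e] by blast
  moreover have "a \<noteq> b" using e(2) unfolding ab by auto
  ultimately have "case (a, b) of (a, b) \<Rightarrow> a \<noteq> b \<and> e = closed_segment a b" by blast
  then have "case edge_ends e of (a, b) \<Rightarrow> a \<noteq> b \<and> e = closed_segment a b"
    unfolding edge_ends_def by (rule someI)
  then show "fst (edge_ends e) \<noteq> snd (edge_ends e)"
    "e = closed_segment (fst (edge_ends e)) (snd (edge_ends e))"
    unfolding case_prod_unfold by blast+
qed

lemma polys_inner: "q \<in> vpolys k \<Longrightarrow> (\<lambda>x. q x \<bullet> n) \<in> polys k"
proof -
  assume "q \<in> vpolys k"
  then have "(\<lambda>x. n $ 1 * q x $ 1 + n $ 2 * q x $ 2) \<in> polys k"
    by (intro polys_add polys_scale) (auto simp: vpolys_def)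
  then show ?thesis by (simp add: inner_vec_def sum_2 mult.commute)
qed

lemma fun_subspace_bdfm: "fun_subspace (bdfm_polys k T)"
proof -
  have V: "fun_subspace (vpolys (k + 1))" by (rule fun_subspace_vpolys)
  have "(\<lambda>x. p x + q x) \<in> bdfm_polys k T" if pq: "p \<in> bdfm_polys k T" "q \<in> bdfm_polys k T" for p q
  proof -
    have "\<exists>r\<in>polys k. \<forall>x\<in>e. (p x + q x) \<bullet> edge_normal e = r x" if e: "e edge_of T" for e
    proof -
      obtain r s where "r \<in> polys k" "s \<in> polys k"
        "\<forall>x\<in>e. p x \<bullet> edge_normal e = r x" "\<forall>x\<in>e. q x \<bullet> edge_normal e = s x"
        using e pq unfolding bdfm_polys_def by blast
      then show ?thesis
        by (intro bexI[OF _ polys_add[of r k s]]) (auto simp: inner_add_left)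
    qed
    then show ?thesis using pq V unfolding bdfm_polys_def fun_subspace_def by auto
  qed
  moreover have "(\<lambda>x. c *\<^sub>R p x) \<in> bdfm_polys k T" if p: "p \<in> bdfm_polys k T" for p c
  proof -
    have "\<exists>r\<in>polys k. \<forall>x\<in>e. (c *\<^sub>R p x) \<bullet> edge_normal e = r x" if e: "e edge_of T" for e
    proof -
      obtain r where "r \<in> polys k" "\<forall>x\<in>e. p x \<bullet> edge_normal e = r x"
        using e p unfolding bdfm_polys_def by blast
      then show ?thesis by (intro bexI[OF _ polys_scale[of r k c]]) auto
    qed
    then show ?thesis using p V unfolding bdfm_polys_def fun_subspace_def by auto
  qed
  moreover have "(\<lambda>x. 0) \<in> bdfm_polys k T"
    using V polys_zero unfolding bdfm_polys_def fun_subspace_def by auto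
  ultimately show ?thesis unfolding fun_subspace_def by blast
qed

lemma rt_subset_bdfm:
  assumes "2 simplex T" shows "rt_polys k \<subseteq> bdfm_polys k T"
proof
  fix p assume p: "p \<in> rt_polys k"
  then obtain q r where qr: "p = (\<lambda>x. q x + r x *\<^sub>R x)" "q \<in> vpolys k" "r \<in> polys k"
    unfolding rt_polys_def by auto
  have "\<exists>s\<in>polys k. \<forall>x\<in>e. (q x + r x *\<^sub>R x) \<bullet> edge_normal e = s x" if e: "e edge_of T" for e
  proof -
    define a where "a = fst (edge_ends e)"
    define b where "b = snd (edge_ends e)"
    have ab: "e = closed_segment a b" unfolding a_def b_def by (rule edge_ends_edge(2)[OF e assms])
    have tan: "edge_tangent e = (b - a) /\<^sub>R norm (b - a)"
      by (simp add: edge_tangent_def case_prod_unfold a_def b_def)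
    have perp: "(b - a) \<bullet> edge_normal e = 0"
      unfolding edge_normal_def tan by (simp add: inner_vec_def sum_2)
    have const: "x \<bullet> edge_normal e = a \<bullet> edge_normal e" if x: "x \<in> e" for x
    proof -
      have "x \<in> closed_segment a b" using x ab by blast
      then obtain t where "x = (1 - t) *\<^sub>R a + t *\<^sub>R b" unfolding closed_segment_def by blast
      then have "x = a + t *\<^sub>R (b - a)" by (simp add: algebra_simps)
      then show ?thesis using perp by (simp add: inner_add_left)
    qed
    have "(\<lambda>x. q x \<bullet> edge_normal e + (a \<bullet> edge_normal e) * r x) \<in> polys k"
      by (intro polys_add polys_scale polys_inner qr)
    then show ?thesis
      by (rule bexI[rotated]) (simp add: inner_add_left const mult.commute)
  qed
  moreover have "p \<in> vpolys (k + 1)" using p rt_subset_vpolys by blast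
  ultimately show "p \<in> bdfm_polys k T" unfolding bdfm_polys_def qr(1) by blast
qed

lemma mixed_fe_spaceI:
  assumes "\<And>T. T \<in> \<T> \<Longrightarrow> fun_subspace (P T)" "\<And>T. T \<in> \<T> \<Longrightarrow> rt_polys k \<subseteq> P T"
    "\<And>T. T \<in> \<T> \<Longrightarrow> P T \<subseteq> vpolys (k + 1)"
  shows "mixed_fe_space \<Omega> \<T> k (hdiv_fe \<Omega> \<T> P)"
  unfolding mixed_fe_space_def by (rule exI[of _ P]) (simp add: assms[simplified])

lemma mixed_fe_space_RT: "mixed_fe_space \<Omega> \<T> k (RT_space \<Omega> \<T> k)"
  unfolding RT_space_def
  by (rule mixed_fe_spaceI) (rule fun_subspace_rt order_refl rt_subset_vpolys)+

lemma mixed_fe_space_BDM: "mixed_fe_space \<Omega> \<T> k (BDM_space \<Omega> \<T> (k + 1))"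
  unfolding BDM_space_def
  by (rule mixed_fe_spaceI) (rule fun_subspace_vpolys order_refl rt_subset_vpolys)+

lemma mixed_fe_space_BDFM:
  assumes "triangle_mesh \<Omega> \<T>" shows "mixed_fe_space \<Omega> \<T> k (BDFM_space \<Omega> \<T> k)"
  unfolding BDFM_space_def
proof (rule mixed_fe_spaceI)
  fix T assume "T \<in> \<T>"
  then have "2 simplex T" using assms by (simp add: triangle_mesh_def)
  then show "rt_polys k \<subseteq> bdfm_polys k T" by (rule rt_subset_bdfm)
  show "fun_subspace (bdfm_polys k T)" by (rule fun_subspace_bdfm)
  show "bdfm_polys k T \<subseteq> vpolys (k + 1)" by (auto simp: bdfm_polys_def)
qed

end

(* No bubble functions are needed.  Since u_h is continuous and vanishes on the boundary, its tangential
   derivative does not jump; since sigma_h lies in H(div), its normal component does not jump; and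
   curl grad = 0.  Hence every term of the estimator is a derivative or a jump of sigma_h - grad u_h, and
   polynomial inverse and trace inequalities on shape-regular triangles bound eta_h by
   C |sigma_h - grad u_h| in L2.  For the continuous solution, sigma - grad u is divergence free by the
   second equation, so testing the first equation with it gives sigma = grad u.  Therefore
   sigma_h - grad u_h = (sigma_h - sigma) + grad (u - u_h).  The weak derivatives of the discrete
   functions are identified with the elementwise ones by testing with smooth bump functions. *)
theory Submission
  imports Defs
begin

section \<open>Polynomials\<close>

definition poly_index :: "nat \<Rightarrow> (nat \<times> nat) set" where
  "poly_index k = {(i, j). i + j \<le> k}"

definition mon :: "nat \<times> nat \<Rightarrow> pt \<Rightarrow> real" where
  "mon a x = (x $ 1) ^ fst a * (x $ 2) ^ snd a"

lemma finite_monomials [simp]: "finite (poly_index k)"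
  unfolding poly_index_def by (rule finite_poly_index)

lemma polys_iff: "p \<in> polys k \<longleftrightarrow> (\<exists>c. p = (\<lambda>x. \<Sum>a\<in>poly_index k. c a * mon a x))"
proof
  assume "p \<in> polys k"
  then obtain c where "\<And>x. p x = (\<Sum>(i, j)\<in>{(i, j). i + j \<le> k}. c i j * (x $ 1) ^ i * (x $ 2) ^ j)"
    unfolding polys_def by blast
  then have "p = (\<lambda>x. \<Sum>a\<in>poly_index k. (\<lambda>(i, j). c i j) a * mon a x)"
    by (auto simp: poly_index_def mon_def case_prod_unfold mult.assoc)
  then show "\<exists>c. p = (\<lambda>x. \<Sum>a\<in>poly_index k. c a * mon a x)" by blast
next
  assume "\<exists>c. p = (\<lambda>x. \<Sum>a\<in>poly_index k. c a * mon a x)"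
  then obtain c where c: "p = (\<lambda>x. \<Sum>a\<in>poly_index k. c a * mon a x)" by blast
  show "p \<in> polys k"
    by (rule polysI[where c = "\<lambda>i j. c (i, j)"])
      (simp add: c poly_index_def mon_def case_prod_unfold mult.assoc)
qed

lemma polys_sum:
  assumes "\<And>a. a \<in> A \<Longrightarrow> f a \<in> polys k"
  shows "(\<lambda>x. \<Sum>a\<in>A. f a x) \<in> polys k"
  using assms
proof (induction A rule: infinite_finite_induct)
  case (insert a A)
  then have "(\<lambda>x. f a x + (\<Sum>a\<in>A. f a x)) \<in> polys k"
    by (intro polys_add) auto
  with insert show ?case by simp
qed (simp_all add: polys_zero)

lemma polys_const: "(\<lambda>x. c) \<in> polys k"
proof -
  have "(\<lambda>x. c) = (\<lambda>x::pt. \<Sum>a\<in>{(0, 0)}. c * mon a x)" by (simp add: mon_def)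
  moreover have "\<dots> = (\<lambda>x. \<Sum>a\<in>poly_index k. (if a = (0, 0) then c else 0) * mon a x)"
    by (intro ext sum.mono_neutral_cong_left) (auto simp: poly_index_def finite_poly_index)
  ultimately have "(\<lambda>x. c) = (\<lambda>x. \<Sum>a\<in>poly_index k. (if a = (0, 0) then c else 0) * mon a x)"
    by (rule trans)
  then show ?thesis unfolding polys_iff by (rule exI[of _ "\<lambda>a. if a = (0, 0) then c else 0"])
qed

lemma polys_affine_power:
  "(\<lambda>x. (a + c * x $ 1) ^ i * (b + c * x $ 2) ^ j) \<in> polys (i + j)"
proof (induction i)
  case 0
  show ?case
  proof (induction j)
    case (Suc j)
    have "(\<lambda>x. b * ((a + c * x $ 1) ^ 0 * (b + c * x $ 2) ^ j) +
        c * ((a + c * x $ 1) ^ 0 * (b + c * x $ 2) ^ j * x $ 2)) \<in> polys (0 + Suc j)"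
      using polys_add[OF polys_scale[OF polys_mono[OF Suc]] polys_scale[OF polys_mult_coord[OF Suc]]]
      by simp
    then show ?case by (simp add: algebra_simps)
  qed (simp add: polys_const)
next
  case (Suc i)
  have "(\<lambda>x. a * ((a + c * x $ 1) ^ i * (b + c * x $ 2) ^ j) +
      c * ((a + c * x $ 1) ^ i * (b + c * x $ 2) ^ j * x $ 1)) \<in> polys (Suc i + j)"
    using polys_add[OF polys_scale[OF polys_mono[OF Suc]] polys_scale[OF polys_mult_coord[OF Suc]]]
    by simp
  then show ?case by (simp add: algebra_simps)
qed

lemma mon_polys: "a \<in> poly_index k \<Longrightarrow> mon a \<in> polys k"
  using polys_affine_power[of 0 1 "fst a" 0 "snd a"]
  by (auto simp: mon_def[abs_def] poly_index_def intro: polys_mono)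

lemma polys_comp_affine:
  assumes "p \<in> polys k" shows "(\<lambda>x. p (x0 + c *\<^sub>R x)) \<in> polys k"
proof -
  obtain d where d: "p = (\<lambda>x. \<Sum>a\<in>poly_index k. d a * mon a x)"
    using assms polys_iff by blast
  have "(\<lambda>x. \<Sum>a\<in>poly_index k. d a * mon a (x0 + c *\<^sub>R x)) \<in> polys k"
  proof (intro polys_sum polys_scale)
    fix a assume "a \<in> poly_index k"
    then have "fst a + snd a \<le> k" by (auto simp: poly_index_def)
    then show "(\<lambda>x. mon a (x0 + c *\<^sub>R x)) \<in> polys k"
      using polys_mono[OF polys_affine_power[of "x0 $ 1" c "fst a" "x0 $ 2" "snd a"]]
      by (simp add: mon_def)
  qed
  then show ?thesis by (simp add: d)
qed

lemma polys_restrict_line: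
  assumes "p \<in> polys k" obtains P :: "real poly" where "\<And>s. p (a + s *\<^sub>R t) = poly P s"
proof -
  obtain d where d: "p = (\<lambda>x. \<Sum>a\<in>poly_index k. d a * mon a x)"
    using assms polys_iff by blast
  show thesis
    by (rule that[of "\<Sum>b\<in>poly_index k. smult (d b)
        ([:a $ 1, t $ 1:] ^ fst b * [:a $ 2, t $ 2:] ^ snd b)"])
      (simp add: d mon_def poly_sum)
qed

lemma polys_zero_on_segment:
  assumes "p \<in> polys k" "\<alpha> < \<beta>" "\<And>s. \<alpha> < s \<Longrightarrow> s < \<beta> \<Longrightarrow> p (a + s *\<^sub>R t) = 0"
  shows "p (a + s *\<^sub>R t) = 0"
proof -
  obtain P :: "real poly" where P: "\<And>s. p (a + s *\<^sub>R t) = poly P s"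
    using polys_restrict_line[OF assms(1)] by blast
  have "P = 0"
  proof (rule ccontr)
    assume "P \<noteq> 0"
    then have "finite {s. poly P s = 0}" by (rule poly_roots_finite)
    moreover have "{\<alpha><..<\<beta>} \<subseteq> {s. poly P s = 0}" using assms(3) P by auto
    ultimately show False using assms(2) infinite_Ioo finite_subset by blast
  qed
  then show ?thesis by (simp add: P)
qed

subsection \<open>Derivatives\<close>

lemma pd_eqI: "(f has_derivative D) (at x) \<Longrightarrow> pd i f x = D (axis i 1)"
  using frechet_derivative_at[of f D x] by (simp add: pd_def)

lemma differentiable_has_derivative_pd:
  assumes "f differentiable at x"
  shows "(f has_derivative (\<lambda>h. grad f x \<bullet> h)) (at x)"
proof -
  obtain D where D: "(f has_derivative D) (at x)" using assms by (auto simp: differentiable_def)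
  then have lin: "linear D" using has_derivative_linear by blast
  have "D h = grad f x \<bullet> h" for h
  proof -
    have "h = h $ 1 *\<^sub>R axis 1 1 + h $ 2 *\<^sub>R axis 2 1"
      by (simp add: vec_eq_iff forall_2 axis_def)
    then have "D h = D (h $ 1 *\<^sub>R axis 1 1 + h $ 2 *\<^sub>R axis 2 1)" by (rule arg_cong)
    also have "\<dots> = h $ 1 * D (axis 1 1) + h $ 2 * D (axis 2 1)"
      by (simp add: linear_add[OF lin] linear_scale[OF lin])
    finally
    show ?thesis by (simp add: grad_def inner_vec_def sum_2 pd_eqI[OF D] mult.commute)
  qed
  then have "D = (\<lambda>h. grad f x \<bullet> h)" by blast
  with D show ?thesis by simp
qed

lemma pd_cong_open:
  assumes "open A" "x \<in> A" "\<And>y. y \<in> A \<Longrightarrow> f y = g y"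
  shows "pd i f x = pd i g x"
proof -
  have "(f has_derivative D) (at x) \<longleftrightarrow> (g has_derivative D) (at x)" for D
    using has_derivative_transform_within_open[of _ _ x UNIV A] assms by metis
  then show ?thesis by (simp add: pd_def frechet_derivative_def)
qed

lemma pd_add:
  "f differentiable at x \<Longrightarrow> g differentiable at x \<Longrightarrow> pd i (\<lambda>x. f x + g x) x = pd i f x + pd i g x"
  by (simp add: pd_eqI[OF has_derivative_add[OF differentiable_has_derivative_pd
        differentiable_has_derivative_pd]] grad_def inner_axis)

lemma pd_mult:
  "f differentiable at x \<Longrightarrow> g differentiable at x \<Longrightarrow>
    pd i (\<lambda>x. f x * g x) x = pd i f x * g x + f x * pd i g x"
  by (simp add: pd_eqI[OF has_derivative_mult[OF differentiable_has_derivative_pd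
        differentiable_has_derivative_pd]] grad_def inner_axis)

lemma pd_const: "pd i (\<lambda>x. c) x = 0"
  by (simp add: pd_eqI[OF has_derivative_const])

lemma pd_cmult: "f differentiable at x \<Longrightarrow> pd i (\<lambda>x. c * f x) x = c * pd i f x"
  by (subst pd_mult) (simp_all add: pd_const)

lemma pd_diff:
  "f differentiable at x \<Longrightarrow> g differentiable at x \<Longrightarrow> pd i (\<lambda>x. f x - g x) x = pd i f x - pd i g x"
  by (simp add: pd_eqI[OF has_derivative_diff[OF differentiable_has_derivative_pd
        differentiable_has_derivative_pd]] grad_def inner_axis)

lemma pd_sum:
  assumes "\<And>a. a \<in> A \<Longrightarrow> f a differentiable at x"
  shows "pd i (\<lambda>x. \<Sum>a\<in>A. f a x) x = (\<Sum>a\<in>A. pd i (f a) x)"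
  using pd_eqI[OF has_derivative_sum[of A f "\<lambda>a h. grad (f a) x \<bullet> h",
        OF differentiable_has_derivative_pd[OF assms]], of i]
  by (simp add: grad_def inner_axis)

lemma coord_has_derivative: "((\<lambda>x::pt. x $ i) has_derivative (\<lambda>h. h $ i)) (at x)"
  by (rule bounded_linear_imp_has_derivative) (rule bounded_linear_vec_nth)

lemma mon_has_derivative:
  "(mon a has_derivative (\<lambda>h. (x $ 1) ^ fst a * (real (snd a) * ((x $ 2) ^ (snd a - 1)) * h $ 2) +
     real (fst a) * (x $ 1) ^ (fst a - 1) * h $ 1 * (x $ 2) ^ snd a)) (at x)"
  unfolding mon_def[abs_def]
  by (auto intro!: derivative_eq_intros coord_has_derivative simp: fun_eq_iff)

lemma mon_differentiable: "mon a differentiable at x"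
  by (rule differentiableI[OF mon_has_derivative])

lemma pd_mon:
  "pd i (mon a) = (\<lambda>x. if i = 1 then real (fst a) * mon (fst a - 1, snd a) x
     else real (snd a) * mon (fst a, snd a - 1) x)"
proof
  fix x
  have "i = 1 \<or> i = 2" using exhaust_2 by blast
  then show "pd i (mon a) x = (if i = 1 then real (fst a) * mon (fst a - 1, snd a) x
     else real (snd a) * mon (fst a, snd a - 1) x)"
    by (subst pd_eqI[OF mon_has_derivative]) (auto simp: mon_def axis_def)
qed

lemma polys_differentiable: "p \<in> polys k \<Longrightarrow> p differentiable at x"
  unfolding polys_iff
  by (elim exE) (simp add: differentiable_sum differentiable_mult mon_differentiable)

lemma pd_polys_eq:
  "pd i (\<lambda>x. \<Sum>a\<in>poly_index k. c a * mon a x) = (\<lambda>x. \<Sum>a\<in>poly_index k. c a * pd i (mon a) x)"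
  by (rule ext, subst pd_sum)
    (auto intro!: differentiable_mult mon_differentiable sum.cong simp: pd_cmult[OF mon_differentiable])

lemma polys_pd: assumes "p \<in> polys k" shows "pd i p \<in> polys k"
proof -
  obtain c where c: "p = (\<lambda>x. \<Sum>a\<in>poly_index k. c a * mon a x)"
    using assms polys_iff by blast
  show ?thesis unfolding c pd_polys_eq
  proof (intro polys_sum polys_scale)
    fix a assume "a \<in> poly_index k"
    then have "(fst a - 1, snd a) \<in> poly_index k" "(fst a, snd a - 1) \<in> poly_index k"
      by (auto simp: poly_index_def)
    then show "pd i (mon a) \<in> polys k"
      unfolding pd_mon by (cases "i = 1") (auto intro!: polys_scale mon_polys)
  qed
qed

lemma polys_continuous: "p \<in> polys k \<Longrightarrow> continuous_on A p"
  by (intro continuous_at_imp_continuous_on ballI differentiable_imp_continuous_within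
      polys_differentiable)

lemma polys_diff: "p \<in> polys k \<Longrightarrow> q \<in> polys k \<Longrightarrow> (\<lambda>x. p x - q x) \<in> polys k"
  using polys_add[OF _ polys_scale[of q k "-1"]] by simp

subsection \<open>Equivalence of norms\<close>

lemma continuous_integrable_compact:
  fixes f :: "pt \<Rightarrow> 'b::euclidean_space"
  assumes "compact S" "continuous_on S f"
  shows "integrable (lebesgue_on S) f"
proof -
  have "integrable lborel (\<lambda>x. indicator S x *\<^sub>R f x)"
    using borel_integrable_compact[of S f] assms by simp
  then have "integrable lebesgue (\<lambda>x. indicator S x *\<^sub>R f x)"
    by (subst integrable_completion) (auto dest: borel_measurable_integrable)
  then show ?thesis
    using assms(1) by (simp add: integrable_restrict_space lmeasurable_compact fmeasurableD)
qed

lemma integral_lebesgue_on_mono: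
  fixes f :: "pt \<Rightarrow> real"
  assumes "A \<subseteq> B" "A \<in> sets lebesgue" "B \<in> sets lebesgue" "integrable (lebesgue_on B) f" "\<And>x. f x \<ge> 0"
  shows "integral\<^sup>L (lebesgue_on A) f \<le> integral\<^sup>L (lebesgue_on B) f"
proof -
  have B: "integrable lebesgue (\<lambda>x. indicator B x * f x)"
    using assms by (simp add: integrable_restrict_space)
  then have "integrable lebesgue (\<lambda>x. indicator A x *\<^sub>R (indicator B x * f x))"
    by (rule integrable_mult_indicator[OF assms(2)])
  also have "(\<lambda>x. indicator A x *\<^sub>R (indicator B x * f x)) = (\<lambda>x. indicator A x * f x)"
    using assms(1) by (auto simp: indicator_def fun_eq_iff)
  finally have "(\<integral>x. indicator A x * f x \<partial>lebesgue) \<le> (\<integral>x. indicator B x * f x \<partial>lebesgue)"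
    using B by (rule integral_mono) (use assms in \<open>auto simp: indicator_def\<close>)
  then show ?thesis using assms by (simp add: integral_restrict_space)
qed

lemma AE_zero_imp_zero:
  fixes f :: "'a::euclidean_space \<Rightarrow> 'b::euclidean_space"
  assumes "AE x in lebesgue_on S. f x = 0" "S \<in> sets lebesgue"
    "open A" "A \<subseteq> S" "continuous_on A f" "x \<in> A"
  shows "f x = 0"
proof (rule ccontr)
  assume nz: "f x \<noteq> 0"
  define B where "B = {x \<in> A. f x \<noteq> 0}"
  have "open (A \<inter> f -` (- {0}))"
    using assms by (intro continuous_open_preimage) auto
  then have "open B" by (simp add: B_def vimage_def Int_def)
  moreover have "AE x in lebesgue. x \<in> S \<longrightarrow> f x = 0"
    using assms by (simp add: AE_restrict_space_iff)
  then have "AE x in lebesgue. x \<notin> B"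
    by eventually_elim (use assms in \<open>auto simp: B_def\<close>)
  then have "negligible B"
    using AE_iff_null_sets[of B lebesgue] \<open>open B\<close> by (simp add: negligible_iff_null_sets)
  ultimately show False using nz assms open_not_negligible by (fastforce simp: B_def)
qed

lemma power_sum_coeffs_zero:
  fixes d :: "nat \<Rightarrow> real"
  assumes "\<epsilon> > 0" "\<And>s. 0 < s \<Longrightarrow> s < \<epsilon> \<Longrightarrow> (\<Sum>i\<le>n. d i * s ^ i) = 0" "i \<le> n"
  shows "d i = 0"
proof -
  define P where "P = (\<Sum>i\<le>n. monom (d i) i)"
  have P: "poly P s = (\<Sum>i\<le>n. d i * s ^ i)" for s by (simp add: P_def poly_sum poly_monom)
  have "P = 0"
  proof (rule ccontr)
    assume "P \<noteq> 0"
    then have "finite {s. poly P s = 0}" by (rule poly_roots_finite)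
    moreover have "{0<..<\<epsilon>} \<subseteq> {s. poly P s = 0}" using assms(2) P by auto
    ultimately show False using assms(1) infinite_Ioo finite_subset by blast
  qed
  moreover have "coeff P i = d i"
    using assms(3) by (simp add: P_def coeff_sum)
  ultimately show ?thesis by simp
qed

lemma mon_coeffs_zero:
  assumes "\<epsilon> > 0" "\<And>x. x \<in> ball 0 \<epsilon> \<Longrightarrow> (\<Sum>a\<in>poly_index k. c a * mon a x) = 0" "a \<in> poly_index k"
  shows "c a = 0"
proof -
  have idx: "poly_index k = Sigma {..k} (\<lambda>i. {..k - i})" by (auto simp: poly_index_def)
  have inner: "(\<Sum>j\<le>k - i. c (i, j) * t ^ j) = 0" if t: "0 < t" "t < \<epsilon> / 2" and i: "i \<le> k" for i t
  proof (rule power_sum_coeffs_zero[where \<epsilon> = "\<epsilon> / 2" and n = k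
        and d = "\<lambda>i. \<Sum>j\<le>k - i. c (i, j) * t ^ j"])
    fix s assume s: "0 < s" "s < \<epsilon> / 2"
    define x :: pt where "x = vector [s, t]"
    have "norm x \<le> \<bar>x $ 1\<bar> + \<bar>x $ 2\<bar>"
      using norm_le_l1_cart[of x] by (simp add: sum_2)
    then have "x \<in> ball 0 \<epsilon>" using s t by (simp add: x_def)
    then have "(\<Sum>i\<le>k. \<Sum>j\<le>k - i. c (i, j) * (s ^ i * t ^ j)) = 0"
      using assms(2)[of x] unfolding idx by (subst sum.Sigma) (auto simp: mon_def x_def case_prod_unfold)
    then show "(\<Sum>i\<le>k. (\<Sum>j\<le>k - i. c (i, j) * t ^ j) * s ^ i) = 0"
      by (simp add: sum_distrib_right sum_distrib_left mult_ac)
  qed (use assms i in auto)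
  obtain i j where a: "a = (i, j)" "i \<le> k" "j \<le> k - i" using assms(3) idx by auto
  show ?thesis
    unfolding a(1)
    by (rule power_sum_coeffs_zero[where \<epsilon> = "\<epsilon> / 2" and n = "k - i" and d = "\<lambda>j. c (i, j)"])
      (use inner assms a in auto)
qed

lemma mon_continuous: "continuous_on A (mon a)"
  by (rule continuous_at_imp_continuous_on) (simp add: mon_differentiable differentiable_imp_continuous_within)

lemma compact_coeff_sphere:
  assumes "finite I"
  shows "compact {c :: 'a \<Rightarrow> real. (\<forall>a. a \<notin> I \<longrightarrow> c a = 0) \<and> (\<Sum>a\<in>I. (c a)\<^sup>2) = 1}" (is "compact ?S")
proof -
  have "compact (Pi\<^sub>E UNIV (\<lambda>a. if a \<in> I then {- 1..1::real} else {0}))" (is "compact ?K")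
  proof -
    have "compactin (product_topology (\<lambda>i::'a. euclidean) UNIV) ?K"
      unfolding compactin_PiE by auto
    then show ?thesis by (simp add: euclidean_product_topology)
  qed
  moreover have "closed {c :: 'a \<Rightarrow> real. (\<Sum>a\<in>I. (c a)\<^sup>2) = 1}"
    by (intro closed_Collect_eq continuous_intros continuous_on_product_coordinates)
  moreover have "?S = ?K \<inter> {c. (\<Sum>a\<in>I. (c a)\<^sup>2) = 1}"
  proof -
    have "\<bar>c a\<bar> \<le> 1" if "(\<Sum>a\<in>I. (c a)\<^sup>2) = 1" "a \<in> I" for c :: "'a \<Rightarrow> real" and a
    proof -
      have "(c a)\<^sup>2 \<le> 1" using member_le_sum[of a I "\<lambda>a. (c a)\<^sup>2"] that assms by simp
      then show ?thesis by (simp add: abs_square_le_1)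
    qed
    then show ?thesis by (fastforce simp: PiE_def Pi_def abs_le_iff split: if_splits)
  qed
  ultimately show ?thesis by (simp add: compact_Int_closed)
qed

text \<open>Compactness of the unit sphere in coefficient space, where the squared norm is a continuous
  positive function.\<close>

lemma coeff_bound:
  assumes "\<delta> > 0"
  obtains \<mu> where "\<mu> > 0"
    "\<And>c. \<mu> * (\<Sum>a\<in>poly_index k. (c a)\<^sup>2) \<le>
       (\<integral>x. (\<Sum>a\<in>poly_index k. c a * mon a x)\<^sup>2 \<partial>lebesgue_on (cball 0 \<delta>))"
proof -
  define I where "I = poly_index k"
  have fI: "finite I" by (simp add: I_def)
  define M where "M = lebesgue_on (cball (0::pt) \<delta>)"
  define Q where "Q = (\<lambda>c. \<integral>x. (\<Sum>a\<in>I. c a * mon a x)\<^sup>2 \<partial>M)"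
  define S where "S = {c :: nat \<times> nat \<Rightarrow> real. (\<forall>a. a \<notin> I \<longrightarrow> c a = 0) \<and> (\<Sum>a\<in>I. (c a)\<^sup>2) = 1}"
  have int: "integrable M (\<lambda>x. mon a x * mon b x)" for a b
    unfolding M_def by (intro continuous_integrable_compact continuous_intros mon_continuous) auto
  have int2: "integrable M (\<lambda>x. (\<Sum>a\<in>I. c a * mon a x)\<^sup>2)" for c
    unfolding M_def by (intro continuous_integrable_compact continuous_intros mon_continuous) auto
  have Q: "Q c = (\<Sum>a\<in>I. \<Sum>b\<in>I. c a * c b * (\<integral>x. mon a x * mon b x \<partial>M))" for c
  proof -
    have "Q c = (\<integral>x. (\<Sum>a\<in>I. \<Sum>b\<in>I. (c a * c b) * (mon a x * mon b x)) \<partial>M)"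
      unfolding Q_def power2_eq_square sum_product by (simp add: mult_ac)
    also have "\<dots> = (\<Sum>a\<in>I. \<Sum>b\<in>I. c a * c b * (\<integral>x. mon a x * mon b x \<partial>M))"
      using int by (subst Bochner_Integration.integral_sum, simp)+ simp
    finally show ?thesis .
  qed
  have "continuous_on S Q"
    unfolding Q
    by (intro continuous_intros continuous_on_subset[OF continuous_on_product_coordinates]) auto
  moreover have "compact S" unfolding S_def by (rule compact_coeff_sphere[OF fI])
  moreover have "S \<noteq> {}"
  proof -
    have "(\<lambda>a. if a = (0, 0) then 1 else 0) \<in> S"
      using fI by (auto simp: S_def I_def poly_index_def if_distrib[of "\<lambda>x. x\<^sup>2"] finite_poly_index cong: if_cong)
    then show ?thesis by blast
  qed
  ultimately obtain c0 where c0: "c0 \<in> S" "\<And>c. c \<in> S \<Longrightarrow> Q c0 \<le> Q c"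
    using continuous_attains_inf by metis
  have "Q c0 > 0"
  proof (rule ccontr)
    assume "\<not> Q c0 > 0"
    moreover have "Q c0 \<ge> 0" unfolding Q_def by (rule integral_nonneg_AE) simp
    ultimately have "Q c0 = 0" by simp
    then have "AE x in M. (\<Sum>a\<in>I. c0 a * mon a x)\<^sup>2 = 0"
      unfolding Q_def using int2 by (subst (asm) integral_nonneg_eq_0_iff_AE) auto
    then have "AE x in lebesgue_on (cball 0 \<delta>). (\<Sum>a\<in>I. c0 a * mon a x) = 0"
      unfolding M_def by simp
    then have "(\<Sum>a\<in>I. c0 a * mon a x) = 0" if "x \<in> ball 0 \<delta>" for x
      using that
      by (intro AE_zero_imp_zero[where f = "\<lambda>x. \<Sum>a\<in>I. c0 a * mon a x"
            and S = "cball 0 \<delta>" and A = "ball 0 \<delta>"]) (auto intro!: continuous_intros mon_continuous)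
    then have "c0 a = 0" if "a \<in> I" for a
      using mon_coeffs_zero[OF assms] that unfolding I_def by blast
    then show False using c0(1) by (simp add: S_def)
  qed
  show thesis
  proof (rule that)
    show "Q c0 > 0" by fact
    fix c :: "nat \<times> nat \<Rightarrow> real"
    define s where "s = (\<Sum>a\<in>I. (c a)\<^sup>2)"
    have "s \<ge> 0" unfolding s_def by (rule sum_nonneg) simp
    have "Q c0 * s \<le> Q c"
    proof (cases "s = 0")
      case True
      then show ?thesis by (simp add: Q_def)
    next
      case False
      with \<open>s \<ge> 0\<close> have s: "s > 0" by simp
      define c1 where "c1 a = (if a \<in> I then c a / sqrt s else 0)" for a
      have "(\<Sum>a\<in>I. (c1 a)\<^sup>2) = (\<Sum>a\<in>I. (c a)\<^sup>2 / s)"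
        using s by (intro sum.cong) (auto simp: c1_def power_divide)
      also have "\<dots> = 1" using s by (simp add: s_def sum_divide_distrib[symmetric])
      finally have "c1 \<in> S" by (simp add: S_def c1_def)
      then have "Q c0 \<le> Q c1" by (rule c0)
      also have "Q c1 = Q c / s"
        using s by (simp add: Q c1_def sum_divide_distrib sum_distrib_left)
      finally show ?thesis using s by (simp add: field_simps)
    qed
    then show "Q c0 * (\<Sum>a\<in>poly_index k. (c a)\<^sup>2) \<le>
        (\<integral>x. (\<Sum>a\<in>poly_index k. c a * mon a x)\<^sup>2 \<partial>lebesgue_on (cball 0 \<delta>))"
      by (simp add: s_def Q_def I_def M_def)
  qed
qed

lemma sum_mult_bound:
  assumes "finite I" "\<And>a. a \<in> I \<Longrightarrow> \<bar>b a\<bar> \<le> (B::real)" "B \<ge> 0"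
  shows "(\<Sum>a\<in>I. c a * b a)\<^sup>2 \<le> (\<Sum>a\<in>I. (c a)\<^sup>2) * (of_nat (card I) * B\<^sup>2)"
proof -
  have "(\<Sum>a\<in>I. c a * b a)\<^sup>2 \<le> (\<Sum>a\<in>I. (c a)\<^sup>2) * (\<Sum>a\<in>I. (b a)\<^sup>2)"
    by (rule Cauchy_Schwarz_ineq_sum)
  also have "(\<Sum>a\<in>I. (b a)\<^sup>2) \<le> of_nat (card I) * B\<^sup>2"
    by (rule sum_bounded_above) (use assms in \<open>auto intro: power2_le_iff_abs_le[THEN iffD2]\<close>)
  finally show ?thesis by (simp add: mult_left_mono sum_nonneg)
qed

lemma mon_bound: "y \<in> cball 0 1 \<Longrightarrow> \<bar>mon a y\<bar> \<le> 1"
proof -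
  assume "y \<in> cball 0 1"
  then have "\<bar>y $ 1\<bar> \<le> 1" "\<bar>y $ 2\<bar> \<le> 1"
    using component_le_norm_cart[of y] by (auto intro: order_trans)
  then show ?thesis by (simp add: mon_def abs_mult power_abs mult_le_one power_le_one)
qed

lemma polys_unit_bound:
  assumes "\<delta> > 0"
  obtains C where "C > 0"
    "\<And>p y. p \<in> polys k \<Longrightarrow> y \<in> cball 0 1 \<Longrightarrow>
       (p y)\<^sup>2 \<le> C * (\<integral>x. (p x)\<^sup>2 \<partial>lebesgue_on (cball 0 \<delta>))"
    "\<And>p y i. p \<in> polys k \<Longrightarrow> y \<in> cball 0 1 \<Longrightarrow>
       (pd i p y)\<^sup>2 \<le> C * (\<integral>x. (p x)\<^sup>2 \<partial>lebesgue_on (cball 0 \<delta>))"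
proof -
  obtain \<mu> where \<mu>: "\<mu> > 0" "\<And>c. \<mu> * (\<Sum>a\<in>poly_index k. (c a)\<^sup>2) \<le>
       (\<integral>x. (\<Sum>a\<in>poly_index k. c a * mon a x)\<^sup>2 \<partial>lebesgue_on (cball 0 \<delta>))"
    using coeff_bound[OF assms, of k] by blast
  define n where "n = real (card (poly_index k)) * (real k + 1)\<^sup>2"
  have "(0, 0) \<in> poly_index k" by (simp add: poly_index_def)
  then have "poly_index k \<noteq> {}" by blast
  then have n: "n > 0" by (simp add: n_def card_gt_0_iff)
  have bound: "(\<Sum>a\<in>poly_index k. c a * b a)\<^sup>2 \<le>
      n / \<mu> * (\<integral>x. (\<Sum>a\<in>poly_index k. c a * mon a x)\<^sup>2 \<partial>lebesgue_on (cball 0 \<delta>))"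
    if b: "\<And>a. a \<in> poly_index k \<Longrightarrow> \<bar>b a\<bar> \<le> real k + 1" for b c
  proof -
    have "(\<Sum>a\<in>poly_index k. c a * b a)\<^sup>2 \<le> (\<Sum>a\<in>poly_index k. (c a)\<^sup>2) * n"
      unfolding n_def by (rule sum_mult_bound) (use b in auto)
    also have "\<dots> = n / \<mu> * (\<mu> * (\<Sum>a\<in>poly_index k. (c a)\<^sup>2))" using \<mu>(1) by simp
    also have "\<dots> \<le> n / \<mu> * (\<integral>x. (\<Sum>a\<in>poly_index k. c a * mon a x)\<^sup>2 \<partial>lebesgue_on (cball 0 \<delta>))"
      using \<mu> n by (intro mult_left_mono) auto
    finally show ?thesis .
  qed
  show thesis
  proof (rule that[of "n / \<mu>"])
    show "n / \<mu> > 0" using n \<mu>(1) by simp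
  next
    fix p y assume p: "p \<in> polys k" and y: "y \<in> cball (0::pt) 1"
    obtain c where c: "p = (\<lambda>x. \<Sum>a\<in>poly_index k. c a * mon a x)" using p polys_iff by blast
    show "(p y)\<^sup>2 \<le> n / \<mu> * (\<integral>x. (p x)\<^sup>2 \<partial>lebesgue_on (cball 0 \<delta>))"
      unfolding c by (rule bound) (rule order_trans[OF mon_bound[OF y]], simp)
  next
    fix p y i assume p: "p \<in> polys k" and y: "y \<in> cball (0::pt) 1"
    obtain c where c: "p = (\<lambda>x. \<Sum>a\<in>poly_index k. c a * mon a x)" using p polys_iff by blast
    show "(pd i p y)\<^sup>2 \<le> n / \<mu> * (\<integral>x. (p x)\<^sup>2 \<partial>lebesgue_on (cball 0 \<delta>))"
      unfolding c pd_polys_eq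
    proof (rule bound)
      fix a assume "a \<in> poly_index k"
      then have a: "real (fst a) \<le> real k" "real (snd a) \<le> real k" by (auto simp: poly_index_def)
      have *: "\<bar>real m * mon b y\<bar> \<le> real k + 1" if "real m \<le> real k" for m b
        using mult_mono[OF that mon_bound[OF y, of b]] by (simp add: abs_mult)
      show "\<bar>pd i (mon a) y\<bar> \<le> real k + 1"
        unfolding pd_mon using *[OF a(1)] *[OF a(2)] by simp
    qed
  qed
qed

lemma integral_cball_affine:
  fixes f :: "pt \<Rightarrow> real"
  assumes "h > 0" "f \<in> borel_measurable borel"
  shows "(\<integral>x. f x \<partial>lebesgue_on (cball x0 (h * \<delta>))) = h\<^sup>2 * (\<integral>x. f (x0 + h *\<^sub>R x) \<partial>lebesgue_on (cball 0 \<delta>))"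
proof -
  note [measurable] = assms(2)
  have m [measurable]: "(\<lambda>x. indicator (cball x0 (h * \<delta>)) x * f x) \<in> borel_measurable borel"
    by (intro borel_measurable_times borel_measurable_indicator assms(2)) simp
  have ind: "indicator (cball x0 (h * \<delta>)) (x0 + h *\<^sub>R x) = (indicator (cball 0 \<delta>) x :: real)" for x
    using assms(1) by (auto simp: indicator_def dist_norm)
  have "(\<integral>x. f x \<partial>lebesgue_on (cball x0 (h * \<delta>))) = (\<integral>x. indicator (cball x0 (h * \<delta>)) x * f x \<partial>lborel)"
    by (subst integral_restrict_space) (auto intro!: integral_completion)
  also have "\<dots> = (\<integral>x. indicator (cball x0 (h * \<delta>)) x * f x
      \<partial>density (distr lborel borel (\<lambda>x. x0 + h *\<^sub>R x)) (\<lambda>_. \<bar>h\<bar> ^ DIM(pt)))"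
    using lborel_affine[of h x0] assms(1) by simp
  also have "\<dots> = (\<integral>x. h\<^sup>2 * (indicator (cball x0 (h * \<delta>)) (x0 + h *\<^sub>R x) * f (x0 + h *\<^sub>R x)) \<partial>lborel)"
    using assms(1) by (subst integral_density) (simp_all add: integral_distr m)
  also have "\<dots> = h\<^sup>2 * (\<integral>x. indicator (cball 0 \<delta>) x * f (x0 + h *\<^sub>R x) \<partial>lborel)"
    by (simp add: ind)
  also have "(\<integral>x. indicator (cball 0 \<delta>) x * f (x0 + h *\<^sub>R x) \<partial>lborel) =
      (\<integral>x. f (x0 + h *\<^sub>R x) \<partial>lebesgue_on (cball 0 \<delta>))"
  proof -
    have "(\<lambda>x. indicator (cball 0 \<delta>) x * f (x0 + h *\<^sub>R x)) \<in> borel_measurable lborel"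
      by (intro borel_measurable_times borel_measurable_indicator measurable_compose[OF _ assms(2)]) auto
    from integral_completion[OF this] show ?thesis by (simp add: integral_restrict_space)
  qed
  finally show ?thesis .
qed

lemma pd_affine:
  assumes "p differentiable at (x0 + h *\<^sub>R y)"
  shows "pd i (\<lambda>x. p (x0 + h *\<^sub>R x)) y = h * pd i p (x0 + h *\<^sub>R y)"
proof -
  have "((\<lambda>x. x0 + h *\<^sub>R x) has_derivative (\<lambda>v. h *\<^sub>R v)) (at y)"
    by (auto intro!: derivative_eq_intros)
  from has_derivative_compose[OF this differentiable_has_derivative_pd[OF assms]]
  show ?thesis by (simp add: pd_eqI grad_def inner_axis)
qed

lemma polys_inverse_estimate:
  assumes "\<delta> > 0"
  obtains C where "C > 0"
    "\<And>p T x0 h y. \<lbrakk>p \<in> polys k; h > 0; compact T; cball x0 (h * \<delta>) \<subseteq> T; T \<subseteq> cball x0 h; y \<in> T\<rbrakk> \<Longrightarrow>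
       h\<^sup>2 * (p y)\<^sup>2 \<le> C * (\<integral>x. (p x)\<^sup>2 \<partial>lebesgue_on T)"
    "\<And>p T x0 h y i. \<lbrakk>p \<in> polys k; h > 0; compact T; cball x0 (h * \<delta>) \<subseteq> T; T \<subseteq> cball x0 h; y \<in> T\<rbrakk> \<Longrightarrow>
       h\<^sup>2 * (h * pd i p y)\<^sup>2 \<le> C * (\<integral>x. (p x)\<^sup>2 \<partial>lebesgue_on T)"
proof -
  obtain C where C: "C > 0"
    "\<And>p y. p \<in> polys k \<Longrightarrow> y \<in> cball 0 1 \<Longrightarrow>
       (p y)\<^sup>2 \<le> C * (\<integral>x. (p x)\<^sup>2 \<partial>lebesgue_on (cball 0 \<delta>))"
    "\<And>p y i. p \<in> polys k \<Longrightarrow> y \<in> cball 0 1 \<Longrightarrow>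
       (pd i p y)\<^sup>2 \<le> C * (\<integral>x. (p x)\<^sup>2 \<partial>lebesgue_on (cball 0 \<delta>))"
    using polys_unit_bound[OF assms, of k] by blast
  have "h\<^sup>2 * (p y)\<^sup>2 \<le> C * (\<integral>x. (p x)\<^sup>2 \<partial>lebesgue_on T) \<and>
      h\<^sup>2 * (h * pd i p y)\<^sup>2 \<le> C * (\<integral>x. (p x)\<^sup>2 \<partial>lebesgue_on T)"
    if p: "p \<in> polys k" and h: "h > 0" and T: "compact T" "cball x0 (h * \<delta>) \<subseteq> T" "T \<subseteq> cball x0 h"
      and y: "y \<in> T" for p T x0 h y i
  proof -
    define q where "q x = p (x0 + h *\<^sub>R x)" for x
    have q: "q \<in> polys k" unfolding q_def by (rule polys_comp_affine[OF p])
    define z where "z = (y - x0) /\<^sub>R h"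
    have yz: "y = x0 + h *\<^sub>R z" using h by (simp add: z_def)
    have "z \<in> cball 0 1" 
    proof -
      have "norm (y - x0) \<le> h" using T(3) y by (auto simp: dist_norm norm_minus_commute)
      then show ?thesis using h unfolding z_def mem_cball_0 norm_scaleR by (simp add: field_simps)
    qed
    note b = C(2)[OF q this] C(3)[OF q this, of i]
    have sq: "continuous_on A (\<lambda>x. (p x)\<^sup>2)" for A
      by (intro continuous_intros polys_continuous[OF p])
    then have "(\<lambda>x. (p x)\<^sup>2) \<in> borel_measurable borel"
      by (rule borel_measurable_continuous_onI)
    then have "h\<^sup>2 * (\<integral>x. (q x)\<^sup>2 \<partial>lebesgue_on (cball 0 \<delta>)) = (\<integral>x. (p x)\<^sup>2 \<partial>lebesgue_on (cball x0 (h * \<delta>)))"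
      unfolding q_def using integral_cball_affine[OF h, of "\<lambda>x. (p x)\<^sup>2"] by simp
    also have "\<dots> \<le> (\<integral>x. (p x)\<^sup>2 \<partial>lebesgue_on T)"
    proof -
      have "integrable (lebesgue_on T) (\<lambda>x. (p x)\<^sup>2)"
        using T(1) sq by (rule continuous_integrable_compact)
      then show ?thesis using T
        by (intro integral_lebesgue_on_mono) (auto simp: lmeasurable_compact fmeasurableD)
    qed
    finally have *: "C * (h\<^sup>2 * (\<integral>x. (q x)\<^sup>2 \<partial>lebesgue_on (cball 0 \<delta>))) \<le> C * (\<integral>x. (p x)\<^sup>2 \<partial>lebesgue_on T)"
      using C(1) by simp
    have "pd i q z = h * pd i p y"
      unfolding q_def yz by (rule pd_affine[OF polys_differentiable[OF p]])
    moreover have "q z = p y" by (simp add: q_def yz)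
    moreover have "h\<^sup>2 * s \<le> C * (\<integral>x. (p x)\<^sup>2 \<partial>lebesgue_on T)"
      if "s \<le> C * (\<integral>x. (q x)\<^sup>2 \<partial>lebesgue_on (cball 0 \<delta>))" for s
    proof -
      have "h\<^sup>2 * s \<le> h\<^sup>2 * (C * (\<integral>x. (q x)\<^sup>2 \<partial>lebesgue_on (cball 0 \<delta>)))"
        using that by (rule mult_left_mono) simp
      with * show ?thesis by (simp add: mult_ac)
    qed
    ultimately show ?thesis using b by metis
  qed
  with C(1) show thesis using that by blast
qed

section \<open>Test functions\<close>

definition smooth :: "(pt \<Rightarrow> real) \<Rightarrow> bool" where
  "smooth f \<longleftrightarrow> (\<forall>n. times_cont_diff n f)"

lemma times_cont_diff_continuous: "times_cont_diff n f \<Longrightarrow> continuous_on UNIV f"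
proof (cases n)
  case (Suc m)
  moreover assume "times_cont_diff n f"
  ultimately have "f differentiable at x" for x by simp
  then show ?thesis
    by (intro continuous_at_imp_continuous_on ballI differentiable_imp_continuous_within)
qed simp

lemma times_cont_diff_mono: "times_cont_diff (Suc n) f \<Longrightarrow> times_cont_diff n f"
proof (induction n arbitrary: f)
  case 0
  from times_cont_diff_continuous[OF this] show ?case by simp
next
  case (Suc n)
  then have "times_cont_diff (Suc n) (pd i f)" for i by simp
  then have "times_cont_diff n (pd i f)" for i by (rule Suc.IH)
  then show ?case using Suc.prems by simp
qed

lemma times_cont_diff_add:
  "times_cont_diff n f \<Longrightarrow> times_cont_diff n g \<Longrightarrow> times_cont_diff n (\<lambda>x. f x + g x)"
proof (induction n arbitrary: f g)
  case 0
  then show ?case by (auto intro: continuous_on_add)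
next
  case (Suc n)
  then have "pd i (\<lambda>x. f x + g x) = (\<lambda>x. pd i f x + pd i g x)" for i by (intro ext pd_add) auto
  then show ?case using Suc by (auto intro!: differentiable_add)
qed

lemma times_cont_diff_mult:
  "times_cont_diff n f \<Longrightarrow> times_cont_diff n g \<Longrightarrow> times_cont_diff n (\<lambda>x. f x * g x)"
proof (induction n arbitrary: f g)
  case 0
  then show ?case by (auto intro: continuous_on_mult)
next
  case (Suc n)
  then have "pd i (\<lambda>x. f x * g x) = (\<lambda>x. pd i f x * g x + f x * pd i g x)" for i
    by (intro ext pd_mult) auto
  moreover have "times_cont_diff n f" "times_cont_diff n g"
    using Suc.prems times_cont_diff_mono by blast+
  ultimately show ?case using Suc by (auto intro!: differentiable_mult times_cont_diff_add)
qed

lemma times_cont_diff_polys: "p \<in> polys k \<Longrightarrow> times_cont_diff n p"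
proof (induction n arbitrary: p)
  case 0
  then show ?case by (simp add: polys_continuous)
next
  case (Suc n)
  then show ?case by (auto intro: polys_differentiable polys_pd)
qed

lemma smooth_polys: "p \<in> polys k \<Longrightarrow> smooth p"
  by (simp add: smooth_def times_cont_diff_polys)

lemma smooth_mult: "smooth f \<Longrightarrow> smooth g \<Longrightarrow> smooth (\<lambda>x. f x * g x)"
  by (simp add: smooth_def times_cont_diff_mult)

lemma smooth_Suc: "smooth f \<Longrightarrow> times_cont_diff (Suc n) f"
  unfolding smooth_def by (rule spec)

lemma smooth_pd: "smooth f \<Longrightarrow> smooth (pd i f)"
  unfolding smooth_def[of "pd i f"] using smooth_Suc by simp

lemma smooth_differentiable: "smooth f \<Longrightarrow> f differentiable at x"
  using smooth_Suc by simp

lemma smooth_continuous: "smooth f \<Longrightarrow> continuous_on A f"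
  by (rule continuous_on_subset[OF times_cont_diff_continuous[OF smooth_Suc] subset_UNIV])

lemma smooth_measurable: "smooth f \<Longrightarrow> f \<in> borel_measurable lebesgue"
  using borel_measurable_continuous_onI[OF smooth_continuous[of f UNIV]]
  by (simp add: measurable_completion)

lemma test_funs_smooth: "\<phi> \<in> test_funs \<Omega> \<Longrightarrow> smooth \<phi>"
  by (simp add: test_funs_def smooth_def)

lemma test_funs_mono: "A \<subseteq> B \<Longrightarrow> test_funs A \<subseteq> test_funs B"
  by (auto simp: test_funs_def)

lemma test_funs_zero_outside: "\<phi> \<in> test_funs \<Omega> \<Longrightarrow> x \<notin> \<Omega> \<Longrightarrow> \<phi> x = 0"
  using closure_subset[of "{x. \<phi> x \<noteq> 0}"] by (auto simp: test_funs_def)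

lemma test_funsI:
  assumes "smooth \<phi>" "compact K" "K \<subseteq> \<Omega>" "\<And>x. x \<notin> K \<Longrightarrow> \<phi> x = 0"
  shows "\<phi> \<in> test_funs \<Omega>"
proof -
  have "closure {x. \<phi> x \<noteq> 0} \<subseteq> K"
    using assms by (intro closure_minimal) (auto simp: compact_imp_closed)
  then show ?thesis
    using assms compact_Int_closed[of K "closure {x. \<phi> x \<noteq> 0}"]
    by (auto simp: test_funs_def smooth_def Int_absorb1)
qed

lemma test_fun_support:
  assumes "\<phi> \<in> test_funs \<Omega>"
  obtains K where "compact K" "K \<subseteq> \<Omega>" "\<And>x. x \<notin> K \<Longrightarrow> \<phi> x = 0" "\<And>x i. x \<notin> K \<Longrightarrow> pd i \<phi> x = 0"
proof
  define K where "K = closure {x. \<phi> x \<noteq> 0}"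
  show "compact K" "K \<subseteq> \<Omega>" using assms by (auto simp: test_funs_def K_def)
  show z: "\<phi> x = 0" if "x \<notin> K" for x using that closure_subset[of "{x. \<phi> x \<noteq> 0}"] by (auto simp: K_def)
  show "pd i \<phi> x = 0" if "x \<notin> K" for x i
  proof -
    have "pd i \<phi> x = pd i (\<lambda>x. 0) x"
    proof (rule pd_cong_open)
      show "open (- K)" unfolding K_def by (intro open_Compl closed_closure)
      show "x \<in> - K" using that by simp
    qed (simp add: z)
    then show ?thesis by (simp add: pd_const)
  qed
qed

lemma test_funs_mult_smooth:
  assumes "\<phi> \<in> test_funs \<Omega>" "smooth f"
  shows "(\<lambda>x. f x * \<phi> x) \<in> test_funs \<Omega>"
proof -
  obtain K where "compact K" "K \<subseteq> \<Omega>" "\<And>x. x \<notin> K \<Longrightarrow> \<phi> x = 0"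
    using test_fun_support[OF assms(1)] by metis
  then show ?thesis
    by (intro test_funsI[of _ K] smooth_mult assms test_funs_smooth[OF assms(1)]) auto
qed

lemma test_funs_pd:
  assumes "\<phi> \<in> test_funs \<Omega>"
  shows "pd i \<phi> \<in> test_funs \<Omega>"
proof -
  obtain K where "compact K" "K \<subseteq> \<Omega>" "\<And>x i. x \<notin> K \<Longrightarrow> pd i \<phi> x = 0"
    using test_fun_support[OF assms] by metis
  then show ?thesis
    by (intro test_funsI[of _ K] smooth_pd test_funs_smooth[OF assms(1)]) auto
qed

lemma test_funs_integrable:
  assumes "\<phi> \<in> test_funs \<Omega>" "continuous_on UNIV f"
  shows "integrable lebesgue (\<lambda>x. f x * \<phi> x)"
proof -
  obtain K where K: "compact K" "\<And>x. x \<notin> K \<Longrightarrow> \<phi> x = 0"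
    using test_fun_support[OF assms(1)] by metis
  have "integrable (lebesgue_on K) (\<lambda>x. f x * \<phi> x)"
    using K(1) by (intro continuous_integrable_compact continuous_intros continuous_on_subset[OF assms(2)]
        smooth_continuous test_funs_smooth[OF assms(1)]) auto
  also have "integrable (lebesgue_on K) (\<lambda>x. f x * \<phi> x) \<longleftrightarrow>
      integrable lebesgue (\<lambda>x. indicator K x *\<^sub>R (f x * \<phi> x))"
    using K by (simp add: integrable_restrict_space lmeasurable_compact fmeasurableD)
  also have "(\<lambda>x. indicator K x *\<^sub>R (f x * \<phi> x)) = (\<lambda>x. f x * \<phi> x)"
    using K(2) by (auto simp: indicator_def fun_eq_iff)
  finally show ?thesis .
qed

subsection \<open>Bump functions\<close>

text \<open>The factors \<open>t\<^sup>-\<^sup>k\<close> make this family closed under differentiation up to linear combinations.\<close>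

definition flat :: "nat \<Rightarrow> real \<Rightarrow> real" where
  "flat k t = (if t > 0 then exp (- 1 / t) / t ^ k else 0)"

lemma flat_nonneg: "flat k t \<ge> 0" by (simp add: flat_def)

lemma flat_tendsto_0: "(flat k \<longlongrightarrow> 0) (at 0)"
proof -
  have "((\<lambda>t::real. (inverse t) ^ k / exp (inverse t)) \<longlongrightarrow> 0) (at_right 0)"
    by (rule filterlim_compose[OF tendsto_power_div_exp_0 filterlim_inverse_at_top_right])
  then have "(flat k \<longlongrightarrow> 0) (at_right 0)"
  proof (rule Lim_transform_eventually)
    show "\<forall>\<^sub>F t in at_right 0. (inverse t) ^ k / exp (inverse t) = flat k t"
      using eventually_at_right_less[of 0]
      by eventually_elim (simp add: flat_def exp_minus field_simps)
  qed
  moreover have "(flat k \<longlongrightarrow> 0) (at_left 0)"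
    by (rule tendsto_eventually) (auto simp: flat_def eventually_at_left_field intro: exI[of _ "-1"])
  ultimately show ?thesis by (simp add: filterlim_at_split)
qed

lemma flat_has_derivative: "(flat k has_real_derivative (flat (k + 2) t - real k * flat (k + 1) t)) (at t)"
proof -
  consider "t > 0" | "t = 0" | "t < 0" by linarith
  then show ?thesis
  proof cases
    case 1
    have "((\<lambda>t. exp (- 1 / t) / t ^ k) has_real_derivative
        (exp (- 1 / t) / t ^ (k + 2) - real k * (exp (- 1 / t) / t ^ (k + 1)))) (at t)"
    proof -
      have "((\<lambda>t. exp (- 1 / t)) has_real_derivative exp (- 1 / t) / t\<^sup>2) (at t)"
        using 1 by (auto intro!: derivative_eq_intros simp: field_simps power2_eq_square)
      from DERIV_divide[OF this DERIV_pow[of k]] have "((\<lambda>t. exp (- 1 / t) / t ^ k) has_real_derivative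
        (exp (- 1 / t) / t\<^sup>2 * t ^ k - exp (- 1 / t) * (real k * t ^ (k - Suc 0))) / (t ^ k * t ^ k)) (at t)"
        using 1 by simp
      moreover have "(exp (- 1 / t) / t\<^sup>2 * t ^ k - exp (- 1 / t) * (real k * t ^ (k - Suc 0))) / (t ^ k * t ^ k) =
          exp (- 1 / t) / t ^ (k + 2) - real k * (exp (- 1 / t) / t ^ (k + 1))"
        using 1 by (cases k) (simp_all add: field_simps power2_eq_square)
      ultimately show ?thesis by simp
    qed
    then have "(flat k has_real_derivative
        (exp (- 1 / t) / t ^ (k + 2) - real k * (exp (- 1 / t) / t ^ (k + 1)))) (at t)"
      by (rule has_field_derivative_transform_within_open[where S = "{0<..}"])
        (use 1 in \<open>auto simp: flat_def\<close>)
    then show ?thesis using 1 by (simp add: flat_def)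
  next
    case 2
    have "((\<lambda>h. flat (Suc k) h) \<longlongrightarrow> 0) (at 0)" by (rule flat_tendsto_0)
    moreover have "flat (Suc k) h = (flat k (0 + h) - flat k 0) / h" for h
      by (simp add: flat_def)
    ultimately have "(\<lambda>h. (flat k (0 + h) - flat k 0) / h) \<midarrow>0\<rightarrow> 0" by simp
    then show ?thesis unfolding 2 DERIV_def by (simp add: flat_def)
  next
    case 3
    have "((\<lambda>t. 0) has_real_derivative 0) (at t)" by simp
    then have "(flat k has_real_derivative 0) (at t)"
      by (rule has_field_derivative_transform_within_open[where S = "{..<0}"])
        (use 3 in \<open>auto simp: flat_def\<close>)
    then show ?thesis using 3 by (simp add: flat_def)
  qed
qed

lemma flat_coord_has_derivative:
  "((\<lambda>x::pt. flat k (c * x $ i + a)) has_derivative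
     (\<lambda>h. (flat (k + 2) (c * x $ i + a) - real k * flat (k + 1) (c * x $ i + a)) * (c * h $ i))) (at x)"
proof -
  have "((\<lambda>x::pt. c * x $ i + a) has_derivative (\<lambda>h. c * h $ i)) (at x)"
    by (auto intro!: derivative_eq_intros coord_has_derivative)
  from has_derivative_compose[OF this, of "flat k"
      "\<lambda>s. (flat (k + 2) (c * x $ i + a) - real k * flat (k + 1) (c * x $ i + a)) * s"]
  show ?thesis
    using flat_has_derivative[of k "c * x $ i + a"] by (simp add: has_field_derivative_def)
qed

lemma smooth_flat: "smooth (\<lambda>x. flat k (c * x $ i + a))"
proof -
  have "times_cont_diff n (\<lambda>x. flat k (c * x $ i + a))" for n
  proof (induction n arbitrary: k)
    case 0
    then show ?case
      by (auto intro!: continuous_at_imp_continuous_on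
          has_derivative_continuous[OF flat_coord_has_derivative])
  next
    case (Suc n)
    have pd: "pd j (\<lambda>x. flat k (c * x $ i + a)) = (\<lambda>x. (if i = j then c else 0) *
        (flat (k + 2) (c * x $ i + a) + (- real k) * flat (k + 1) (c * x $ i + a)))" for j
      by (rule ext) (simp add: pd_eqI[OF flat_coord_has_derivative] axis_def)
    have const: "times_cont_diff n (\<lambda>x. b)" for b
      by (rule times_cont_diff_polys[OF polys_const])
    show ?case
      unfolding times_cont_diff.simps pd
      by (intro conjI allI times_cont_diff_mult times_cont_diff_add const Suc
          differentiableI[OF flat_coord_has_derivative])
  qed
  then show ?thesis by (simp add: smooth_def)
qed

definition bump :: "real \<Rightarrow> pt \<Rightarrow> pt \<Rightarrow> pt \<Rightarrow> real" where
  "bump n a b x = (flat 0 (n * x $ 1 + - n * a $ 1) * flat 0 (- n * x $ 1 + n * b $ 1)) *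
     (flat 0 (n * x $ 2 + - n * a $ 2) * flat 0 (- n * x $ 2 + n * b $ 2))"

lemma smooth_bump: "smooth (bump n a b)"
  unfolding bump_def[abs_def] by (intro smooth_mult smooth_flat)

lemma bump_nonneg: "bump n a b x \<ge> 0"
  unfolding bump_def by (intro mult_nonneg_nonneg flat_nonneg)

lemma flat_le_1: "flat 0 t \<le> 1" by (simp add: flat_def)

lemma bump_le_1: "bump n a b x \<le> 1"
  unfolding bump_def by (intro mult_le_one mult_nonneg_nonneg flat_nonneg flat_le_1)

lemma bump_pos_iff:
  assumes "n > 0" shows "bump n a b x > 0 \<longleftrightarrow> x \<in> box a b"
proof -
  have 1: "flat 0 (n * s + - n * t) > 0 \<longleftrightarrow> t < s" for s t using assms by (simp add: flat_def)
  have 2: "flat 0 (- n * s + n * t) > 0 \<longleftrightarrow> s < t" for s t using assms by (simp add: flat_def)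
  have 3: "v * w > 0 \<longleftrightarrow> v > 0 \<and> w > 0" if "v \<ge> 0" "w \<ge> 0" for v w :: real
    using that by (auto simp: zero_less_mult_iff)
  show ?thesis
    unfolding bump_def by (simp only: 1 2 3 flat_nonneg mult_nonneg_nonneg mem_box_cart forall_2)
qed

lemma bump_zero: "n > 0 \<Longrightarrow> x \<notin> box a b \<Longrightarrow> bump n a b x = 0"
  using bump_pos_iff[of n a b x] bump_nonneg[of n a b x] by linarith

lemma bump_test_fun: "n > 0 \<Longrightarrow> cbox a b \<subseteq> \<Omega> \<Longrightarrow> bump n a b \<in> test_funs \<Omega>"
  by (rule test_funsI[of _ "cbox a b"]) (use box_subset_cbox[of a b] in \<open>auto simp: smooth_bump intro!: bump_zero\<close>)

lemma bump_tendsto: "(\<lambda>n. bump (real (Suc n)) a b x) \<longlonglongrightarrow> indicator (box a b) x"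
proof (cases "x \<in> box a b")
  case True
  have fl: "(\<lambda>n. flat 0 (real (Suc n) * t)) \<longlonglongrightarrow> 1" if "t > 0" for t
  proof -
    have "(\<lambda>n. - (inverse (real (Suc n)) / t)) \<longlonglongrightarrow> - (0 / t)"
      by (intro tendsto_intros LIMSEQ_inverse_real_of_nat) (use that in auto)
    then have "(\<lambda>n. exp (- (inverse (real (Suc n)) / t))) \<longlonglongrightarrow> exp (- (0 / t))"
      by (rule tendsto_exp)
    moreover have "flat 0 (real (Suc n) * t) = exp (- (inverse (real (Suc n)) / t))" for n
      using that by (simp add: flat_def field_simps add_pos_nonneg)
    ultimately show ?thesis by simp
  qed
  have "(\<lambda>n. (flat 0 (real (Suc n) * (x $ 1 - a $ 1)) * flat 0 (real (Suc n) * (b $ 1 - x $ 1))) *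
     (flat 0 (real (Suc n) * (x $ 2 - a $ 2)) * flat 0 (real (Suc n) * (b $ 2 - x $ 2)))) \<longlonglongrightarrow> (1 * 1) * (1 * 1)"
    using True by (intro tendsto_mult fl) (auto simp: mem_box_cart)
  then show ?thesis
    using True unfolding bump_def by (simp only: algebra_simps) (simp add: algebra_simps)
next
  case False
  then show ?thesis by (simp add: bump_zero del: of_nat_Suc)
qed

subsection \<open>Fundamental lemma of the calculus of variations\<close>

lemma box_integral_zero_imp_AE_zero:
  fixes D :: "pt \<Rightarrow> real"
  assumes D: "integrable lebesgue D" and box0: "\<And>a b. box a b \<subseteq> box l u \<Longrightarrow> (LINT x:box a b|lebesgue. D x) = 0"
  shows "AE x in lebesgue. x \<in> box l u \<longrightarrow> D x = 0"
proof -
  define B where "B = box l u"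
  have si: "set_integrable lebesgue A D" if "A \<in> sets lebesgue" for A
    unfolding set_integrable_def by (rule integrable_mult_indicator[OF that D])
  have B: "B \<in> sets borel" "B \<in> sets lebesgue" by (simp_all add: B_def)
  have leb: "A \<in> sets lebesgue" if "A \<in> sets borel" for A :: "pt set" using that by simp
  have borel0: "(LINT x:A \<inter> B|lebesgue. D x) = 0" if "A \<in> sets borel" for A
  proof -
    have st: "Int_stable (range (\<lambda>(a, b). box a b :: pt set))"
      by (auto simp: Int_stable_def box_Int_box)
    have "A \<in> sigma_sets UNIV (range (\<lambda>(a, b). box a b))" using that by (simp add: borel_eq_box)
    from st subset_UNIV[of "range (\<lambda>(a, b). box a b :: pt set)", folded Pow_UNIV] this show ?thesis
    proof (induction rule: sigma_sets_induct_disjoint)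
      case (basic A)
      then obtain a b where "A \<inter> B = box a b" by (auto simp: B_def box_Int_box)
      moreover have "A \<inter> B \<subseteq> box l u" by (simp add: B_def)
      ultimately show ?case using box0 by simp
    next
      case empty
      show ?case by (simp add: set_lebesgue_integral_def)
    next
      case (compl A)
      then have A: "A \<in> sets borel" by (simp add: borel_eq_box)
      have "B = (A \<inter> B) \<union> ((UNIV - A) \<inter> B)" by blast
      then have "(LINT x:B|lebesgue. D x) = (LINT x:(A \<inter> B) \<union> ((UNIV - A) \<inter> B)|lebesgue. D x)" by simp
      also have "\<dots> = (LINT x:A \<inter> B|lebesgue. D x) + (LINT x:(UNIV - A) \<inter> B|lebesgue. D x)"
        using A B by (intro set_integral_Un si leb) auto
      finally show ?case using box0[of l u] compl by (simp add: B_def)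
    next
      case (union A)
      then have A: "A i \<in> sets borel" for i by (auto simp: borel_eq_box)
      have "(LINT x:(\<Union>i. A i \<inter> B)|lebesgue. D x) = (\<Sum>i. LINT x:A i \<inter> B|lebesgue. D x)"
      proof (rule lebesgue_integral_countable_add)
        show "set_integrable lebesgue (\<Union>i. A i \<inter> B) D"
          using A B by (intro si leb sets.countable_UN sets.Int) auto
      qed (use A B union in \<open>auto simp: disjoint_family_on_def\<close>)
      moreover have "(\<Union>i. A i) \<inter> B = (\<Union>i. A i \<inter> B)" by blast
      ultimately show ?case by (simp only: union.IH suminf_zero)
    qed
  qed
  have "AE x in lebesgue_on B. D x = 0"
  proof (rule sigma_finite_measure.density_zero)
    show "sigma_finite_measure (lebesgue_on B)"
      by (intro finite_measure.axioms(1) finite_measure_lebesgue_on) (simp add: B_def)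
    show "integrable (lebesgue_on B) D"
      using B integrable_mult_indicator[OF B(2) D] by (simp add: integrable_restrict_space)
    fix A assume "A \<in> sets (lebesgue_on B)"
    then have A: "A \<in> sets lebesgue" "A \<subseteq> B" using B by (auto simp: sets_restrict_space_iff)
    obtain S N N' where S: "A = S \<union> N" "N \<subseteq> N'" "N' \<in> null_sets lborel" "S \<in> sets lborel"
      using A(1) by (rule sets_completionE)
    have "AE x in lebesgue. x \<notin> N'"
      using S(3) by (intro AE_not_in null_sets_completionI)
    then have "(\<integral>x. indicator A x *\<^sub>R D x \<partial>lebesgue) = (\<integral>x. indicator (S \<inter> B) x *\<^sub>R D x \<partial>lebesgue)"
    proof (intro integral_cong_AE)
      show "(\<lambda>x. indicator A x *\<^sub>R D x) \<in> borel_measurable lebesgue"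
        using si[OF A(1)] unfolding set_integrable_def by (rule borel_measurable_integrable)
      show "(\<lambda>x. indicator (S \<inter> B) x *\<^sub>R D x) \<in> borel_measurable lebesgue"
        using si[of "S \<inter> B"] S(4) B unfolding set_integrable_def by (auto intro: borel_measurable_integrable)
      assume "AE x in lebesgue. x \<notin> N'"
      then show "AE x in lebesgue. indicator A x *\<^sub>R D x = indicator (S \<inter> B) x *\<^sub>R D x"
        by eventually_elim (use S A in \<open>auto simp: indicator_def\<close>)
    qed
    also have "\<dots> = 0" using borel0[of S] S(4) by (simp add: set_lebesgue_integral_def)
    finally have "(\<integral>x. indicator A x *\<^sub>R D x \<partial>lebesgue) = 0" .
    moreover have "set_lebesgue_integral (lebesgue_on B) A D = (\<integral>x. indicator A x *\<^sub>R D x \<partial>lebesgue)"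
      using B A unfolding set_lebesgue_integral_def
      by (subst integral_restrict_space) (auto simp: indicator_def intro!: Bochner_Integration.integral_cong)
    ultimately show "set_lebesgue_integral (lebesgue_on B) A D = 0" by simp
  qed
  then show ?thesis using B by (simp add: AE_restrict_space_iff B_def)
qed

theorem fundamental_lemma:
  fixes d :: "pt \<Rightarrow> real"
  assumes "open \<Omega>" "integrable (lebesgue_on \<Omega>) d"
    and orth: "\<And>\<phi>. \<phi> \<in> test_funs \<Omega> \<Longrightarrow> l2_inner \<Omega> d \<phi> = 0"
  shows "AE x in lebesgue_on \<Omega>. d x = 0"
proof -
  define D where "D x = indicator \<Omega> x * d x" for x
  have \<Omega>: "\<Omega> \<in> sets lebesgue" using assms(1) by simp
  have D: "integrable lebesgue D"
    using assms(2) \<Omega> by (simp add: integrable_restrict_space D_def[abs_def])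
  have box0: "(LINT x:box a b|lebesgue. D x) = 0" if "cbox a b \<subseteq> \<Omega>" for a b
  proof -
    have "(\<lambda>n. \<integral>x. bump (real (Suc n)) a b x * D x \<partial>lebesgue) \<longlonglongrightarrow> (\<integral>x. indicator (box a b) x * D x \<partial>lebesgue)"
    proof (rule integral_dominated_convergence)
      show "(\<lambda>x. indicator (box a b) x * D x) \<in> borel_measurable lebesgue"
        using D by (intro borel_measurable_times borel_measurable_indicator) auto
      show "(\<lambda>x. bump (real (Suc n)) a b x * D x) \<in> borel_measurable lebesgue" for n
        by (rule borel_measurable_times[OF smooth_measurable[OF smooth_bump] borel_measurable_integrable[OF D]])
      show "integrable lebesgue (\<lambda>x. norm (D x))" using D by (rule integrable_norm)
      show "AE x in lebesgue. (\<lambda>n. bump (real (Suc n)) a b x * D x) \<longlonglongrightarrow> indicator (box a b) x * D x"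
        by (intro always_eventually allI tendsto_mult bump_tendsto tendsto_const)
      show "AE x in lebesgue. norm (bump (real (Suc n)) a b x * D x) \<le> norm (D x)" for n
        using bump_le_1 bump_nonneg
        by (intro always_eventually allI) (simp add: abs_mult mult_left_le_one_le del: of_nat_Suc)
    qed
    moreover have "(\<integral>x. bump (real (Suc n)) a b x * D x \<partial>lebesgue) = 0" for n
    proof -
      have "l2_inner \<Omega> d (bump (real (Suc n)) a b) = 0"
        by (rule orth, rule bump_test_fun) (use that in auto)
      moreover have "l2_inner \<Omega> d (bump (real (Suc n)) a b) =
          (\<integral>x. bump (real (Suc n)) a b x * D x \<partial>lebesgue)"
        using \<Omega> unfolding l2_inner_def D_def
        by (subst integral_restrict_space) (auto simp: mult_ac)
      ultimately show ?thesis by simp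
    qed
    ultimately show ?thesis by (simp add: set_lebesgue_integral_def LIMSEQ_const_iff)
  qed
  obtain \<D> where \<D>: "countable \<D>" "\<D> \<subseteq> Pow \<Omega>" "\<And>X. X \<in> \<D> \<Longrightarrow> \<exists>a b. X = cbox a b" "\<Union>\<D> = \<Omega>"
    using open_countable_Union_open_cbox[OF assms(1)] by metis
  have "AE x in lebesgue. x \<in> X \<longrightarrow> D x = 0" if X\<D>: "X \<in> \<D>" for X
  proof -
    obtain l u where X: "X = cbox l u" using \<D>(3)[OF X\<D>] by blast
    have "AE x in lebesgue. x \<in> box l u \<longrightarrow> D x = 0"
    proof (rule box_integral_zero_imp_AE_zero[OF D])
      fix a b assume sub: "box a b \<subseteq> box l u"
      show "(LINT x:box a b|lebesgue. D x) = 0"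
      proof (cases "box a b = {}")
        case True
        then show ?thesis by (simp add: set_lebesgue_integral_def)
      next
        case False
        then have "cbox a b = closure (box a b)" by simp
        also have "\<dots> \<subseteq> cbox l u" using sub box_subset_cbox by (intro closure_minimal) auto
        also have "\<dots> \<subseteq> \<Omega>" using X\<D> X \<D>(2) by blast
        finally show ?thesis by (rule box0)
      qed
    qed
    moreover have "AE x in lebesgue. x \<notin> cbox l u - box l u"
      using negligible_frontier_interval[of l u] by (intro AE_not_in) (simp add: negligible_iff_null_sets)
    ultimately show ?thesis by eventually_elim (auto simp: X)
  qed
  then have "AE x in lebesgue. \<forall>X\<in>\<D>. x \<in> X \<longrightarrow> D x = 0"
    by (subst AE_ball_countable[OF \<D>(1)]) blast
  then have "AE x in lebesgue. x \<in> \<Omega> \<longrightarrow> d x = 0"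
    by eventually_elim (use \<D>(4) in \<open>auto simp: D_def indicator_def\<close>)
  then show ?thesis using \<Omega> by (simp add: AE_restrict_space_iff)
qed

section \<open>The divergence theorem on half-planes\<close>

definition perp :: "pt \<Rightarrow> pt" where
  "perp t = vector [t $ 2, - (t $ 1)]"

lemma perp_nth [simp]: "perp t $ 1 = t $ 2" "perp t $ 2 = - (t $ 1)"
  by (simp_all add: perp_def)

lemma inner_pt: "(x::pt) \<bullet> y = x $ 1 * y $ 1 + x $ 2 * y $ 2"
  by (simp add: inner_vec_def sum_2)

lemma norm_1_components: "norm (t::pt) = 1 \<Longrightarrow> (t $ 1)\<^sup>2 + (t $ 2)\<^sup>2 = 1"
  using dot_square_norm[of t] by (simp add: inner_pt power2_eq_square)

lemma inner_perp [simp]: "t \<bullet> perp t = 0" "perp t \<bullet> t = 0" by (simp_all add: inner_pt)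

lemma norm_perp [simp]: "norm (perp t) = norm t"
  by (simp add: norm_eq_sqrt_inner inner_pt)

lemma frame_component:
  assumes "norm t = 1" shows "(v \<bullet> t) * t $ i + (v \<bullet> perp t) * perp t $ i = v $ i"
proof -
  have "i = 1 \<or> i = 2" using exhaust_2 by blast
  moreover have "(v \<bullet> t) * t $ 1 + (v \<bullet> perp t) * perp t $ 1 = v $ 1 * ((t $ 1)\<^sup>2 + (t $ 2)\<^sup>2)"
    "(v \<bullet> t) * t $ 2 + (v \<bullet> perp t) * perp t $ 2 = v $ 2 * ((t $ 1)\<^sup>2 + (t $ 2)\<^sup>2)"
    by (simp_all add: inner_pt power2_eq_square algebra_simps)
  ultimately show ?thesis using norm_1_components[OF assms] by auto
qed

lemma frame_expand: "norm t = 1 \<Longrightarrow> x = (x \<bullet> t) *\<^sub>R t + (x \<bullet> perp t) *\<^sub>R perp t"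
  by (simp add: vec_eq_iff frame_component)

lemma lborel_distr_orthogonal:
  assumes "orthogonal_transformation (f :: pt \<Rightarrow> pt)"
  shows "distr lborel borel f = lborel"
proof (rule lborel_eqI[symmetric])
  have lin: "linear f" by (rule orthogonal_transformation_linear[OF assms])
  have meas: "f \<in> borel_measurable borel"
    by (rule borel_measurable_continuous_onI) (rule linear_continuous_on[OF linear_conv_bounded_linear[THEN iffD1, OF lin]])
  fix l u :: pt assume lu: "\<And>b. b \<in> Basis \<Longrightarrow> l \<bullet> b \<le> u \<bullet> b"
  define A where "A = f -` box l u"
  have bij: "bij f" by (rule orthogonal_transformation_bij[OF assms])
  have A: "A = inv f ` box l u" unfolding A_def by (rule bij_vimage_eq_inv_image[OF bij])
  have inv: "orthogonal_transformation (inv f)" by (rule orthogonal_transformation_inv[OF assms])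
  have lm: "box l u \<in> lmeasurable" by simp
  have borel: "A \<in> sets borel" using meas unfolding A_def by (rule measurable_sets_borel) simp
  have "emeasure lborel A = emeasure lebesgue A" using borel by simp
  also have "\<dots> = measure lebesgue A"
    unfolding A by (intro emeasure_eq_measure2 measurable_orthogonal_image inv lm)
  also have "\<dots> = measure lebesgue (box l u)"
    unfolding A by (simp add: measure_orthogonal_image inv)
  also have "\<dots> = emeasure lborel (box l u)"
    using emeasure_eq_measure2[OF lm] by simp
  also have "\<dots> = (\<Prod>b\<in>Basis. (u - l) \<bullet> b)" using lu by (rule emeasure_lborel_box)
  finally show "emeasure (distr lborel borel f) (box l u) = (\<Prod>b\<in>Basis. (u - l) \<bullet> b)"
    using meas by (simp add: emeasure_distr A_def)
qed simp

lemma Basis_pt: "(Basis :: pt set) = {axis 1 1, axis 2 1}"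
  by (simp add: Basis_vec_def UNIV_2 insert_commute)

definition frame :: "pt \<Rightarrow> pt \<Rightarrow> real \<times> real \<Rightarrow> pt" where
  "frame t n z = fst z *\<^sub>R t + snd z *\<^sub>R n"

lemma frame_measurable [measurable]: "frame t n \<in> borel_measurable (lborel \<Otimes>\<^sub>M lborel)"
  unfolding frame_def[abs_def] by measurable

lemma lborel_distr_axes: "distr (lborel \<Otimes>\<^sub>M lborel) borel (frame (axis 1 1) (axis 2 1)) = lborel"
proof (rule lborel_eqI[symmetric])
  fix l u :: pt assume lu: "\<And>b. b \<in> Basis \<Longrightarrow> l \<bullet> b \<le> u \<bullet> b"
  have "frame (axis 1 1) (axis 2 1) -` box l u = {l $ 1<..<u $ 1} \<times> {l $ 2<..<u $ 2}"
    by (auto simp: frame_def mem_box_cart forall_2 axis_def)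
  moreover have "l $ 1 \<le> u $ 1" "l $ 2 \<le> u $ 2"
    using lu[of "axis 1 1"] lu[of "axis 2 1"] by (simp_all add: Basis_pt inner_axis)
  ultimately show "emeasure (distr (lborel \<Otimes>\<^sub>M lborel) borel (frame (axis 1 1) (axis 2 1))) (box l u) =
      (\<Prod>b\<in>Basis. (u - l) \<bullet> b)"
    by (simp add: emeasure_distr space_pair_measure lborel.emeasure_pair_measure_Times Basis_pt
        inner_axis axis_eq_axis ennreal_mult)
qed simp

lemma lborel_distr_frame:
  assumes "norm t = 1"
  shows "distr (lborel \<Otimes>\<^sub>M lborel) borel (frame t (perp t)) = lborel"
proof -
  define g where "g y = y $ 1 *\<^sub>R t + y $ 2 *\<^sub>R perp t" for y :: pt
  have "linear g" by (rule linearI) (simp_all add: g_def algebra_simps)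
  moreover have "g v \<bullet> g w = v \<bullet> w" for v w
    using norm_1_components[OF assms] by (simp add: g_def inner_pt) algebra
  ultimately have orth: "orthogonal_transformation g" by (simp add: orthogonal_transformation_def)
  have meas: "g \<in> borel_measurable borel"
    by (rule borel_measurable_continuous_onI)
      (rule linear_continuous_on[OF linear_conv_bounded_linear[THEN iffD1, OF \<open>linear g\<close>]])
  have "frame t (perp t) = g \<circ> frame (axis 1 1) (axis 2 1)"
    by (auto simp: fun_eq_iff frame_def g_def axis_def)
  then have "distr (lborel \<Otimes>\<^sub>M lborel) borel (frame t (perp t)) =
      distr (distr (lborel \<Otimes>\<^sub>M lborel) borel (frame (axis 1 1) (axis 2 1))) borel g"
    using meas by (simp add: distr_distr)
  also have "\<dots> = lborel" by (simp add: lborel_distr_axes lborel_distr_orthogonal[OF orth])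
  finally show ?thesis .
qed

lemma integral_derivative_lessThan:
  fixes f f' :: "real \<Rightarrow> real"
  assumes "\<And>x. (f has_real_derivative f' x) (at x)" "continuous_on UNIV f'"
    "\<And>x. x < - R \<Longrightarrow> f x = 0" "\<And>x. x < - R \<Longrightarrow> f' x = 0"
  shows "(\<integral>x. indicator {..<c} x * f' x \<partial>lborel) = f c"
proof -
  define a where "a = min c (- R) - 1"
  have a: "a \<le> c" "a < - R" by (auto simp: a_def)
  have cont: "isCont f' x" for x using assms(2) by (simp add: continuous_on_eq_continuous_at)
  have m: "f' \<in> borel_measurable borel" using assms(2) by (rule borel_measurable_continuous_onI)
  have "AE x in lborel. x \<noteq> c" by (rule AE_lborel_singleton)
  then have "(\<integral>x. indicator {..<c} x * f' x \<partial>lborel) = (\<integral>x. f' x * indicator {a..c} x \<partial>lborel)"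
  proof (intro integral_cong_AE)
    assume "AE x in lborel. x \<noteq> c"
    then show "AE x in lborel. indicator {..<c} x * f' x = f' x * indicator {a..c} x"
    proof eventually_elim
      case (elim x)
      show ?case using elim a assms(4)[of x] by (cases "x < a") (auto simp: indicator_def)
    qed
  qed (use m in \<open>auto intro!: borel_measurable_times borel_measurable_indicator\<close>)
  also have "\<dots> = f c - f a"
    by (rule integral_FTC_Icc_real[OF a(1)]) (use assms(1) cont in auto)
  also have "f a = 0" using a assms(3) by simp
  finally show ?thesis by simp
qed

lemma half_plane_frame:
  assumes t: "norm t = 1" shows "frame t (perp t) (s, r) \<bullet> perp t = r"
proof -
  have "perp t \<bullet> perp t = 1" using t norm_perp[of t] by (simp add: dot_square_norm)
  then show ?thesis by (simp add: frame_def inner_add_left)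
qed

theorem half_plane_pd_integral:
  assumes f: "f \<in> test_funs UNIV" and t: "norm t = 1"
  shows "(\<integral>x. indicator {x. x \<bullet> perp t < c} x * pd i f x \<partial>lborel) =
    perp t $ i * (\<integral>s. f (s *\<^sub>R t + c *\<^sub>R perp t) \<partial>lborel)"
proof -
  define n where "n = perp t"
  define H where "H = {x::pt. x \<bullet> n < c}"
  define T where "T = frame t n"
  have sm: "smooth f" using f by (rule test_funs_smooth)
  obtain K where K: "compact K" "\<And>x. x \<notin> K \<Longrightarrow> f x = 0" "\<And>x i. x \<notin> K \<Longrightarrow> pd i f x = 0"
    using test_fun_support[OF f] by metis
  obtain R where R: "\<And>x. x \<in> K \<Longrightarrow> norm x \<le> R"
    using K(1) compact_imp_bounded bounded_iff by metis
  have nn: "n \<bullet> n = 1" using t norm_perp[of t] by (simp add: n_def dot_square_norm)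
  have tt: "t \<bullet> t = 1" using t by (simp add: dot_square_norm)
  have Tt: "T (s, r) \<bullet> t = s" for s r by (simp add: T_def frame_def inner_add_left tt n_def)
  have Tn: "T (s, r) \<bullet> n = r" for s r unfolding T_def n_def by (rule half_plane_frame[OF t])
  have out: "T (s, r) \<notin> K" if "\<bar>s\<bar> > R \<or> \<bar>r\<bar> > R" for s r
    using R[of "T (s, r)"] Cauchy_Schwarz_ineq2[of "T (s, r)" t] Cauchy_Schwarz_ineq2[of "T (s, r)" n]
      that t norm_perp[of t] by (auto simp: Tt Tn[unfolded n_def] n_def)
  have H: "H \<in> sets borel" unfolding H_def by (simp add: borel_measurable_less)
  have pdc: "continuous_on A (pd j f)" for A j by (intro smooth_continuous smooth_pd sm)
  have int: "integrable lborel (\<lambda>x. indicator H x * pd j f x)" for j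
  proof -
    have "integrable lborel (\<lambda>x. indicator K x *\<^sub>R pd j f x)"
      by (rule borel_integrable_compact[OF K(1) pdc])
    also have "(\<lambda>x. indicator K x *\<^sub>R pd j f x) = pd j f"
      using K(3) by (auto simp: indicator_def fun_eq_iff)
    finally have "integrable lborel (pd j f)" .
    from integrable_mult_indicator[OF _ this, of H] H show ?thesis by simp
  qed
  have dirint: "integrable lborel (\<lambda>x. indicator H x * (grad f x \<bullet> v))" for v
  proof -
    have "integrable lborel (\<lambda>x. (indicator H x * pd 1 f x) * v $ 1 + (indicator H x * pd 2 f x) * v $ 2)"
      using int by (intro Bochner_Integration.integrable_add integrable_mult_left) auto
    then show ?thesis by (simp add: inner_pt grad_def algebra_simps)
  qed
  have distr: "distr (lborel \<Otimes>\<^sub>M lborel) borel T = lborel"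
    unfolding T_def n_def by (rule lborel_distr_frame[OF t])
  have Tm [measurable]: "T \<in> borel_measurable (lborel \<Otimes>\<^sub>M lborel)" unfolding T_def by simp
  have chain: "((\<lambda>a. f (b + a *\<^sub>R v)) has_real_derivative grad f (b + a *\<^sub>R v) \<bullet> v) (at a)" for b v a
  proof -
    have "((\<lambda>a. b + a *\<^sub>R v) has_derivative (\<lambda>h. h *\<^sub>R v)) (at a)"
      by (auto intro!: derivative_eq_intros)
    from has_derivative_compose[OF this differentiable_has_derivative_pd[OF smooth_differentiable[OF sm]]]
    show ?thesis by (simp add: has_field_derivative_def mult_commute_abs)
  qed
  have gcont: "continuous_on UNIV (\<lambda>a. grad f (b + a *\<^sub>R v) \<bullet> w)" for b v w
    unfolding inner_pt grad_def vec_lambda_beta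
    by (intro continuous_intros continuous_on_compose2[OF pdc[of UNIV]]) auto
  have gradK: "x \<notin> K \<Longrightarrow> grad f x \<bullet> v = 0" for x v using K(3) by (simp add: inner_pt grad_def)
  have transform: "integrable (lborel \<Otimes>\<^sub>M lborel) (\<lambda>z. indicator H (T z) * (grad f (T z) \<bullet> v))"
    "(\<integral>x. indicator H x * (grad f x \<bullet> v) \<partial>lborel) =
      (\<integral>z. indicator H (T z) * (grad f (T z) \<bullet> v) \<partial>(lborel \<Otimes>\<^sub>M lborel))" for v
  proof -
    have bm: "(\<lambda>x. indicator H x * (grad f x \<bullet> v)) \<in> borel_measurable borel"
      using borel_measurable_integrable[OF dirint] by simp
    show "integrable (lborel \<Otimes>\<^sub>M lborel) (\<lambda>z. indicator H (T z) * (grad f (T z) \<bullet> v))"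
      using dirint[of v] integrable_distr_eq[OF Tm bm] by (simp add: distr)
    show "(\<integral>x. indicator H x * (grad f x \<bullet> v) \<partial>lborel) =
      (\<integral>z. indicator H (T z) * (grad f (T z) \<bullet> v) \<partial>(lborel \<Otimes>\<^sub>M lborel))"
      using integral_distr[OF Tm bm] by (simp add: distr)
  qed
  have Hz: "indicator H (T (s, r)) = (indicator {..<c} r :: real)" for s r
    by (simp add: H_def Tn indicator_def)
  have I_t: "(\<integral>x. indicator H x * (grad f x \<bullet> t) \<partial>lborel) = 0"
  proof -
    have "(\<integral>x. indicator H x * (grad f x \<bullet> t) \<partial>lborel) =
        (\<integral>r. \<integral>s. indicator H (T (s, r)) * (grad f (T (s, r)) \<bullet> t) \<partial>lborel \<partial>lborel)"
      using lborel_pair.integral_snd[of "\<lambda>s r. indicator H (T (s, r)) * (grad f (T (s, r)) \<bullet> t)"]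
        transform[of t] by (simp add: case_prod_beta')
    also have "(\<lambda>r. \<integral>s. indicator H (T (s, r)) * (grad f (T (s, r)) \<bullet> t) \<partial>lborel) = (\<lambda>r. 0)"
    proof
      fix r
      have T': "T (s, r) = r *\<^sub>R n + s *\<^sub>R t" for s by (simp add: T_def frame_def add.commute)
      have z: "f (r *\<^sub>R n + s *\<^sub>R t) = 0" "grad f (r *\<^sub>R n + s *\<^sub>R t) \<bullet> t = 0" if "\<bar>s\<bar> > R" for s
        using K(2)[OF out[of s r]] gradK[OF out[of s r]] that by (simp_all add: T')
      have "(\<integral>s. indicator {..<R + 1} s * (grad f (r *\<^sub>R n + s *\<^sub>R t) \<bullet> t) \<partial>lborel) = f (r *\<^sub>R n + (R + 1) *\<^sub>R t)"
        by (rule integral_derivative_lessThan[where R = R])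
          (use chain gcont z in auto)
      also have "\<dots> = 0" by (rule z(1)) linarith
      also have "(\<lambda>s. indicator {..<R + 1} s * (grad f (r *\<^sub>R n + s *\<^sub>R t) \<bullet> t)) =
          (\<lambda>s. grad f (r *\<^sub>R n + s *\<^sub>R t) \<bullet> t)"
        by (auto simp: indicator_def fun_eq_iff intro!: z(2))
      finally show "(\<integral>s. indicator H (T (s, r)) * (grad f (T (s, r)) \<bullet> t) \<partial>lborel) = 0"
        by (simp only: Hz) (simp add: T')
    qed
    finally show ?thesis by simp
  qed
  have I_n: "(\<integral>x. indicator H x * (grad f x \<bullet> n) \<partial>lborel) = (\<integral>s. f (s *\<^sub>R t + c *\<^sub>R n) \<partial>lborel)"
  proof -
    have "(\<integral>x. indicator H x * (grad f x \<bullet> n) \<partial>lborel) =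
        (\<integral>s. \<integral>r. indicator H (T (s, r)) * (grad f (T (s, r)) \<bullet> n) \<partial>lborel \<partial>lborel)"
      using lborel_pair.integral_fst'[OF transform(1)] transform(2) by simp
    also have "(\<lambda>s. \<integral>r. indicator H (T (s, r)) * (grad f (T (s, r)) \<bullet> n) \<partial>lborel) =
        (\<lambda>s. f (s *\<^sub>R t + c *\<^sub>R n))"
    proof
      fix s
      have T': "T (s, r) = s *\<^sub>R t + r *\<^sub>R n" for r by (simp add: T_def frame_def)
      have z: "f (s *\<^sub>R t + r *\<^sub>R n) = 0" "grad f (s *\<^sub>R t + r *\<^sub>R n) \<bullet> n = 0" if "\<bar>r\<bar> > R" for r
        using K(2)[OF out[of s r]] gradK[OF out[of s r]] that by (simp_all add: T')
      have "(\<integral>r. indicator {..<c} r * (grad f (s *\<^sub>R t + r *\<^sub>R n) \<bullet> n) \<partial>lborel) = f (s *\<^sub>R t + c *\<^sub>R n)"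
        by (rule integral_derivative_lessThan[where R = R])
          (use chain gcont z in auto)
      then show "(\<integral>r. indicator H (T (s, r)) * (grad f (T (s, r)) \<bullet> n) \<partial>lborel) = f (s *\<^sub>R t + c *\<^sub>R n)"
        by (simp only: Hz) (simp add: T')
    qed
    finally show ?thesis .
  qed
  have "(\<integral>x. indicator H x * pd i f x \<partial>lborel) =
      (\<integral>x. (indicator H x * (grad f x \<bullet> t)) * t $ i + (indicator H x * (grad f x \<bullet> n)) * n $ i \<partial>lborel)"
  proof (rule Bochner_Integration.integral_cong[OF refl])
    fix x
    have "pd i f x = (grad f x \<bullet> t) * t $ i + (grad f x \<bullet> n) * n $ i"
      using frame_component[OF t, of "grad f x" i] by (simp add: n_def grad_def)
    then show "indicator H x * pd i f x =
        (indicator H x * (grad f x \<bullet> t)) * t $ i + (indicator H x * (grad f x \<bullet> n)) * n $ i"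
      by (simp add: algebra_simps)
  qed
  also have "\<dots> = n $ i * (\<integral>s. f (s *\<^sub>R t + c *\<^sub>R n) \<partial>lborel)"
    using dirint by (simp add: I_t I_n)
  finally show ?thesis by (simp add: H_def n_def)
qed

corollary integral_pd_test_fun:
  assumes f: "f \<in> test_funs UNIV" shows "(\<integral>x. pd i f x \<partial>lborel) = 0"
proof -
  define t :: pt where "t = axis 1 1"
  have t: "norm t = 1" by (simp add: t_def norm_axis_1)
  obtain K where K: "compact K" "\<And>x. x \<notin> K \<Longrightarrow> f x = 0" "\<And>x i. x \<notin> K \<Longrightarrow> pd i f x = 0"
    using test_fun_support[OF f] by metis
  obtain R where R: "\<And>x. x \<in> K \<Longrightarrow> norm x \<le> R"
    using K(1) compact_imp_bounded bounded_iff by metis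
  have in_H: "x \<bullet> perp t < R + 1" if "x \<in> K" for x
    using R[OF that] Cauchy_Schwarz_ineq2[of x "perp t"] t by simp
  have "f (s *\<^sub>R t + (R + 1) *\<^sub>R perp t) = 0" for s
    using in_H[of "s *\<^sub>R t + (R + 1) *\<^sub>R perp t"] half_plane_frame[OF t, of s "R + 1"] K(2)
    by (force simp: frame_def)
  then have "(\<integral>x. indicator {x. x \<bullet> perp t < R + 1} x * pd i f x \<partial>lborel) = 0"
    using half_plane_pd_integral[OF f t, of "R + 1" i] by simp
  moreover have "indicator {x. x \<bullet> perp t < R + 1} x * pd i f x = pd i f x" for x
    using in_H[of x] K(3)[of x i] by (auto simp: indicator_def)
  ultimately show ?thesis by simp
qed

section \<open>Square integrable functions and weak derivatives\<close>

lemma L2_inner_integrable: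
  assumes "f \<in> L2 A" "g \<in> L2 A" shows "integrable (lebesgue_on A) (\<lambda>x. f x \<bullet> g x)"
proof (rule Bochner_Integration.integrable_bound)
  show "integrable (lebesgue_on A) (\<lambda>x. (norm (f x))\<^sup>2 + (norm (g x))\<^sup>2)"
    using assms by (simp add: L2_def)
  show "(\<lambda>x. f x \<bullet> g x) \<in> borel_measurable (lebesgue_on A)"
    using assms by (auto simp: L2_def intro: borel_measurable_inner)
  have "\<bar>f x \<bullet> g x\<bar> \<le> (norm (f x))\<^sup>2 + (norm (g x))\<^sup>2" for x
  proof -
    have "\<bar>f x \<bullet> g x\<bar> \<le> norm (f x) * norm (g x)" by (rule Cauchy_Schwarz_ineq2)
    also have "\<dots> \<le> (norm (f x))\<^sup>2 + (norm (g x))\<^sup>2"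
      using sum_squares_bound[of "norm (f x)" "norm (g x)"]
        mult_nonneg_nonneg[OF norm_ge_zero[of "f x"] norm_ge_zero[of "g x"]] by linarith
    finally show ?thesis .
  qed
  then show "AE x in lebesgue_on A. norm (f x \<bullet> g x) \<le> norm ((norm (f x))\<^sup>2 + (norm (g x))\<^sup>2)"
    by simp
qed

lemma norm_sq_add_le: "(norm (a + b))\<^sup>2 \<le> 2 * (norm a)\<^sup>2 + 2 * (norm (b :: 'a::real_normed_vector))\<^sup>2"
proof -
  have "(norm (a + b))\<^sup>2 \<le> (norm a + norm b)\<^sup>2" by (intro power_mono norm_triangle_ineq) simp
  also have "\<dots> \<le> 2 * (norm a)\<^sup>2 + 2 * (norm b)\<^sup>2"
    using sum_squares_bound[of "norm a" "norm b"] by (simp add: power2_sum)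
  finally show ?thesis .
qed

lemma L2_add:
  assumes "f \<in> L2 A" "g \<in> L2 A" shows "(\<lambda>x. f x + g x) \<in> L2 A"
proof -
  have m: "(\<lambda>x. f x + g x) \<in> borel_measurable (lebesgue_on A)"
    using assms by (auto simp: L2_def)
  moreover have "integrable (lebesgue_on A) (\<lambda>x. (norm (f x + g x))\<^sup>2)"
  proof (rule Bochner_Integration.integrable_bound)
    show "integrable (lebesgue_on A) (\<lambda>x. 2 * (norm (f x))\<^sup>2 + 2 * (norm (g x))\<^sup>2)"
      using assms by (simp add: L2_def)
    show "(\<lambda>x. (norm (f x + g x))\<^sup>2) \<in> borel_measurable (lebesgue_on A)"
      by (rule measurable_compose[OF m borel_measurable_continuous_onI]) (intro continuous_intros)
  qed (simp add: norm_sq_add_le)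
  ultimately show ?thesis by (simp add: L2_def)
qed

lemma L2_scale: "f \<in> L2 A \<Longrightarrow> (\<lambda>x. c *\<^sub>R f x) \<in> L2 A"
  by (auto simp: L2_def power_mult_distrib intro: borel_measurable_scaleR)

lemma L2_diff: "f \<in> L2 A \<Longrightarrow> g \<in> L2 A \<Longrightarrow> (\<lambda>x. f x - g x) \<in> L2 A"
  using L2_add[OF _ L2_scale[of g A "-1"]] by simp

lemma L2_component:
  assumes "g \<in> L2 A" shows "(\<lambda>x. (g x :: pt) $ i) \<in> L2 A"
proof -
  have m: "(\<lambda>x. g x $ i) \<in> borel_measurable (lebesgue_on A)"
    using assms borel_measurable_inner[of g "lebesgue_on A" "\<lambda>_. axis i 1"]
    by (simp add: L2_def inner_axis)
  moreover have "integrable (lebesgue_on A) (\<lambda>x. (norm (g x $ i))\<^sup>2)"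
  proof (rule Bochner_Integration.integrable_bound)
    show "integrable (lebesgue_on A) (\<lambda>x. (norm (g x))\<^sup>2)"
      using assms by (simp add: L2_def)
    show "(\<lambda>x. (norm (g x $ i))\<^sup>2) \<in> borel_measurable (lebesgue_on A)"
      by (rule measurable_compose[OF m borel_measurable_continuous_onI]) (intro continuous_intros)
    have "(norm (g x $ i))\<^sup>2 \<le> (norm (g x))\<^sup>2" for x
      by (intro power_mono) (use component_le_norm_cart[of "g x" i] in auto)
    then show "AE x in lebesgue_on A. norm ((norm (g x $ i))\<^sup>2) \<le> norm ((norm (g x))\<^sup>2)" by simp
  qed
  ultimately show ?thesis by (simp add: L2_def)
qed

lemma L2_integrable:
  assumes "f \<in> L2 A" "A \<in> lmeasurable" shows "integrable (lebesgue_on A) (f :: pt \<Rightarrow> real)"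
proof -
  have "(\<lambda>x. 1::real) \<in> L2 A"
    using finite_measure.integrable_const[OF finite_measure_lebesgue_on[OF assms(2)]] by (simp add: L2_def)
  from L2_inner_integrable[OF assms(1) this] show ?thesis by simp
qed

lemma integrable_lebesgue_on_subset:
  fixes f :: "pt \<Rightarrow> 'b::euclidean_space"
  assumes "integrable (lebesgue_on A) f" "B \<subseteq> A" "A \<in> sets lebesgue" "B \<in> sets lebesgue"
  shows "integrable (lebesgue_on B) f"
proof -
  have "integrable lebesgue (\<lambda>x. indicator A x *\<^sub>R f x)"
    using assms by (simp add: integrable_restrict_space)
  from integrable_mult_indicator[OF assms(4) this]
  have "integrable lebesgue (\<lambda>x. indicator B x *\<^sub>R (indicator A x *\<^sub>R f x))" .
  also have "(\<lambda>x. indicator B x *\<^sub>R (indicator A x *\<^sub>R f x)) = (\<lambda>x. indicator B x *\<^sub>R f x)"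
    using assms(2) by (auto simp: indicator_def fun_eq_iff)
  finally show ?thesis using assms by (simp add: integrable_restrict_space)
qed

lemma L2_subset:
  fixes f :: "pt \<Rightarrow> 'b::euclidean_space"
  assumes "f \<in> L2 A" "B \<subseteq> A" "A \<in> sets lebesgue" "B \<in> sets lebesgue" shows "f \<in> L2 B"
proof -
  have f: "f \<in> borel_measurable (lebesgue_on A)" "integrable (lebesgue_on A) (\<lambda>x. (norm (f x))\<^sup>2)"
    using assms(1) by (simp_all add: L2_def)
  show ?thesis
    using measurable_restrict_mono[OF f(1) assms(2)] integrable_lebesgue_on_subset[OF f(2) assms(2-4)]
    by (simp add: L2_def)
qed

lemma continuous_L2:
  fixes f :: "pt \<Rightarrow> 'b::euclidean_space"
  assumes "continuous_on UNIV f" "bounded A" "A \<in> sets lebesgue" shows "f \<in> L2 A"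
proof -
  have "integrable (lebesgue_on (closure A)) (\<lambda>x. (norm (f x))\<^sup>2)"
    by (intro continuous_integrable_compact continuous_intros continuous_on_subset[OF assms(1)])
      (use assms in auto)
  moreover have "f \<in> borel_measurable (lebesgue_on (closure A))"
    by (rule continuous_imp_measurable_on_sets_lebesgue) (use continuous_on_subset[OF assms(1)] in auto)
  ultimately have "f \<in> L2 (closure A)" by (simp add: L2_def)
  then show ?thesis by (rule L2_subset) (use assms closure_subset in auto)
qed

lemma test_fun_L2:
  assumes "\<phi> \<in> test_funs \<Omega>" "A \<in> sets lebesgue" shows "\<phi> \<in> L2 A"
proof -
  have sm: "smooth \<phi>" using assms(1) by (rule test_funs_smooth)
  have "integrable lebesgue (\<lambda>x. (norm (\<phi> x))\<^sup>2)"
    using test_funs_integrable[OF assms(1) smooth_continuous[OF sm]] by (simp add: power2_eq_square)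
  then have "\<phi> \<in> L2 UNIV"
    using smooth_measurable[OF sm] by (simp add: L2_def lebesgue_on_UNIV_eq)
  from L2_subset[OF this subset_UNIV _ assms(2)] show ?thesis by simp
qed

lemma grad_L2:
  assumes "\<phi> \<in> test_funs \<Omega>" "A \<in> sets lebesgue" shows "grad \<phi> \<in> L2 A"
proof -
  have "(\<lambda>x. pd 1 \<phi> x *\<^sub>R axis 1 1 + pd 2 \<phi> x *\<^sub>R (axis 2 1 :: pt)) \<in> L2 A"
  proof -
    have "(\<lambda>x. pd j \<phi> x *\<^sub>R (axis j 1 :: pt)) \<in> L2 A" for j
      using test_fun_L2[OF test_funs_pd[OF assms(1)] assms(2), of j]
      by (auto simp: L2_def norm_axis_1 intro: borel_measurable_scaleR)
    from L2_add[OF this[of 1] this[of 2]] show ?thesis .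
  qed
  moreover have "(\<lambda>x. pd 1 \<phi> x *\<^sub>R axis 1 1 + pd 2 \<phi> x *\<^sub>R (axis 2 1 :: pt)) = grad \<phi>"
    by (auto simp: grad_def vec_eq_iff axis_def forall_2)
  ultimately show ?thesis by simp
qed

lemma l2_inner_diff_left:
  "f \<in> L2 A \<Longrightarrow> g \<in> L2 A \<Longrightarrow> h \<in> L2 A \<Longrightarrow>
    l2_inner A (\<lambda>x. f x - g x) h = l2_inner A f h - l2_inner A g h"
  by (simp add: l2_inner_def inner_diff_left L2_inner_integrable)

lemma l2_inner_commute: "l2_inner A f g = l2_inner A g f"
  by (simp add: l2_inner_def inner_commute)

lemma l2_inner_cong_AE:
  assumes "f \<in> L2 A" "g \<in> L2 A" "h \<in> L2 A" "AE x in lebesgue_on A. f x = g x"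
  shows "l2_inner A f h = l2_inner A g h"
  unfolding l2_inner_def
proof (rule integral_cong_AE)
  show "AE x in lebesgue_on A. f x \<bullet> h x = g x \<bullet> h x" using assms(4) by eventually_elim simp
qed (use assms in \<open>auto simp: L2_def intro: borel_measurable_inner\<close>)

lemma l2_inner_restrict:
  assumes "V \<subseteq> \<Omega>" "V \<in> sets lebesgue" "\<Omega> \<in> sets lebesgue" "\<And>x. x \<notin> V \<Longrightarrow> g x = 0"
  shows "l2_inner \<Omega> f g = l2_inner V f g"
proof -
  have "indicator \<Omega> x *\<^sub>R (f x \<bullet> g x) = indicator V x *\<^sub>R (f x \<bullet> g x)" for x
    using assms by (cases "x \<in> V") (auto simp: indicator_def)
  from Bochner_Integration.integral_cong[OF refl this, of lebesgue] show ?thesis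
    using assms(2,3) unfolding l2_inner_def by (subst (1 2) integral_restrict_space) simp_all
qed

lemma l2_inner_test_fun:
  assumes "\<psi> \<in> test_funs V" "V \<in> sets lebesgue" "continuous_on UNIV f"
  shows "l2_inner V f \<psi> = (\<integral>x. f x * \<psi> x \<partial>lborel)"
proof -
  have "l2_inner V f \<psi> = l2_inner UNIV f \<psi>"
    by (rule l2_inner_restrict[symmetric]) (use assms test_funs_zero_outside in auto)
  also have "\<dots> = (\<integral>x. f x * \<psi> x \<partial>lebesgue)" by (simp add: l2_inner_def lebesgue_on_UNIV_eq)
  also have "\<dots> = (\<integral>x. f x * \<psi> x \<partial>lborel)"
  proof (rule integral_completion)
    have "(\<lambda>x. f x * \<psi> x) \<in> borel_measurable borel"
      by (intro borel_measurable_continuous_onI continuous_intros assms smooth_continuous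
          test_funs_smooth[OF assms(1)])
    then show "(\<lambda>x. f x * \<psi> x) \<in> borel_measurable lborel" by simp
  qed
  finally show ?thesis .
qed

lemma integration_by_parts_test_fun:
  assumes "\<phi> \<in> test_funs V" "open V" "smooth f"
  shows "l2_inner V f (pd i \<phi>) = - l2_inner V (pd i f) \<phi>"
proof -
  have sm: "smooth \<phi>" using assms(1) by (rule test_funs_smooth)
  have prod: "(\<lambda>x. f x * \<phi> x) \<in> test_funs UNIV"
    using test_funs_mult_smooth[OF assms(1,3)] test_funs_mono by blast
  have int: "integrable lborel (\<lambda>x. g x * \<psi> x)" if "\<psi> \<in> test_funs V" "continuous_on UNIV g" for g \<psi>
  proof -
    have "(\<lambda>x. g x * \<psi> x) \<in> borel_measurable borel"
      by (intro borel_measurable_continuous_onI continuous_intros that smooth_continuous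
          test_funs_smooth[OF that(1)])
    then have "(\<lambda>x. g x * \<psi> x) \<in> borel_measurable lborel" by simp
    from integrable_completion[OF this] show ?thesis using test_funs_integrable[OF that] by simp
  qed
  have "0 = (\<integral>x. pd i (\<lambda>x. f x * \<phi> x) x \<partial>lborel)" using integral_pd_test_fun[OF prod] by simp
  also have "\<dots> = (\<integral>x. pd i f x * \<phi> x + f x * pd i \<phi> x \<partial>lborel)"
    by (simp add: pd_mult smooth_differentiable assms(3) sm)
  also have "\<dots> = (\<integral>x. pd i f x * \<phi> x \<partial>lborel) + (\<integral>x. f x * pd i \<phi> x \<partial>lborel)"
    by (intro Bochner_Integration.integral_add int test_funs_pd assms(1) smooth_continuous smooth_pd assms(3))
  finally show ?thesis
    using assms by (simp add: l2_inner_test_fun test_funs_pd smooth_continuous smooth_pd)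
qed

lemma has_weak_grad_smooth: "open V \<Longrightarrow> smooth f \<Longrightarrow> has_weak_grad V f (grad f)"
  unfolding has_weak_grad_def grad_def by (simp add: integration_by_parts_test_fun)

definition divg :: "(pt \<Rightarrow> pt) \<Rightarrow> pt \<Rightarrow> real" where
  "divg q x = (\<Sum>i\<in>UNIV. pd i (\<lambda>y. q y $ i) x)"

lemma has_weak_div_smooth:
  assumes "open V" "bounded V" "\<And>i. smooth (\<lambda>x. q x $ i)"
  shows "has_weak_div V q (divg q)"
  unfolding has_weak_div_def
proof
  fix \<phi> assume \<phi>: "\<phi> \<in> test_funs V"
  have V: "V \<in> sets lebesgue" using assms(1) by simp
  have L2: "f \<in> L2 V" if "smooth f" for f
    by (rule continuous_L2[OF smooth_continuous[OF that] assms(2) V])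
  have comp: "l2_inner V (\<lambda>x. q x $ i) (pd i \<phi>) = - l2_inner V (pd i (\<lambda>x. q x $ i)) \<phi>" for i
    by (rule integration_by_parts_test_fun[OF \<phi> assms(1,3)])
  have "l2_inner V q (grad \<phi>) = (\<Sum>i\<in>UNIV. l2_inner V (\<lambda>x. q x $ i) (pd i \<phi>))"
    unfolding l2_inner_def inner_vec_def grad_def vec_lambda_beta
    using L2_inner_integrable[OF L2[OF assms(3)] test_fun_L2[OF test_funs_pd[OF \<phi>] V]]
    by (subst Bochner_Integration.integral_sum) auto
  also have "\<dots> = - (\<Sum>i\<in>UNIV. l2_inner V (pd i (\<lambda>x. q x $ i)) \<phi>)"
    by (simp add: comp sum_negf)
  also have "(\<Sum>i\<in>UNIV. l2_inner V (pd i (\<lambda>x. q x $ i)) \<phi>) = l2_inner V (divg q) \<phi>"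
    unfolding l2_inner_def divg_def inner_sum_left
    using L2_inner_integrable[OF L2[OF smooth_pd[OF assms(3)]] test_fun_L2[OF \<phi> V]]
    by (subst Bochner_Integration.integral_sum) auto
  finally show "l2_inner V q (grad \<phi>) = - l2_inner V (divg q) \<phi>" .
qed

lemma grad_zero_outside: "\<phi> \<in> test_funs V \<Longrightarrow> x \<notin> V \<Longrightarrow> grad \<phi> x = 0"
  using test_funs_zero_outside[OF test_funs_pd] by (simp add: grad_def vec_eq_iff)

lemma has_weak_grad_restrict:
  assumes "has_weak_grad \<Omega> u g" "V \<subseteq> \<Omega>" "open V" "open \<Omega>" "\<And>x. x \<in> V \<Longrightarrow> u x = f x"
  shows "has_weak_grad V f g"
  unfolding has_weak_grad_def
proof (intro ballI allI)
  fix \<phi> i assume \<phi>: "\<phi> \<in> test_funs V"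
  have res: "l2_inner \<Omega> w \<psi> = l2_inner V w \<psi>" if "\<psi> \<in> test_funs V" for w \<psi>
    by (rule l2_inner_restrict) (use assms that test_funs_zero_outside in auto)
  have "l2_inner V f (pd i \<phi>) = l2_inner V u (pd i \<phi>)"
    unfolding l2_inner_def using assms(5) by (intro Bochner_Integration.integral_cong) auto
  also have "\<dots> = l2_inner \<Omega> u (pd i \<phi>)" by (simp add: res test_funs_pd \<phi>)
  also have "\<dots> = - l2_inner \<Omega> (\<lambda>x. g x $ i) \<phi>"
    using assms(1) \<phi> test_funs_mono[OF assms(2)] by (auto simp: has_weak_grad_def)
  finally show "l2_inner V f (pd i \<phi>) = - l2_inner V (\<lambda>x. g x $ i) \<phi>" by (simp add: res \<phi>)
qed

lemma has_weak_div_restrict: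
  assumes "has_weak_div \<Omega> \<tau> d" "V \<subseteq> \<Omega>" "open V" "open \<Omega>" "\<And>x. x \<in> V \<Longrightarrow> \<tau> x = q x"
  shows "has_weak_div V q d"
  unfolding has_weak_div_def
proof
  fix \<phi> assume \<phi>: "\<phi> \<in> test_funs V"
  have "l2_inner V q (grad \<phi>) = l2_inner V \<tau> (grad \<phi>)"
    unfolding l2_inner_def using assms(5) by (intro Bochner_Integration.integral_cong) auto
  also have "\<dots> = l2_inner \<Omega> \<tau> (grad \<phi>)"
    by (rule l2_inner_restrict[symmetric]) (use assms grad_zero_outside[OF \<phi>] in auto)
  also have "\<dots> = - l2_inner \<Omega> d \<phi>"
    using assms(1) \<phi> test_funs_mono[OF assms(2)] by (auto simp: has_weak_div_def)
  also have "l2_inner \<Omega> d \<phi> = l2_inner V d \<phi>"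
    by (rule l2_inner_restrict) (use assms test_funs_zero_outside[OF \<phi>] in auto)
  finally show "l2_inner V q (grad \<phi>) = - l2_inner V d \<phi>" .
qed

lemma open_bounded_lmeasurable: "open V \<Longrightarrow> bounded V \<Longrightarrow> (V :: pt set) \<in> lmeasurable"
  by (simp add: bounded_set_imp_lmeasurable)

lemma L2_orthogonal_AE_eq:
  fixes d d' :: "pt \<Rightarrow> real"
  assumes "open V" "bounded V" "d \<in> L2 V" "d' \<in> L2 V"
    and eq: "\<And>\<phi>. \<phi> \<in> test_funs V \<Longrightarrow> l2_inner V d \<phi> = l2_inner V d' \<phi>"
  shows "AE x in lebesgue_on V. d x = d' x"
proof -
  have "AE x in lebesgue_on V. d x - d' x = 0"
  proof (rule fundamental_lemma[OF assms(1)])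
    show "integrable (lebesgue_on V) (\<lambda>x. d x - d' x)"
      by (rule L2_integrable[OF L2_diff[OF assms(3,4)] open_bounded_lmeasurable[OF assms(1,2)]])
    show "l2_inner V (\<lambda>x. d x - d' x) \<phi> = 0" if "\<phi> \<in> test_funs V" for \<phi>
      using eq[OF that] test_fun_L2[OF that, of V] assms by (simp add: l2_inner_diff_left)
  qed
  then show ?thesis by simp
qed

lemma weak_div_unique:
  assumes "open V" "bounded V" "d \<in> L2 V" "d' \<in> L2 V" "has_weak_div V \<tau> d" "has_weak_div V \<tau> d'"
  shows "AE x in lebesgue_on V. d x = d' x"
proof (rule L2_orthogonal_AE_eq[OF assms(1-4)])
  fix \<phi> assume \<phi>: "\<phi> \<in> test_funs V"
  show "l2_inner V d \<phi> = l2_inner V d' \<phi>"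
    using bspec[OF assms(5)[unfolded has_weak_div_def] \<phi>] bspec[OF assms(6)[unfolded has_weak_div_def] \<phi>]
    by linarith
qed

lemma weak_grad_unique:
  assumes "open V" "bounded V" "g \<in> L2 V" "g' \<in> L2 V" "has_weak_grad V u g" "has_weak_grad V u g'"
  shows "AE x in lebesgue_on V. g x = g' x"
proof -
  have "AE x in lebesgue_on V. g x $ i = g' x $ i" for i
  proof (rule L2_orthogonal_AE_eq[OF assms(1,2)])
    fix \<phi> assume "\<phi> \<in> test_funs V"
    then have "l2_inner V u (pd i \<phi>) = - l2_inner V (\<lambda>x. g x $ i) \<phi>"
      "l2_inner V u (pd i \<phi>) = - l2_inner V (\<lambda>x. g' x $ i) \<phi>"
      using assms(5,6) by (auto simp: has_weak_grad_def)
    then show "l2_inner V (\<lambda>x. g x $ i) \<phi> = l2_inner V (\<lambda>x. g' x $ i) \<phi>" by simp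
  qed (use assms L2_component in auto)
  from this[of 1] this[of 2] show ?thesis
    by eventually_elim (simp add: vec_eq_iff forall_2)
qed

lemma weak_gradD:
  assumes "u \<in> H1 \<Omega>" shows "weak_grad \<Omega> u \<in> L2 \<Omega>" "has_weak_grad \<Omega> u (weak_grad \<Omega> u)"
proof -
  have "\<exists>g. g \<in> L2 \<Omega> \<and> has_weak_grad \<Omega> u g" using assms by (auto simp: H1_def)
  from someI_ex[OF this] show "weak_grad \<Omega> u \<in> L2 \<Omega>" "has_weak_grad \<Omega> u (weak_grad \<Omega> u)"
    by (simp_all add: weak_grad_def)
qed

lemma weak_divD:
  assumes "\<tau> \<in> Hdiv \<Omega>" shows "weak_div \<Omega> \<tau> \<in> L2 \<Omega>" "has_weak_div \<Omega> \<tau> (weak_div \<Omega> \<tau>)"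
proof -
  have "\<exists>d. d \<in> L2 \<Omega> \<and> has_weak_div \<Omega> \<tau> d" using assms by (auto simp: Hdiv_def)
  from someI_ex[OF this] show "weak_div \<Omega> \<tau> \<in> L2 \<Omega>" "has_weak_div \<Omega> \<tau> (weak_div \<Omega> \<tau>)"
    by (simp_all add: weak_div_def)
qed

lemma has_weak_grad_diff:
  assumes "u \<in> L2 \<Omega>" "v \<in> L2 \<Omega>" "g \<in> L2 \<Omega>" "g' \<in> L2 \<Omega>" "open \<Omega>"
    "has_weak_grad \<Omega> u g" "has_weak_grad \<Omega> v g'"
  shows "has_weak_grad \<Omega> (\<lambda>x. u x - v x) (\<lambda>x. g x - g' x)"
  unfolding has_weak_grad_def
proof (intro ballI allI)
  fix \<phi> i assume \<phi>: "\<phi> \<in> test_funs \<Omega>"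
  have \<Omega>: "\<Omega> \<in> sets lebesgue" using assms(5) by simp
  have "l2_inner \<Omega> (\<lambda>x. u x - v x) (pd i \<phi>) = l2_inner \<Omega> u (pd i \<phi>) - l2_inner \<Omega> v (pd i \<phi>)"
    by (intro l2_inner_diff_left assms test_fun_L2[OF test_funs_pd[OF \<phi>] \<Omega>])
  also have "\<dots> = - (l2_inner \<Omega> (\<lambda>x. g x $ i) \<phi> - l2_inner \<Omega> (\<lambda>x. g' x $ i) \<phi>)"
    using assms(6,7) \<phi> by (simp add: has_weak_grad_def)
  also have "l2_inner \<Omega> (\<lambda>x. g x $ i) \<phi> - l2_inner \<Omega> (\<lambda>x. g' x $ i) \<phi> =
      l2_inner \<Omega> (\<lambda>x. g x $ i - g' x $ i) \<phi>"
    by (intro l2_inner_diff_left[symmetric] L2_component assms test_fun_L2[OF \<phi> \<Omega>])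
  finally show "l2_inner \<Omega> (\<lambda>x. u x - v x) (pd i \<phi>) = - l2_inner \<Omega> (\<lambda>x. (g x - g' x) $ i) \<phi>" by simp
qed

lemma weak_grad_diff:
  assumes "open \<Omega>" "bounded \<Omega>" "u \<in> H1 \<Omega>" "v \<in> H1 \<Omega>"
  shows "AE x in lebesgue_on \<Omega>. weak_grad \<Omega> (\<lambda>x. u x - v x) x = weak_grad \<Omega> u x - weak_grad \<Omega> v x"
    and "(\<lambda>x. u x - v x) \<in> H1 \<Omega>"
proof -
  note u = weak_gradD[OF assms(3)] and v = weak_gradD[OF assms(4)]
  have L2: "u \<in> L2 \<Omega>" "v \<in> L2 \<Omega>" using assms by (auto simp: H1_def)
  have d: "has_weak_grad \<Omega> (\<lambda>x. u x - v x) (\<lambda>x. weak_grad \<Omega> u x - weak_grad \<Omega> v x)"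
    by (intro has_weak_grad_diff L2 u v assms)
  have L: "(\<lambda>x. weak_grad \<Omega> u x - weak_grad \<Omega> v x) \<in> L2 \<Omega>" by (intro L2_diff u v)
  show H1: "(\<lambda>x. u x - v x) \<in> H1 \<Omega>" unfolding H1_def using L d L2_diff[OF L2] by blast
  show "AE x in lebesgue_on \<Omega>. weak_grad \<Omega> (\<lambda>x. u x - v x) x = weak_grad \<Omega> u x - weak_grad \<Omega> v x"
    by (rule weak_grad_unique[OF assms(1,2) weak_gradD(1)[OF H1] L weak_gradD(2)[OF H1] d])
qed

lemma l2_norm_sq: "(l2_norm A f)\<^sup>2 = (\<integral>x. (norm (f x))\<^sup>2 \<partial>lebesgue_on A)"
proof -
  have "l2_inner A f f = (\<integral>x. (norm (f x))\<^sup>2 \<partial>lebesgue_on A)"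
    by (simp add: l2_inner_def dot_square_norm)
  moreover have "\<dots> \<ge> 0" by (rule integral_nonneg_AE) simp
  ultimately show ?thesis by (simp add: l2_norm_def)
qed

lemma l2_inner_self_zero:
  assumes "f \<in> L2 A" "l2_inner A f f = 0" shows "AE x in lebesgue_on A. f x = 0"
proof -
  have "(\<integral>x. (norm (f x))\<^sup>2 \<partial>lebesgue_on A) = 0"
    using assms(2) by (simp add: l2_inner_def dot_square_norm)
  then have "AE x in lebesgue_on A. (norm (f x))\<^sup>2 = 0"
    using assms(1) by (subst (asm) integral_nonneg_eq_0_iff_AE) (auto simp: L2_def)
  then show ?thesis by simp
qed

lemma test_fun_H10:
  assumes "open \<Omega>" "bounded \<Omega>" "\<phi> \<in> test_funs \<Omega>"
  shows "\<phi> \<in> H10 \<Omega>" "AE x in lebesgue_on \<Omega>. weak_grad \<Omega> \<phi> x = grad \<phi> x"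
proof -
  have \<Omega>: "\<Omega> \<in> sets lebesgue" using assms by simp
  have g: "has_weak_grad \<Omega> \<phi> (grad \<phi>)" by (rule has_weak_grad_smooth[OF assms(1) test_funs_smooth[OF assms(3)]])
  have gL2: "grad \<phi> \<in> L2 \<Omega>" by (rule grad_L2[OF assms(3) \<Omega>])
  have H1: "\<phi> \<in> H1 \<Omega>" using test_fun_L2[OF assms(3) \<Omega>] g gL2 by (auto simp: H1_def)
  have "l2_norm \<Omega> (weak_grad \<Omega> (\<lambda>x. \<phi> x - \<phi> x)) = 0"
  proof -
    have "AE x in lebesgue_on \<Omega>. weak_grad \<Omega> (\<lambda>x. \<phi> x - \<phi> x) x = 0"
      using weak_grad_diff(1)[OF assms(1,2) H1 H1] by simp
    then have "AE x in lebesgue_on \<Omega>. weak_grad \<Omega> (\<lambda>x. \<phi> x - \<phi> x) x \<bullet> weak_grad \<Omega> (\<lambda>x. \<phi> x - \<phi> x) x = 0"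
      by eventually_elim simp
    then show ?thesis unfolding l2_norm_def l2_inner_def by (simp add: integral_eq_zero_AE)
  qed
  then have "H1_norm \<Omega> (\<lambda>x. \<phi> x - \<phi> x) = 0" by (simp add: H1_norm_def l2_norm_def l2_inner_def)
  then have "\<exists>\<psi>\<in>test_funs \<Omega>. H1_norm \<Omega> (\<lambda>x. \<phi> x - \<psi> x) < \<epsilon>" if "\<epsilon> > 0" for \<epsilon>
    using assms(3) that by (intro bexI[of _ \<phi>]) auto
  then show "\<phi> \<in> H10 \<Omega>" using H1 by (simp add: H10_def)
  show "AE x in lebesgue_on \<Omega>. weak_grad \<Omega> \<phi> x = grad \<phi> x"
    by (rule weak_grad_unique[OF assms(1,2) weak_gradD(1)[OF H1] gL2 weak_gradD(2)[OF H1] g])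
qed

text \<open>The second equation makes \<open>\<sigma> - \<nabla>u\<close> divergence free, so it is an admissible test field in the
  first equation, where all terms with a divergence drop out.\<close>

lemma ls_solution_sigma_eq_grad:
  assumes "open \<Omega>" "bounded \<Omega>" "ls_eigen_solution \<Omega> (Hdiv \<Omega>) (H10 \<Omega>) lam \<sigma> u"
  shows "AE x in lebesgue_on \<Omega>. \<sigma> x = weak_grad \<Omega> u x"
proof -
  have \<Omega>: "\<Omega> \<in> sets lebesgue" using assms by simp
  have \<sigma>: "\<sigma> \<in> Hdiv \<Omega>" and u: "u \<in> H10 \<Omega>"
    and eq1: "\<And>\<tau>. \<tau> \<in> Hdiv \<Omega> \<Longrightarrow> l2_inner \<Omega> \<sigma> \<tau> + l2_inner \<Omega> (weak_div \<Omega> \<sigma>) (weak_div \<Omega> \<tau>)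
              - l2_inner \<Omega> (weak_grad \<Omega> u) \<tau> = - lam * l2_inner \<Omega> u (weak_div \<Omega> \<tau>)"
    and eq2: "\<And>v. v \<in> H10 \<Omega> \<Longrightarrow> - l2_inner \<Omega> \<sigma> (weak_grad \<Omega> v)
              + l2_inner \<Omega> (weak_grad \<Omega> u) (weak_grad \<Omega> v) = 0"
    using assms(3) by (auto simp: ls_eigen_solution_def)
  define G where "G = weak_grad \<Omega> u"
  have uH1: "u \<in> H1 \<Omega>" using u by (simp add: H10_def)
  then have uL2: "u \<in> L2 \<Omega>" by (simp add: H1_def)
  have G: "G \<in> L2 \<Omega>" unfolding G_def by (rule weak_gradD(1)[OF uH1])
  have \<sigma>L2: "\<sigma> \<in> L2 \<Omega>" using \<sigma> by (simp add: Hdiv_def)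
  define \<tau> where "\<tau> x = \<sigma> x - G x" for x
  have \<tau>L2: "\<tau> \<in> L2 \<Omega>" unfolding \<tau>_def[abs_def] by (rule L2_diff[OF \<sigma>L2 G])
  have zL2: "(\<lambda>x. 0::real) \<in> L2 \<Omega>" by (simp add: L2_def)
  have div0: "has_weak_div \<Omega> \<tau> (\<lambda>x. 0)"
    unfolding has_weak_div_def
  proof
    fix \<phi> assume \<phi>: "\<phi> \<in> test_funs \<Omega>"
    note H = test_fun_H10[OF assms(1,2) \<phi>]
    have H1: "\<phi> \<in> H1 \<Omega>" using H(1) by (simp add: H10_def)
    have "l2_inner \<Omega> \<tau> (grad \<phi>) = l2_inner \<Omega> (grad \<phi>) \<tau>" by (rule l2_inner_commute)
    also have "\<dots> = l2_inner \<Omega> (weak_grad \<Omega> \<phi>) \<tau>"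
      by (rule l2_inner_cong_AE[symmetric]) (use weak_gradD(1)[OF H1] grad_L2[OF \<phi> \<Omega>] \<tau>L2 H(2) in auto)
    also have "\<dots> = l2_inner \<Omega> \<tau> (weak_grad \<Omega> \<phi>)" by (rule l2_inner_commute)
    also have "\<dots> = l2_inner \<Omega> \<sigma> (weak_grad \<Omega> \<phi>) - l2_inner \<Omega> G (weak_grad \<Omega> \<phi>)"
      unfolding \<tau>_def by (rule l2_inner_diff_left[OF \<sigma>L2 G weak_gradD(1)[OF H1]])
    also have "\<dots> = 0" using eq2[OF H(1)] by (simp add: G_def)
    finally show "l2_inner \<Omega> \<tau> (grad \<phi>) = - l2_inner \<Omega> (\<lambda>x. 0) \<phi>" by (simp add: l2_inner_def)
  qed
  then have \<tau>: "\<tau> \<in> Hdiv \<Omega>" using \<tau>L2 zL2 by (auto simp: Hdiv_def)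
  note d = weak_divD[OF \<tau>]
  have d0: "AE x in lebesgue_on \<Omega>. weak_div \<Omega> \<tau> x = 0"
    by (rule weak_div_unique[OF assms(1,2) d(1) zL2 d(2) div0])
  have z: "l2_inner \<Omega> f (weak_div \<Omega> \<tau>) = 0" if "f \<in> L2 \<Omega>" for f
  proof -
    have "l2_inner \<Omega> (weak_div \<Omega> \<tau>) f = l2_inner \<Omega> (\<lambda>x. 0) f"
      by (rule l2_inner_cong_AE[OF d(1) zL2 that d0])
    then show ?thesis by (subst l2_inner_commute) (simp add: l2_inner_def)
  qed
  have "l2_inner \<Omega> \<tau> \<tau> = l2_inner \<Omega> \<sigma> \<tau> - l2_inner \<Omega> G \<tau>"
    unfolding \<tau>_def[abs_def] by (rule l2_inner_diff_left[OF \<sigma>L2 G \<tau>L2[unfolded \<tau>_def[abs_def]]])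
  also have "\<dots> = 0"
    using eq1[OF \<tau>] z[OF weak_divD(1)[OF \<sigma>]] z[OF uL2] by (simp add: G_def)
  finally have "AE x in lebesgue_on \<Omega>. \<tau> x = 0" by (rule l2_inner_self_zero[OF \<tau>L2])
  then show ?thesis by eventually_elim (simp add: \<tau>_def G_def)
qed

subsection \<open>Continuity of the normal component\<close>

lemma smooth_vpolys: "q \<in> vpolys k \<Longrightarrow> smooth (\<lambda>x. q x $ i)"
  unfolding vpolys_def using smooth_polys by blast

lemma vpolys_continuous: "q \<in> vpolys k \<Longrightarrow> continuous_on A q"
proof -
  assume q: "q \<in> vpolys k"
  have "continuous_on A (\<lambda>x. \<chi> i. q x $ i)"
    by (intro continuous_intros smooth_continuous smooth_vpolys[OF q])
  then show ?thesis by simp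
qed

lemma divg_polys: "q \<in> vpolys k \<Longrightarrow> divg q \<in> polys k"
  unfolding divg_def[abs_def] vpolys_def by (intro polys_sum polys_pd) auto

lemma has_weak_div_vpolys_AE:
  assumes "has_weak_div \<Omega> \<tau> d" "d \<in> L2 \<Omega>" "open \<Omega>" "bounded \<Omega>" "open V" "V \<subseteq> \<Omega>"
    "\<And>x. x \<in> V \<Longrightarrow> \<tau> x = q x" "q \<in> vpolys k"
  shows "AE x in lebesgue. x \<in> V \<longrightarrow> d x = divg q x"
proof -
  have V: "bounded V" "V \<in> sets lebesgue" using assms bounded_subset by auto
  have "AE x in lebesgue_on V. d x = divg q x"
  proof (rule weak_div_unique[OF assms(5) V(1)])
    show "d \<in> L2 V" by (rule L2_subset[OF assms(2,6)]) (use V assms in auto)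
    show "divg q \<in> L2 V" by (rule continuous_L2[OF polys_continuous[OF divg_polys[OF assms(8)]] V])
    show "has_weak_div V q d" by (rule has_weak_div_restrict[OF assms(1,6,5,3,7)])
    show "has_weak_div V q (divg q)" by (rule has_weak_div_smooth[OF assms(5) V(1) smooth_vpolys[OF assms(8)]])
  qed
  then show ?thesis using V by (simp add: AE_restrict_space_iff)
qed

lemma grad_polys_continuous: "p \<in> polys k \<Longrightarrow> continuous_on A (grad p)"
  unfolding grad_def[abs_def] by (intro continuous_intros polys_continuous[OF polys_pd])

lemma has_weak_grad_polys_AE:
  assumes "has_weak_grad \<Omega> u g" "g \<in> L2 \<Omega>" "open \<Omega>" "bounded \<Omega>" "open V" "V \<subseteq> \<Omega>"
    "\<And>x. x \<in> V \<Longrightarrow> u x = p x" "p \<in> polys k"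
  shows "AE x in lebesgue. x \<in> V \<longrightarrow> g x = grad p x"
proof -
  have V: "bounded V" "V \<in> sets lebesgue" using assms bounded_subset by auto
  have "AE x in lebesgue_on V. g x = grad p x"
  proof (rule weak_grad_unique[OF assms(5) V(1)])
    show "g \<in> L2 V" by (rule L2_subset[OF assms(2,6)]) (use V assms in auto)
    show "grad p \<in> L2 V" by (rule continuous_L2[OF grad_polys_continuous[OF assms(8)] V])
    show "has_weak_grad V p g" by (rule has_weak_grad_restrict[OF assms(1,6,5,3,7)])
    show "has_weak_grad V p (grad p)" by (rule has_weak_grad_smooth[OF assms(5) smooth_polys[OF assms(8)]])
  qed
  then show ?thesis using V by (simp add: AE_restrict_space_iff)
qed

lemma perp_uminus: "perp (- t) = - perp t"
  by (simp add: vec_eq_iff forall_2)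

lemma half_plane_above_pd_integral:
  assumes f: "f \<in> test_funs UNIV" and t: "norm t = 1"
  shows "(\<integral>x. indicator {x. x \<bullet> perp t > c} x * pd i f x \<partial>lborel) =
    - perp t $ i * (\<integral>s. f (s *\<^sub>R t + c *\<^sub>R perp t) \<partial>lborel)"
proof -
  have "(\<integral>s. f (s *\<^sub>R t + c *\<^sub>R perp t) \<partial>lborel) = (\<integral>s. f (s *\<^sub>R (- t) + (- c) *\<^sub>R perp (- t)) \<partial>lborel)"
    using lborel_integral_real_affine[of "-1" "\<lambda>s. f (s *\<^sub>R t + c *\<^sub>R perp t)" 0]
    by (simp add: perp_uminus)
  moreover have "{x. x \<bullet> perp t > c} = {x. x \<bullet> perp (- t) < - c}" by (auto simp: perp_uminus)
  ultimately show ?thesis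
    using half_plane_pd_integral[OF f, of "- t" "- c" i] t by (simp add: perp_uminus)
qed

lemma hyperplane_null: "norm t = 1 \<Longrightarrow> AE x in lborel. x \<bullet> perp t \<noteq> c"
proof -
  assume "norm t = 1"
  then have "perp t \<noteq> 0" using norm_perp[of t] by (metis norm_zero zero_neq_one)
  then have "negligible {x. perp t \<bullet> x = c}" by (intro negligible_hyperplane) auto
  then have "AE x in lebesgue. x \<notin> {x. perp t \<bullet> x = c}"
    by (intro AE_not_in) (simp add: negligible_iff_null_sets)
  then show ?thesis by (simp add: AE_completion_iff inner_commute)
qed

text \<open>Testing the weak divergence with bump functions around a point of the interface.\<close>

lemma normal_component_continuous:
  assumes div: "has_weak_div \<Omega> \<tau> d" "d \<in> L2 \<Omega>" and \<tau>: "\<tau> \<in> L2 \<Omega>" and \<Omega>: "open \<Omega>" "bounded \<Omega>"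
    and ball: "r > 0" "ball x0 r \<subseteq> \<Omega>" and t: "norm t = 1"
    and q1: "q1 \<in> vpolys k" "\<And>x. x \<in> ball x0 r \<Longrightarrow> (x - x0) \<bullet> perp t < 0 \<Longrightarrow> \<tau> x = q1 x"
    and q2: "q2 \<in> vpolys k" "\<And>x. x \<in> ball x0 r \<Longrightarrow> (x - x0) \<bullet> perp t > 0 \<Longrightarrow> \<tau> x = q2 x"
  shows "q1 x0 \<bullet> perp t = q2 x0 \<bullet> perp t"
proof (rule ccontr)
  assume neq: "q1 x0 \<bullet> perp t \<noteq> q2 x0 \<bullet> perp t"
  define n where "n = perp t"
  define c where "c = x0 \<bullet> n"
  define J where "J x = (q1 x - q2 x) \<bullet> n" for x
  have Jc: "continuous_on A J" for A
    unfolding J_def[abs_def] by (intro continuous_intros vpolys_continuous[OF q1(1)] vpolys_continuous[OF q2(1)])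
  have "J x0 \<noteq> 0" using neq by (simp add: J_def n_def inner_diff_left)
  then have "\<exists>e>0. \<forall>x. dist x x0 < e \<longrightarrow> J x * J x0 > 0"
  proof -
    have "continuous (at x0) (\<lambda>x. J x * J x0)"
      using Jc[of UNIV] by (intro continuous_intros) (simp add: continuous_on_eq_continuous_at)
    then have lim: "((\<lambda>x. J x * J x0) \<longlongrightarrow> J x0 * J x0) (at x0)" by (simp add: continuous_at)
    have "0 < J x0 * J x0" using \<open>J x0 \<noteq> 0\<close> not_real_square_gt_zero by blast
    from order_tendstoD(1)[OF lim this] have "\<forall>\<^sub>F x in at x0. J x * J x0 > 0" .
    then obtain e where e: "e > 0" "\<And>x. x \<noteq> x0 \<Longrightarrow> dist x x0 < e \<Longrightarrow> J x * J x0 > 0"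
      by (auto simp: eventually_at)
    then show ?thesis using \<open>J x0 \<noteq> 0\<close> by (metis not_real_square_gt_zero)
  qed
  then obtain e where e: "e > 0" "\<And>x. dist x x0 < e \<Longrightarrow> J x * J x0 > 0" by blast
  have "0 < min e r" using e ball by simp
  then have "x0 \<in> ball x0 (min e r)" by simp
  then obtain a b where ab: "x0 \<in> box a b" "cbox a b \<subseteq> ball x0 (min e r)"
    using open_contains_cbox[OF open_ball] by metis
  define \<phi> where "\<phi> = bump 1 a b"
  have \<phi>ball: "\<phi> \<in> test_funs (ball x0 r)"
    unfolding \<phi>_def by (rule bump_test_fun) (use ab in auto)
  have \<phi>: "\<phi> \<in> test_funs \<Omega>" using \<phi>ball test_funs_mono[OF ball(2)] by blast
  have \<phi>sm: "smooth \<phi>" by (rule test_funs_smooth[OF \<phi>])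
  have \<Omega>leb: "\<Omega> \<in> sets lebesgue" using \<Omega> by simp
  define Hm where "Hm = {x. x \<bullet> n < c}"
  define Hp where "Hp = {x. x \<bullet> n > c}"
  have side: "x \<in> Hm \<longleftrightarrow> (x - x0) \<bullet> perp t < 0" "x \<in> Hp \<longleftrightarrow> (x - x0) \<bullet> perp t > 0" for x
    by (auto simp: Hm_def Hp_def c_def n_def inner_diff_left)
  have Ho: "open Hm" "open Hp"
    unfolding Hm_def Hp_def by (auto intro!: open_Collect_less continuous_intros)
  define B where "B = ball x0 r"
  have w: "(\<lambda>x. q x $ i * \<phi> x) \<in> test_funs UNIV" if "q \<in> vpolys k" for q i
    using test_funs_mult_smooth[OF \<phi> smooth_vpolys[OF that]] test_funs_mono by blast
  have dm: "AE x in lebesgue. x \<in> B \<inter> Hm \<longrightarrow> d x = divg q1 x"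
    by (rule has_weak_div_vpolys_AE[OF div \<Omega> _ _ _ q1(1)])
      (use Ho ball q1(2) side in \<open>auto simp: B_def\<close>)
  have dp: "AE x in lebesgue. x \<in> B \<inter> Hp \<longrightarrow> d x = divg q2 x"
    by (rule has_weak_div_vpolys_AE[OF div \<Omega> _ _ _ q2(1)])
      (use Ho ball q2(2) side in \<open>auto simp: B_def\<close>)
  have expand: "(\<Sum>i\<in>UNIV. pd i (\<lambda>x. q x $ i * \<phi> x) x) = q x \<bullet> grad \<phi> x + divg q x * \<phi> x"
    if "q \<in> vpolys k" for q x
    using smooth_differentiable[OF smooth_vpolys[OF that]] smooth_differentiable[OF \<phi>sm]
    by (simp add: pd_mult divg_def inner_vec_def grad_def sum.distrib sum_distrib_right add.commute)
  have intH: "integrable lborel (\<lambda>x. indicator H x * pd i (\<lambda>x. q x $ i * \<phi> x) x)"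
    if "q \<in> vpolys k" "open H" for q i H
  proof -
    have pdw: "pd i (\<lambda>x. q x $ i * \<phi> x) \<in> test_funs UNIV" by (rule test_funs_pd[OF w[OF that(1)]])
    have "pd i (\<lambda>x. q x $ i * \<phi> x) \<in> borel_measurable borel"
      by (intro borel_measurable_continuous_onI smooth_continuous test_funs_smooth[OF pdw])
    then have "integrable lborel (pd i (\<lambda>x. q x $ i * \<phi> x))"
      using test_funs_integrable[OF pdw, of "\<lambda>_. 1"]
        integrable_completion[of "pd i (\<lambda>x. q x $ i * \<phi> x)" lborel] by simp
    from integrable_mult_indicator[OF _ this, of H] that(2) show ?thesis by simp
  qed
  define F where "F x = indicator Hm x * (\<Sum>i\<in>UNIV. pd i (\<lambda>x. q1 x $ i * \<phi> x) x) +
      indicator Hp x * (\<Sum>i\<in>UNIV. pd i (\<lambda>x. q2 x $ i * \<phi> x) x)" for x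
  have Fint: "integrable lborel F"
    unfolding F_def[abs_def] sum_distrib_left
    by (intro Bochner_Integration.integrable_add Bochner_Integration.integrable_sum intH q1 q2 Ho)
  have F0: "(\<integral>x. F x \<partial>lborel) = 0"
  proof -
    have i1: "integrable (lebesgue_on \<Omega>) (\<lambda>x. d x * \<phi> x)"
      using L2_inner_integrable[OF div(2) test_fun_L2[OF \<phi> \<Omega>leb]] by simp
    have "AE x in lebesgue_on \<Omega>. \<tau> x \<bullet> grad \<phi> x + d x * \<phi> x = F x"
    proof -
      have "AE x in lebesgue. x \<bullet> n \<noteq> c" using hyperplane_null[OF t] by (simp add: n_def AE_completion)
      with dm dp have "AE x in lebesgue. x \<in> \<Omega> \<longrightarrow> \<tau> x \<bullet> grad \<phi> x + d x * \<phi> x = F x"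
      proof eventually_elim
        case (elim x)
        show ?case
        proof (cases "x \<in> B")
          case False
          then have "\<phi> x = 0" "grad \<phi> x = 0"
            using test_funs_zero_outside[OF \<phi>ball] grad_zero_outside[OF \<phi>ball] by (auto simp: B_def)
          then show ?thesis by (simp add: F_def expand q1 q2)
        next
          case True
          consider "x \<in> Hm" "x \<notin> Hp" | "x \<in> Hp" "x \<notin> Hm"
            using elim(3) by (auto simp: Hm_def Hp_def linorder_neq_iff)
          then show ?thesis
          proof cases
            case 1
            then have "\<tau> x = q1 x" using q1(2) True side by (simp add: B_def)
            then show ?thesis using 1 True elim(1) by (simp add: F_def expand q1)
          next
            case 2
            then have "\<tau> x = q2 x" using q2(2) True side by (simp add: B_def)
            then show ?thesis using 2 True elim(2) by (simp add: F_def expand q2)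
          qed
        qed
      qed
      then show ?thesis using \<Omega>leb by (simp add: AE_restrict_space_iff)
    qed
    note AE = this
    have Fz: "F x = 0" if "x \<notin> \<Omega>" for x
      using test_funs_zero_outside[OF \<phi> that] grad_zero_outside[OF \<phi> that]
      by (simp add: F_def expand q1 q2)
    have "(\<integral>x. F x \<partial>lborel) = (\<integral>x. F x \<partial>lebesgue)"
      using borel_measurable_integrable[OF Fint] by (simp add: integral_completion)
    also have "\<dots> = (\<integral>x. indicator \<Omega> x *\<^sub>R F x \<partial>lebesgue)"
      using Fz by (intro Bochner_Integration.integral_cong) (auto simp: indicator_def)
    also have "\<dots> = (\<integral>x. F x \<partial>lebesgue_on \<Omega>)"
      using \<Omega>leb by (simp add: integral_restrict_space)
    finally have FO: "(\<integral>x. F x \<partial>lborel) = (\<integral>x. F x \<partial>lebesgue_on \<Omega>)" .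
    have FintO: "integrable (lebesgue_on \<Omega>) F"
      using Fint borel_measurable_integrable[OF Fint]
      by (intro integrable_lebesgue_on_subset[of UNIV F \<Omega>])
        (simp_all add: lebesgue_on_UNIV_eq integrable_completion \<Omega>leb)
    have i2: "integrable (lebesgue_on \<Omega>) (\<lambda>x. \<tau> x \<bullet> grad \<phi> x)"
      by (rule L2_inner_integrable[OF \<tau> grad_L2[OF \<phi> \<Omega>leb]])
    have "(\<integral>x. F x \<partial>lebesgue_on \<Omega>) = (\<integral>x. \<tau> x \<bullet> grad \<phi> x + d x * \<phi> x \<partial>lebesgue_on \<Omega>)"
    proof (rule integral_cong_AE)
      show "AE x in lebesgue_on \<Omega>. F x = \<tau> x \<bullet> grad \<phi> x + d x * \<phi> x"
        using AE by eventually_elim simp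
      show "(\<lambda>x. \<tau> x \<bullet> grad \<phi> x + d x * \<phi> x) \<in> borel_measurable (lebesgue_on \<Omega>)"
        using i1 i2 by (intro borel_measurable_add) auto
    qed (use FintO in auto)
    also have "\<dots> = l2_inner \<Omega> \<tau> (grad \<phi>) + l2_inner \<Omega> d \<phi>"
      using i1 i2 by (simp add: l2_inner_def)
    also have "\<dots> = 0" using bspec[OF div(1)[unfolded has_weak_div_def] \<phi>] by simp
    finally show ?thesis using FO by simp
  qed
  define l where "l s = s *\<^sub>R t + c *\<^sub>R n" for s
  have lc: "continuous_on A l" for A unfolding l_def[abs_def] by (intro continuous_intros)
  have l0: "l (x0 \<bullet> t) = x0"
    using frame_expand[OF t, of x0] by (simp add: l_def c_def n_def)
  have linei: "integrable lborel (\<lambda>s. q (l s) $ i * \<phi> (l s))" if q: "q \<in> vpolys k" for q i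
  proof -
    obtain R where R: "\<And>x. x \<in> cbox a b \<Longrightarrow> norm x \<le> R"
      using bounded_cbox bounded_iff by metis
    have z: "\<phi> (l s) = 0" if "s \<notin> {- R..R}" for s
    proof (rule ccontr)
      assume "\<phi> (l s) \<noteq> 0"
      then have "l s \<in> box a b" using bump_zero[of 1 "l s" a b] by (auto simp: \<phi>_def)
      then have "norm (l s) \<le> R" using R box_subset_cbox by blast
      moreover have "l s \<bullet> t = s" using t by (simp add: l_def n_def inner_add_left dot_square_norm)
      then have "\<bar>s\<bar> \<le> norm (l s)" using Cauchy_Schwarz_ineq2[of "l s" t] t by simp
      ultimately show False using that by auto
    qed
    have "continuous_on {- R..R} (\<lambda>s. q (l s) $ i * \<phi> (l s))"
      by (intro continuous_intros continuous_on_compose2[OF vpolys_continuous[OF q] lc]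
          continuous_on_compose2[OF smooth_continuous[OF \<phi>sm] lc]) auto
    then have "integrable lborel (\<lambda>s. indicator {- R..R} s *\<^sub>R (q (l s) $ i * \<phi> (l s)))"
      by (intro borel_integrable_compact) auto
    also have "(\<lambda>s. indicator {- R..R} s *\<^sub>R (q (l s) $ i * \<phi> (l s))) = (\<lambda>s. q (l s) $ i * \<phi> (l s))"
      using z by (auto simp: fun_eq_iff indicator_def)
    finally show ?thesis .
  qed
  have "0 = (\<integral>x. F x \<partial>lborel)" by (simp add: F0)
  also have "\<dots> = (\<Sum>i\<in>UNIV. \<integral>x. indicator Hm x * pd i (\<lambda>x. q1 x $ i * \<phi> x) x \<partial>lborel) +
      (\<Sum>i\<in>UNIV. \<integral>x. indicator Hp x * pd i (\<lambda>x. q2 x $ i * \<phi> x) x \<partial>lborel)"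
    unfolding F_def sum_2 distrib_left
    by (simp only: Bochner_Integration.integral_add Bochner_Integration.integrable_add
        intH[OF q1(1) Ho(1)] intH[OF q2(1) Ho(2)])
  also have "\<dots> = (\<Sum>i\<in>UNIV. n $ i * (\<integral>s. q1 (l s) $ i * \<phi> (l s) \<partial>lborel)) +
      (\<Sum>i\<in>UNIV. - n $ i * (\<integral>s. q2 (l s) $ i * \<phi> (l s) \<partial>lborel))"
    unfolding Hm_def Hp_def n_def l_def
    by (simp only: half_plane_pd_integral[OF w[OF q1(1)] t] half_plane_above_pd_integral[OF w[OF q2(1)] t])
  also have "\<dots> = (\<integral>s. J (l s) * \<phi> (l s) \<partial>lborel)"
  proof -
    have "(\<integral>s. J (l s) * \<phi> (l s) \<partial>lborel) =
        (\<integral>s. (\<Sum>i\<in>UNIV. n $ i * (q1 (l s) $ i * \<phi> (l s)) + - n $ i * (q2 (l s) $ i * \<phi> (l s))) \<partial>lborel)"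
      by (intro Bochner_Integration.integral_cong refl) (simp add: J_def inner_vec_def sum_2 algebra_simps)
    also have "\<dots> = (\<Sum>i\<in>UNIV. n $ i * (\<integral>s. q1 (l s) $ i * \<phi> (l s) \<partial>lborel) +
        - n $ i * (\<integral>s. q2 (l s) $ i * \<phi> (l s) \<partial>lborel))"
      using linei[OF q1(1)] linei[OF q2(1)]
      by (subst Bochner_Integration.integral_sum) auto
    finally show ?thesis unfolding sum.distrib by (rule sym)
  qed
  finally have line0: "(\<integral>s. J (l s) * \<phi> (l s) \<partial>lborel) = 0" by simp
  define h where "h s = J x0 * (J (l s) * \<phi> (l s))" for s
  have "integrable lborel (\<lambda>s. \<Sum>i\<in>UNIV. n $ i * (q1 (l s) $ i * \<phi> (l s)) - n $ i * (q2 (l s) $ i * \<phi> (l s)))"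
    using linei[OF q1(1)] linei[OF q2(1)]
    by (intro Bochner_Integration.integrable_sum Bochner_Integration.integrable_diff integrable_mult_right) auto
  also have "(\<lambda>s. \<Sum>i\<in>UNIV. n $ i * (q1 (l s) $ i * \<phi> (l s)) - n $ i * (q2 (l s) $ i * \<phi> (l s))) =
      (\<lambda>s. J (l s) * \<phi> (l s))"
    by (rule ext) (simp add: J_def inner_vec_def sum_2 algebra_simps)
  finally have hint: "integrable lborel h" unfolding h_def[abs_def] by (rule integrable_mult_right)
  have h0: "h s \<ge> 0" for s
  proof (cases "l s \<in> box a b")
    case True
    then have "dist (l s) x0 < e" using ab(2) box_subset_cbox by (force simp: dist_commute)
    from e(2)[OF this] show ?thesis
      using bump_nonneg[of 1 a b "l s"] unfolding h_def \<phi>_def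
      by (metis mult.assoc mult.commute less_imp_le mult_nonneg_nonneg)
  next
    case False
    then show ?thesis by (simp add: h_def \<phi>_def bump_zero)
  qed
  have "(\<integral>s. h s \<partial>lborel) = 0" using line0 by (simp add: h_def)
  then have "AE s in lborel. h s = 0"
    using integral_nonneg_eq_0_iff_AE[OF hint] h0 by simp
  then have AEh: "AE s in lebesgue_on UNIV. h s = 0"
    unfolding lebesgue_on_UNIV_eq by (rule AE_completion)
  have "continuous_on UNIV h"
    unfolding h_def[abs_def]
    by (intro continuous_intros continuous_on_compose2[OF Jc lc]
        continuous_on_compose2[OF smooth_continuous[OF \<phi>sm] lc]) auto
  from AE_zero_imp_zero[OF AEh _ open_UNIV _ this, of "x0 \<bullet> t"] have "h (x0 \<bullet> t) = 0" by simp
  moreover have "\<phi> x0 > 0" unfolding \<phi>_def using ab(1) by (simp add: bump_pos_iff)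
  ultimately show False using \<open>J x0 \<noteq> 0\<close> by (simp add: h_def l0)
qed

section \<open>Triangles and their edges\<close>

lemma triangle_basics:
  assumes "2 simplex (T :: pt set)"
  shows "convex T" "compact T" "interior T \<noteq> {}" "rel_interior T = interior T"
    "closure (interior T) = T" "aff_dim T = 2" "T \<in> sets lebesgue"
proof -
  show c: "convex T" "compact T" using assms by (simp_all add: convex_simplex compact_simplex)
  show ad: "aff_dim T = 2" by (rule aff_dim_simplex[OF assms])
  have "affine hull T = UNIV" using ad aff_dim_eq_full[of T] by simp
  then show ri: "rel_interior T = interior T" by (rule rel_interior_interior)
  have "T \<noteq> {}" using ad by auto
  then show "interior T \<noteq> {}" using ri rel_interior_eq_empty[OF c(1)] by auto
  then show "closure (interior T) = T"
    using convex_closure_interior[OF c(1)] c(2) by (simp add: compact_imp_closed)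
  show "T \<in> sets lebesgue" using c(2) by (simp add: lmeasurable_compact fmeasurableD)
qed

lemma triangle_diameter_pos: "2 simplex (T :: pt set) \<Longrightarrow> diameter T > 0"
proof -
  assume T: "2 simplex T"
  obtain x where "x \<in> interior T" using triangle_basics(3)[OF T] by blast
  then obtain r where r: "r > 0" "ball x r \<subseteq> T"
    using mem_interior by metis
  have "bounded T" using triangle_basics(2)[OF T] by (rule compact_imp_bounded)
  then have "diameter (ball x r) \<le> diameter T" using r(2) by (intro diameter_subset)
  then show ?thesis using r(1) by (simp add: diameter_ball)
qed

lemma diameter_closed_segment:
  "diameter (closed_segment a b) = norm (b - a :: 'a::euclidean_space)"
proof (rule antisym)
  show "diameter (closed_segment a b) \<le> norm (b - a)"
  proof (rule diameter_le)
    fix x y assume "x \<in> closed_segment a b" "y \<in> closed_segment a b"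
    then obtain u v where uv: "x = (1 - u) *\<^sub>R a + u *\<^sub>R b" "0 \<le> u" "u \<le> 1"
      "y = (1 - v) *\<^sub>R a + v *\<^sub>R b" "0 \<le> v" "v \<le> 1" by (auto simp: in_segment)
    have "x - y = (u - v) *\<^sub>R (b - a)" unfolding uv(1,4) by (simp add: algebra_simps)
    then have "norm (x - y) = \<bar>u - v\<bar> * norm (b - a)" by simp
    also have "\<dots> \<le> 1 * norm (b - a)" using uv by (intro mult_right_mono) auto
    finally show "norm (x - y) \<le> norm (b - a)" by simp
  qed auto
  show "norm (b - a) \<le> diameter (closed_segment a b)"
    using diameter_bounded_bound[OF bounded_closed_segment, of a a b b]
    by (simp add: dist_norm norm_minus_commute)
qed

lemma edge_normal_perp: "edge_normal e = perp (edge_tangent e)"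
  by (simp add: edge_normal_def perp_def)

lemma edge_parametrization:
  assumes "e edge_of T" "2 simplex T"
  defines "a \<equiv> fst (edge_ends e)" and "t \<equiv> edge_tangent e"
  shows "norm t = 1" "diameter e > 0" "e = (\<lambda>s. a + s *\<^sub>R t) ` {0..diameter e}"
    "\<And>x. x \<in> e \<longleftrightarrow> x \<bullet> edge_normal e = a \<bullet> edge_normal e \<and> 0 \<le> (x - a) \<bullet> t \<and> (x - a) \<bullet> t \<le> diameter e"
    "affine hull e = {x. x \<bullet> edge_normal e = a \<bullet> edge_normal e}"
    "rel_interior e = (\<lambda>s. a + s *\<^sub>R t) ` {0<..<diameter e}"
proof -
  define b where "b = snd (edge_ends e)"
  define l where "l = norm (b - a)"
  have ab: "a \<noteq> b" "e = closed_segment a b"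
    using edge_ends_edge[OF assms(1,2)] by (simp_all add: a_def b_def)
  then have l: "l > 0" by (simp add: l_def)
  have diam: "diameter e = l" by (simp add: ab(2) diameter_closed_segment l_def)
  have t: "t = (b - a) /\<^sub>R l" by (simp add: t_def edge_tangent_def case_prod_unfold a_def b_def l_def)
  then have b: "b = a + l *\<^sub>R t" using l by simp
  show nt: "norm t = 1" using l by (simp add: t l_def)
  show "diameter e > 0" using diam l by simp
  have tt: "t \<bullet> t = 1" using nt by (simp add: dot_square_norm)
  define n where "n = edge_normal e"
  have n: "n = perp t" by (simp add: n_def edge_normal_perp t_def)
  show img: "e = (\<lambda>s. a + s *\<^sub>R t) ` {0..diameter e}"
  proof -
    have "closed_segment a b = (\<lambda>u. a + u *\<^sub>R (b - a)) ` {0..1}"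
      unfolding closed_segment_image_interval by (intro image_cong refl) (simp add: algebra_simps)
    also have "\<dots> = (\<lambda>s. a + s *\<^sub>R t) ` ((\<lambda>u. u * l) ` {0..1})"
      by (simp add: image_image b)
    also have "(\<lambda>u. u * l) ` {0..1} = {0..l}"
    proof (intro equalityI subsetI)
      fix s assume "s \<in> {0..l}"
      then show "s \<in> (\<lambda>u. u * l) ` {0..1}" using l by (intro image_eqI[of _ _ "s / l"]) auto
    qed (use l in \<open>auto simp: mult_le_cancel_right2\<close>)
    finally have "closed_segment a b = (\<lambda>s. a + s *\<^sub>R t) ` {0..l}" .
    with ab(2) show ?thesis unfolding diam by (rule trans)
  qed
  have line: "x = a + ((x - a) \<bullet> t) *\<^sub>R t" if "x \<bullet> n = a \<bullet> n" for x
  proof -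
    have "(x - a) \<bullet> perp t = 0" using that by (simp add: n inner_diff_left)
    then have "x - a = ((x - a) \<bullet> t) *\<^sub>R t" using frame_expand[OF nt, of "x - a"] by simp
    then have "a + (x - a) = a + ((x - a) \<bullet> t) *\<^sub>R t" by (rule arg_cong)
    then show ?thesis by simp
  qed
  have on: "(a + s *\<^sub>R t) \<bullet> n = a \<bullet> n" "(a + s *\<^sub>R t - a) \<bullet> t = s" for s
    by (simp_all add: n inner_add_left tt)
  show mem: "x \<in> e \<longleftrightarrow> x \<bullet> edge_normal e = a \<bullet> edge_normal e \<and> 0 \<le> (x - a) \<bullet> t \<and> (x - a) \<bullet> t \<le> diameter e" for x
    unfolding n_def[symmetric]
  proof
    assume "x \<in> e"
    then have "x \<in> (\<lambda>s. a + s *\<^sub>R t) ` {0..diameter e}" by (subst (asm) img)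
    then obtain s where "x = a + s *\<^sub>R t" "s \<in> {0..diameter e}" by (rule imageE)
    then show "x \<bullet> n = a \<bullet> n \<and> 0 \<le> (x - a) \<bullet> t \<and> (x - a) \<bullet> t \<le> diameter e"
      by (simp add: on(1) tt)
  next
    assume "x \<bullet> n = a \<bullet> n \<and> 0 \<le> (x - a) \<bullet> t \<and> (x - a) \<bullet> t \<le> diameter e"
    then show "x \<in> e" using line[of x] by (subst img) auto
  qed
  show "affine hull e = {x. x \<bullet> edge_normal e = a \<bullet> edge_normal e}"
    unfolding n_def[symmetric]
  proof
    have "affine {x. n \<bullet> x = n \<bullet> a}" by (rule affine_hyperplane)
    then show "affine hull e \<subseteq> {x. x \<bullet> n = a \<bullet> n}"
      using mem by (intro hull_minimal) (auto simp: n_def inner_commute)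
    show "{x. x \<bullet> n = a \<bullet> n} \<subseteq> affine hull e"
    proof
      fix x assume "x \<in> {x. x \<bullet> n = a \<bullet> n}"
      then have "x \<bullet> n = a \<bullet> n" by simp
      define s where "s = (x - a) \<bullet> t"
      have xs: "x = a + s *\<^sub>R t" unfolding s_def by (rule line) fact
      have "(1 - s / l) *\<^sub>R a + (s / l) *\<^sub>R (a + l *\<^sub>R t) = a + s *\<^sub>R t"
        using l by (simp add: algebra_simps)
      then have "x = (1 - s / l) *\<^sub>R a + (s / l) *\<^sub>R b" by (simp add: xs b)
      moreover have "a \<in> e" "b \<in> e" by (simp_all add: ab(2))
      ultimately show "x \<in> affine hull e"
        using mem_affine[OF affine_affine_hull, of a e b "1 - s / l" "s / l"]
        by (simp add: hull_inc)
    qed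
  qed
  show "rel_interior e = (\<lambda>s. a + s *\<^sub>R t) ` {0<..<diameter e}"
  proof -
    have "rel_interior e = open_segment a b" using ab by (simp add: rel_interior_closed_segment)
    also have "\<dots> = (\<lambda>u. a + u *\<^sub>R (b - a)) ` {0<..<1}"
      using ab(1) unfolding open_segment_image_interval
      by (simp only: if_False) (intro image_cong refl, simp add: algebra_simps)
    also have "\<dots> = (\<lambda>s. a + s *\<^sub>R t) ` ((\<lambda>u. u * l) ` {0<..<1})"
      by (simp add: image_image b)
    also have "(\<lambda>u. u * l) ` {0<..<1} = {0<..<l}"
    proof (intro equalityI subsetI)
      fix s assume "s \<in> {0<..<l}"
      then show "s \<in> (\<lambda>u. u * l) ` {0<..<1}" using l by (intro image_eqI[of _ _ "s / l"]) auto
    qed (use l in \<open>auto simp: mult_less_cancel_right2\<close>)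
    finally show ?thesis by (simp add: diam)
  qed
qed

definition edge_level :: "pt set \<Rightarrow> real" where
  "edge_level e = fst (edge_ends e) \<bullet> edge_normal e"

lemma edge_side:
  assumes "e edge_of T" "2 simplex T"
  shows "interior T \<subseteq> {x. x \<bullet> edge_normal e < edge_level e} \<or>
    interior T \<subseteq> {x. x \<bullet> edge_normal e > edge_level e}"
proof -
  note T = triangle_basics[OF assms(2)]
  have "e face_of T" "e \<noteq> T" using assms(1) T(6) by (auto simp: edge_of_def)
  then have "affine hull e \<inter> rel_interior T = {}"
    using affine_hull_face_of_disjoint_rel_interior[OF T(1)] by blast
  then have disj: "x \<bullet> edge_normal e \<noteq> edge_level e" if "x \<in> interior T" for x
    using that edge_parametrization(5)[OF assms] T(4) by (auto simp: edge_level_def)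
  have "connected ((\<lambda>x. x \<bullet> edge_normal e) ` interior T)"
    by (intro connected_continuous_image continuous_intros convex_connected convex_interior T)
  then have "is_interval ((\<lambda>x. x \<bullet> edge_normal e) ` interior T)" by (simp add: is_interval_connected_1)
  then show ?thesis
    using disj unfolding is_interval_1 by (force simp: subset_iff not_less)
qed

lemma half_ball_in_triangle:
  assumes "e edge_of T" "2 simplex T" "x \<in> rel_interior e"
    and nu: "\<nu> = edge_normal e \<or> \<nu> = - edge_normal e"
    and side: "interior T \<subseteq> {y. y \<bullet> \<nu> < x \<bullet> \<nu>}"
  shows "\<exists>r>0. \<forall>y\<in>ball x r. y \<bullet> \<nu> < x \<bullet> \<nu> \<longrightarrow> y \<in> interior T"
proof -
  note T = triangle_basics[OF assms(2)]
  note ep = edge_parametrization[OF assms(1,2)]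
  define a where "a = fst (edge_ends e)"
  define t where "t = edge_tangent e"
  define c where "c = x \<bullet> \<nu>"
  have xe: "x \<in> e" using assms(3) rel_interior_subset by blast
  have xn: "x \<bullet> edge_normal e = a \<bullet> edge_normal e" using ep(4)[of x] xe by (simp add: a_def)
  have tt: "t \<bullet> t = 1" using ep(1) by (simp add: t_def dot_square_norm)
  have xs: "0 < (x - a) \<bullet> t" "(x - a) \<bullet> t < diameter e"
    using assms(3) unfolding ep(6) by (auto simp: a_def[symmetric] t_def[symmetric] tt)
  obtain z where z: "z \<in> interior T" using T(3) by blast
  then have zc: "c - z \<bullet> \<nu> > 0" using side by (auto simp: c_def)
  define \<gamma> where "\<gamma> y = (c - y \<bullet> \<nu>) / (c - z \<bullet> \<nu>)" for y
  \<comment> \<open>\<open>y\<close> lies on the segment from \<open>z\<close> to the point \<open>w y\<close> of the line through \<open>e\<close>\<close>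
  define w where "w y = (1 / (1 - \<gamma> y)) *\<^sub>R (y - \<gamma> y *\<^sub>R z)" for y
  have \<gamma>x: "\<gamma> x = 0" by (simp add: \<gamma>_def c_def)
  have \<gamma>c: "(\<gamma> \<longlongrightarrow> \<gamma> x) (at x)"
    unfolding \<gamma>_def using zc by (intro tendsto_intros) auto
  have wc: "(w \<longlongrightarrow> w x) (at x)"
    unfolding w_def using \<gamma>x by (intro tendsto_intros \<gamma>c) auto
  have wx: "w x = x" by (simp add: w_def \<gamma>x)
  have "((\<lambda>y. (w y - a) \<bullet> t) \<longlongrightarrow> (x - a) \<bullet> t) (at x)"
    using wc wx by (intro tendsto_intros) auto
  note wt = order_tendstoD(1)[OF this xs(1)] order_tendstoD(2)[OF this xs(2)]
  have "\<forall>\<^sub>F y in at x. \<gamma> y < 1" by (rule order_tendstoD(2)[OF \<gamma>c]) (simp add: \<gamma>x)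
  with wt have "\<forall>\<^sub>F y in at x. \<gamma> y < 1 \<and> 0 < (w y - a) \<bullet> t \<and> (w y - a) \<bullet> t < diameter e"
    by eventually_elim simp
  then obtain r where r: "r > 0" "\<And>y. y \<noteq> x \<Longrightarrow> dist y x < r \<Longrightarrow>
      \<gamma> y < 1 \<and> 0 < (w y - a) \<bullet> t \<and> (w y - a) \<bullet> t < diameter e"
    unfolding eventually_at by blast
  have "y \<in> interior T" if y: "y \<in> ball x r" "y \<bullet> \<nu> < x \<bullet> \<nu>" for y
  proof -
    have "y \<noteq> x" using y by auto
    then have b: "\<gamma> y < 1" "0 < (w y - a) \<bullet> t" "(w y - a) \<bullet> t < diameter e"
      using r(2)[of y] y by (auto simp: dist_commute)
    have g0: "\<gamma> y > 0" using y zc by (simp add: \<gamma>_def c_def)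
    have "\<gamma> y * (c - z \<bullet> \<nu>) = c - y \<bullet> \<nu>" using zc by (simp add: \<gamma>_def)
    then have "(y - \<gamma> y *\<^sub>R z) \<bullet> \<nu> = (1 - \<gamma> y) * c" by (simp add: inner_diff_left algebra_simps)
    then have "w y \<bullet> \<nu> = c" using b(1) by (simp add: w_def)
    then have "w y \<bullet> edge_normal e = a \<bullet> edge_normal e" using nu xn by (auto simp: c_def)
    then have "w y \<in> e" using ep(4)[of "w y"] b by (simp add: a_def t_def)
    then have wT: "w y \<in> T" using edge_of_imp_subset[OF assms(1)] by blast
    have "y = (1 - \<gamma> y) *\<^sub>R w y + \<gamma> y *\<^sub>R z" using b(1) by (simp add: w_def)
    then have "y = w y - \<gamma> y *\<^sub>R (w y - z)" by (simp add: algebra_simps)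
    moreover have "w y - \<gamma> y *\<^sub>R (w y - z) \<in> interior T"
      by (rule mem_interior_convex_shrink[OF T(1) z wT]) (use g0 b in auto)
    ultimately show ?thesis by simp
  qed
  then show ?thesis using r(1) by blast
qed

lemma edge_level_eq:
  assumes "e edge_of T" "2 simplex T" "x \<in> e" shows "x \<bullet> edge_normal e = edge_level e"
  using edge_parametrization(4)[OF assms(1,2)] assms(3) by (simp add: edge_level_def)

lemma rel_interior_edge_nonempty:
  assumes "e edge_of T" "2 simplex (T :: pt set)" obtains x where "x \<in> rel_interior e"
proof -
  have "diameter e / 2 \<in> {0<..<diameter e}" using edge_parametrization(2)[OF assms(1,2)] by simp
  then show thesis using that edge_parametrization(6)[OF assms(1,2)] by blast
qed

section \<open>Meshes\<close>

locale mesh =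
  fixes \<Omega> :: "pt set" and \<T> :: "pt set set"
  assumes mesh: "triangle_mesh \<Omega> \<T>" and open_domain: "open \<Omega>" and bounded_domain: "bounded \<Omega>"
    and frontier_null: "negligible (frontier \<Omega>)"
begin

lemma triangle: "T \<in> \<T> \<Longrightarrow> 2 simplex T"
  using mesh by (simp add: triangle_mesh_def)

lemma finite_mesh: "finite \<T>"
  using mesh by (simp add: triangle_mesh_def triangulation_def)

lemma Union_mesh: "\<Union>\<T> = closure \<Omega>"
  using mesh by (simp add: triangle_mesh_def)

lemma face_Int: "T \<in> \<T> \<Longrightarrow> T' \<in> \<T> \<Longrightarrow> T \<inter> T' face_of T"
  using mesh by (simp add: triangle_mesh_def triangulation_def)

lemma interior_disjoint:
  assumes "T \<in> \<T>" "T' \<in> \<T>" "T \<noteq> T'" shows "interior T \<inter> T' = {}"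
proof (rule ccontr)
  assume ne: "interior T \<inter> T' \<noteq> {}"
  note B = triangle_basics[OF triangle[OF assms(1)]] and B' = triangle_basics[OF triangle[OF assms(2)]]
  have "T \<subseteq> T \<inter> T'"
    by (rule subset_of_face_of[OF face_Int[OF assms(1,2)] order_refl])
      (use ne B(4) interior_subset in \<open>auto simp: disjnt_def\<close>)
  then have "T' \<inter> T = T" by blast
  then have "T face_of T'" using face_Int[OF assms(2,1)] by simp
  then have "aff_dim T < aff_dim T'" using assms(3) face_of_aff_dim_lt[OF B'(1)] by blast
  then show False using B B' by simp
qed

lemma same_side_eq:
  assumes T: "T \<in> \<T>" "e edge_of T" and T': "T' \<in> \<T>" "e edge_of T'"
    and nu: "\<nu> = edge_normal e \<or> \<nu> = - edge_normal e"
    and side: "x \<in> rel_interior e" "interior T \<subseteq> {y. y \<bullet> \<nu> < x \<bullet> \<nu>}" "interior T' \<subseteq> {y. y \<bullet> \<nu> < x \<bullet> \<nu>}"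
  shows "T = T'"
proof (rule ccontr)
  assume neq: "T \<noteq> T'"
  obtain r where r: "r > 0" "\<And>y. y \<in> ball x r \<Longrightarrow> y \<bullet> \<nu> < x \<bullet> \<nu> \<Longrightarrow> y \<in> interior T"
    using half_ball_in_triangle[OF T(2) triangle[OF T(1)] side(1) nu side(2)] by blast
  obtain r' where r': "r' > 0" "\<And>y. y \<in> ball x r' \<Longrightarrow> y \<bullet> \<nu> < x \<bullet> \<nu> \<Longrightarrow> y \<in> interior T'"
    using half_ball_in_triangle[OF T'(2) triangle[OF T'(1)] side(1) nu side(3)] by blast
  have nn: "norm \<nu> = 1"
    using nu edge_parametrization(1)[OF T(2) triangle[OF T(1)]] by (auto simp: edge_normal_perp)
  define y where "y = x - (min r r' / 2) *\<^sub>R \<nu>"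
  have "y \<bullet> \<nu> < x \<bullet> \<nu>" using r(1) r'(1) nn by (simp add: y_def inner_diff_left dot_square_norm)
  moreover have "y \<in> ball x r" "y \<in> ball x r'" using r(1) r'(1) nn by (simp_all add: y_def dist_norm)
  ultimately have "y \<in> interior T" "y \<in> T'" using r r' interior_subset by blast+
  then show False using interior_disjoint[OF T(1) T'(1) neq] by blast
qed

lemma edge_side':
  assumes "T \<in> \<T>" "e edge_of T" "x \<in> e"
  obtains \<nu> where "\<nu> = edge_normal e \<or> \<nu> = - edge_normal e" "interior T \<subseteq> {y. y \<bullet> \<nu> < x \<bullet> \<nu>}"
proof -
  have "x \<bullet> edge_normal e = edge_level e" by (rule edge_level_eq[OF assms(2) triangle[OF assms(1)] assms(3)])
  then show thesis
    using edge_side[OF assms(2) triangle[OF assms(1)]] that[of "edge_normal e"] that[of "- edge_normal e"]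
    by fastforce
qed

lemma opposite_side:
  assumes T: "T \<in> \<T>" "e edge_of T" and T': "T' \<in> \<T>" "e edge_of T'" and neq: "T \<noteq> T'"
    and nu: "\<nu> = edge_normal e \<or> \<nu> = - edge_normal e"
    and side: "x \<in> rel_interior e" "interior T \<subseteq> {y. y \<bullet> \<nu> < x \<bullet> \<nu>}"
  shows "interior T' \<subseteq> {y. y \<bullet> (- \<nu>) < x \<bullet> (- \<nu>)}"
proof -
  have xe: "x \<in> e" using side(1) rel_interior_subset by blast
  obtain \<mu> where \<mu>: "\<mu> = edge_normal e \<or> \<mu> = - edge_normal e" "interior T' \<subseteq> {y. y \<bullet> \<mu> < x \<bullet> \<mu>}"
    using edge_side'[OF T' xe] by metis
  have "\<mu> \<noteq> \<nu>" using same_side_eq[OF T T' nu side] \<mu>(2) neq by blast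
  then have "\<mu> = - \<nu>" using nu \<mu>(1) by auto
  then show ?thesis using \<mu>(2) by simp
qed

lemma interior_edge_point:
  assumes "T \<in> \<T>" "e edge_of T" "\<not> e \<subseteq> frontier \<Omega>"
  obtains x where "x \<in> rel_interior e" "x \<in> \<Omega>"
proof -
  note ep = edge_parametrization[OF assms(2) triangle[OF assms(1)]]
  obtain x where x: "x \<in> e" "x \<notin> frontier \<Omega>" using assms(3) by blast
  have "x \<in> closure \<Omega>" using x(1) edge_of_imp_subset[OF assms(2)] assms(1) Union_mesh by blast
  then have "x \<in> \<Omega>" using x(2) open_domain by (simp add: frontier_def interior_open)
  have "convex e" using assms(2) by (auto simp: edge_of_def dest: face_of_imp_convex)
  then have "e \<subseteq> closure (rel_interior e)"
    using convex_closure_rel_interior[of e] closure_subset[of e] by simp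
  then have "\<Omega> \<inter> rel_interior e \<noteq> {}"
    using x(1) \<open>x \<in> \<Omega>\<close> open_Int_closure_eq_empty[OF open_domain, of "rel_interior e"] by blast
  then show thesis using that by blast
qed

lemma neighbour_exists:
  assumes T: "T \<in> \<T>" "e edge_of T" and int: "\<not> e \<subseteq> frontier \<Omega>"
  shows "\<exists>T'\<in>\<T>. T' \<noteq> T \<and> e edge_of T'"
proof -
  note B = triangle_basics[OF triangle[OF T(1)]]
  obtain x where x: "x \<in> rel_interior e" "x \<in> \<Omega>" using interior_edge_point[OF assms] by blast
  then have xe: "x \<in> e" using rel_interior_subset by blast
  obtain \<nu> where \<nu>: "\<nu> = edge_normal e \<or> \<nu> = - edge_normal e" "interior T \<subseteq> {y. y \<bullet> \<nu> < x \<bullet> \<nu>}"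
    using edge_side'[OF T xe] by metis
  have nn: "norm \<nu> = 1"
    using \<nu>(1) edge_parametrization(1)[OF T(2) triangle[OF T(1)]] by (auto simp: edge_normal_perp)
  have "T \<subseteq> {y. y \<bullet> \<nu> \<le> x \<bullet> \<nu>}"
  proof -
    have "closure (interior T) \<subseteq> {y. y \<bullet> \<nu> \<le> x \<bullet> \<nu>}"
      using \<nu>(2) by (intro closure_minimal closed_Collect_le continuous_intros) auto
    then show ?thesis using B(5) by simp
  qed
  note side = this
  define A where "A = \<Union>(\<T> - {T})"
  have "closed A" unfolding A_def
    using finite_mesh triangle triangle_basics(2) by (intro closed_Union) (auto simp: compact_imp_closed)
  have "x \<in> closure A"
  proof (unfold closure_approachable, intro allI impI)
    fix \<epsilon> :: real assume "\<epsilon> > 0"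
    obtain r where r: "r > 0" "ball x r \<subseteq> \<Omega>" using x(2) open_domain open_contains_ball by blast
    define y where "y = x + (min r \<epsilon> / 2) *\<^sub>R \<nu>"
    have "dist y x < \<epsilon>" "y \<in> ball x r" using r(1) \<open>\<epsilon> > 0\<close> nn by (simp_all add: y_def dist_norm)
    then have "y \<in> closure \<Omega>" using r(2) closure_subset by blast
    moreover have "y \<bullet> \<nu> > x \<bullet> \<nu>"
      using r(1) \<open>\<epsilon> > 0\<close> nn by (simp add: y_def inner_add_left dot_square_norm)
    then have "y \<notin> T" using side by auto
    ultimately have "y \<in> A" using Union_mesh by (auto simp: A_def)
    then show "\<exists>y\<in>A. dist y x < \<epsilon>" using \<open>dist y x < \<epsilon>\<close> by blast
  qed
  then have "x \<in> A" using \<open>closed A\<close> by simp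
  then obtain T' where T': "T' \<in> \<T>" "T' \<noteq> T" "x \<in> T'" by (auto simp: A_def)
  note B' = triangle_basics[OF triangle[OF T'(1)]]
  have ef: "e face_of T" "aff_dim e = 1" using T(2) by (auto simp: edge_of_def)
  have eT: "e \<subseteq> T" using ef(1) by (rule face_of_imp_subset)
  have "e \<subseteq> T \<inter> T'"
    by (rule subset_of_face_of[OF face_Int[OF T(1) T'(1)] eT])
      (use x(1) xe eT T'(3) in \<open>auto simp: disjnt_def\<close>)
  then have efT': "e face_of (T \<inter> T')" by (intro face_of_subset[OF ef(1)]) auto
  have "T \<inter> T' \<noteq> T"
    using interior_disjoint[OF T(1) T'(1)] T'(2) B(3) interior_subset[of T] by blast
  then have "aff_dim (T \<inter> T') < 2"
    using face_of_aff_dim_lt[OF B(1) face_Int[OF T(1) T'(1)]] B(6) by simp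
  then have "e = T \<inter> T'"
    using face_of_aff_dim_lt[OF _ efT'] ef(2) convex_Int[OF B(1) B'(1)] by fastforce
  then have "e face_of T'" using face_Int[OF T'(1) T(1)] by (simp add: Int_commute)
  then show ?thesis using T' ef(2) by (auto simp: edge_of_def)
qed

lemma neighbour_unique:
  assumes T: "T \<in> \<T>" "e edge_of T" and T': "T' \<in> \<T>" "T' \<noteq> T" "e edge_of T'"
    and T'': "T'' \<in> \<T>" "T'' \<noteq> T" "e edge_of T''"
  shows "T' = T''"
proof -
  obtain x where x: "x \<in> rel_interior e" using rel_interior_edge_nonempty[OF T(2) triangle[OF T(1)]] by blast
  then have xe: "x \<in> e" using rel_interior_subset by blast
  obtain \<nu> where \<nu>: "\<nu> = edge_normal e \<or> \<nu> = - edge_normal e" "interior T \<subseteq> {y. y \<bullet> \<nu> < x \<bullet> \<nu>}"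
    using edge_side'[OF T xe] by metis
  have \<nu>': "- \<nu> = edge_normal e \<or> - \<nu> = - edge_normal e" using \<nu>(1) by auto
  show ?thesis
    by (rule same_side_eq[OF T'(1,3) T''(1,3) \<nu>' x
          opposite_side[OF T T'(1,3) T'(2)[symmetric] \<nu>(1) x \<nu>(2)]
          opposite_side[OF T T''(1,3) T''(2)[symmetric] \<nu>(1) x \<nu>(2)]])
qed

lemma neighbour_eq:
  assumes "T \<in> \<T>" "e edge_of T" "T' \<in> \<T>" "T' \<noteq> T" "e edge_of T'"
  shows "neighbour \<T> T e = T'"
  unfolding neighbour_def using assms neighbour_unique by (intro the_equality) blast+

lemma neighbour:
  assumes "T \<in> \<T>" "e edge_of T" "\<not> e \<subseteq> frontier \<Omega>"
  shows "neighbour \<T> T e \<in> \<T>" "neighbour \<T> T e \<noteq> T" "e edge_of neighbour \<T> T e"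
    "neighbour \<T> (neighbour \<T> T e) e = T"
proof -
  obtain T' where T': "T' \<in> \<T>" "T' \<noteq> T" "e edge_of T'" using neighbour_exists[OF assms] by blast
  have "neighbour \<T> T e = T'" by (rule neighbour_eq[OF assms(1,2) T'])
  moreover have "neighbour \<T> T' e = T" by (rule neighbour_eq[OF T'(1,3) assms(1) T'(2)[symmetric] assms(2)])
  ultimately show "neighbour \<T> T e \<in> \<T>" "neighbour \<T> T e \<noteq> T" "e edge_of neighbour \<T> T e"
    "neighbour \<T> (neighbour \<T> T e) e = T" using T' by simp_all
qed

end

lemma triangle_edges:
  assumes "2 simplex T" shows "finite {e. e edge_of T}" "card {e. e edge_of T} \<le> 8"
proof -
  obtain C where C: "\<not> affine_dependent C" "card C = 3" "T = convex hull C"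
    using assms by (auto simp: simplex_def)
  have sub: "{e. e edge_of T} \<subseteq> (\<lambda>c. convex hull c) ` Pow C"
    using C face_of_convex_hull_affine_independent[OF C(1)] by (auto simp: edge_of_def)
  have fin: "finite (Pow C)" using C(1) aff_independent_finite by blast
  show "finite {e. e edge_of T}" using sub fin finite_subset by blast
  have "card {e. e edge_of T} \<le> card ((\<lambda>c. convex hull c) ` Pow C)"
    using sub fin by (intro card_mono) auto
  also have "\<dots> \<le> card (Pow C)" using fin by (rule card_image_le)
  also have "\<dots> = 8" using fin C(2) by (simp add: card_Pow)
  finally show "card {e. e edge_of T} \<le> 8" .
qed

lemma shape_regular_disk:
  assumes "2 simplex T" "diameter T \<le> \<kappa> * disk_diam T"
  obtains x where "cball x (diameter T * (1 / (4 * (\<bar>\<kappa>\<bar> + 1)))) \<subseteq> T" "T \<subseteq> cball x (diameter T)"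
proof -
  define S where "S = {2 * r |r. 0 \<le> r \<and> (\<exists>x. cball x r \<subseteq> T)}"
  have bT: "bounded T" using triangle_basics(2)[OF assms(1)] by (rule compact_imp_bounded)
  have d: "diameter T > 0" by (rule triangle_diameter_pos[OF assms(1)])
  obtain x0 where x0: "x0 \<in> T" using triangle_basics(3)[OF assms(1)] interior_subset by blast
  then have "cball x0 0 \<subseteq> T" by simp
  then have zero: "0 \<in> S" unfolding S_def by (intro CollectI exI[of _ 0]) auto
  have bdd: "bdd_above S"
  proof (rule bdd_aboveI)
    fix s assume "s \<in> S"
    then obtain r x where r: "s = 2 * r" "0 \<le> r" "cball x r \<subseteq> T" by (auto simp: S_def)
    then have "diameter (cball x r) \<le> diameter T" using bT by (intro diameter_subset)
    then show "s \<le> diameter T" using r by (simp add: diameter_cball)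
  qed
  have "disk_diam T = Sup S" by (simp add: disk_diam_def S_def)
  moreover have "Sup S \<ge> 0" using zero bdd by (rule cSup_upper)
  ultimately have "diameter T \<le> (\<bar>\<kappa>\<bar> + 1) * Sup S"
  proof -
    have "\<kappa> * Sup S \<le> (\<bar>\<kappa>\<bar> + 1) * Sup S" using \<open>Sup S \<ge> 0\<close> by (intro mult_right_mono) auto
    then show ?thesis using assms(2) \<open>disk_diam T = Sup S\<close> by simp
  qed
  then have "diameter T / (\<bar>\<kappa>\<bar> + 1) \<le> Sup S" by (simp add: field_simps)
  moreover have "diameter T / (2 * (\<bar>\<kappa>\<bar> + 1)) < diameter T / (\<bar>\<kappa>\<bar> + 1)"
    using d by (simp add: field_simps add_pos_nonneg)
  ultimately have "diameter T / (2 * (\<bar>\<kappa>\<bar> + 1)) < Sup S" by simp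
  from less_cSupD[OF _ this] zero obtain s where s: "s \<in> S" "diameter T / (2 * (\<bar>\<kappa>\<bar> + 1)) < s" by blast
  then obtain r x where r: "s = 2 * r" "0 \<le> r" "cball x r \<subseteq> T" by (auto simp: S_def)
  have "diameter T * (1 / (4 * (\<bar>\<kappa>\<bar> + 1))) \<le> r" using s(2) r(1) by (simp add: field_simps)
  then have "cball x (diameter T * (1 / (4 * (\<bar>\<kappa>\<bar> + 1)))) \<subseteq> T" using r(3) by auto
  moreover have "x \<in> T" using r by auto
  then have "T \<subseteq> cball x (diameter T)" using diameter_bounded_bound[OF bT] by auto
  ultimately show thesis by (rule that)
qed

section \<open>Local bounds for the estimator\<close>

lemma edge_trace_eq:
  assumes "2 simplex T" "x \<in> T" "continuous_on UNIV v" "\<And>y. y \<in> interior T \<Longrightarrow> w y = v y"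
  shows "edge_trace T w x = (v x :: real)"
proof -
  note T = triangle_basics[OF assms(1)]
  have "x islimpt interior T"
  proof (cases "x \<in> interior T")
    case True
    then show ?thesis by (simp add: interior_limit_point interior_open islimpt_subset[OF _ subset_refl])
  next
    case False
    then show ?thesis using assms(2) T(5) by (auto simp: closure_def)
  qed
  then have nt: "\<not> trivial_limit (at x within interior T)" by (simp add: trivial_limit_within)
  have "(v \<longlongrightarrow> v x) (at x within interior T)"
    using continuous_on_subset[OF assms(3), of "insert x (interior T)"] assms(3)
    by (simp add: continuous_on_eq_continuous_at continuous_at_imp_continuous_at_within continuous_within[symmetric])
  moreover have "\<forall>\<^sub>F y in at x within interior T. v y = w y"
    using assms(4) by (auto simp: eventually_at intro!: exI[of _ 1])
  ultimately have "(w \<longlongrightarrow> v x) (at x within interior T)" by (rule Lim_transform_eventually)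
  then show ?thesis unfolding edge_trace_def by (rule tendsto_Lim[OF nt])
qed

lemma integral_AE_bound:
  fixes g :: "pt \<Rightarrow> real"
  assumes "T \<in> lmeasurable" "AE x in lebesgue_on T. g x \<le> B" "B \<ge> 0"
  shows "(\<integral>x. g x \<partial>lebesgue_on T) \<le> B * measure lebesgue T"
proof (cases "integrable (lebesgue_on T) g")
  case True
  interpret finite_measure "lebesgue_on T" by (rule finite_measure_lebesgue_on[OF assms(1)])
  have "(\<integral>x. g x \<partial>lebesgue_on T) \<le> (\<integral>x. B \<partial>lebesgue_on T)"
    by (rule integral_mono_AE[OF True _ assms(2)]) simp
  also have "\<dots> = B * measure (lebesgue_on T) (space (lebesgue_on T))" by simp
  also have "measure (lebesgue_on T) (space (lebesgue_on T)) = measure lebesgue T"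
    using assms(1) by (simp add: measure_restrict_space fmeasurableD)
  finally show ?thesis .
next
  case False
  then show ?thesis using assms(3) by (simp add: not_integrable_integral_eq)
qed

lemma edge_norm_sq_bound:
  assumes "e edge_of T" "2 simplex T" "\<And>x. x \<in> e \<Longrightarrow> (g x)\<^sup>2 \<le> B"
  shows "edge_norm_sq e g \<le> diameter e * B"
proof -
  note ep = edge_parametrization[OF assms(1,2)]
  define f where "f s = (g (fst (edge_ends e) + s *\<^sub>R edge_tangent e))\<^sup>2" for s
  have fB: "f s \<le> B" if "s \<in> {0..diameter e}" for s
    unfolding f_def by (rule assms(3), subst ep(3)) (use that in blast)
  have "B \<ge> 0" using fB[of 0] ep(2) by (auto simp: f_def intro: order_trans[OF zero_le_power2])
  show ?thesis
  proof (cases "integrable (lebesgue_on {0..diameter e}) f")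
    case True
    interpret finite_measure "lebesgue_on {0..diameter e}" by (rule finite_measure_lebesgue_on) simp
    have "(\<integral>s. f s \<partial>lebesgue_on {0..diameter e}) \<le> (\<integral>s. B \<partial>lebesgue_on {0..diameter e})"
      by (rule integral_mono[OF True]) (use fB in \<open>auto simp: space_restrict_space\<close>)
    also have "\<dots> = B * measure (lebesgue_on {0..diameter e}) {0..diameter e}"
      by (simp add: space_restrict_space)
    also have "measure (lebesgue_on {0..diameter e}) {0..diameter e} = diameter e"
      using ep(2) by (simp add: measure_restrict_space)
    finally show ?thesis by (simp add: edge_norm_sq_def f_def mult.commute)
  next
    case False
    then show ?thesis
      using \<open>B \<ge> 0\<close> ep(2) unfolding edge_norm_sq_def f_def[symmetric]
      by (simp add: not_integrable_integral_eq)
  qed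
qed

lemma tangential_derivative_zero:
  assumes "e edge_of T" "2 simplex T" "g \<in> polys k" "\<And>x. x \<in> e \<Longrightarrow> g x = 0"
    "x \<in> e"
  shows "grad g x \<bullet> edge_tangent e = 0"
proof -
  note ep = edge_parametrization[OF assms(1,2)]
  define a where "a = fst (edge_ends e)"
  define t where "t = edge_tangent e"
  have zero: "g (a + s *\<^sub>R t) = 0" for s
  proof (rule polys_zero_on_segment[OF assms(3) ep(2)])
    fix s assume "0 < s" "s < diameter e"
    then show "g (a + s *\<^sub>R t) = 0"
      by (intro assms(4), subst ep(3)) (auto simp: a_def t_def)
  qed
  obtain s where x: "x = a + s *\<^sub>R t"
    using assms(5) by (subst (asm) ep(3)) (auto simp: a_def t_def)
  have "((\<lambda>s. a + s *\<^sub>R t) has_derivative (\<lambda>h. h *\<^sub>R t)) (at s)"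
    by (auto intro!: derivative_eq_intros)
  from has_derivative_compose[OF this differentiable_has_derivative_pd[OF polys_differentiable[OF assms(3)]]]
  have "((\<lambda>s. 0) has_derivative (\<lambda>h. grad g x \<bullet> (h *\<^sub>R t))) (at s)" by (simp add: zero x)
  then have "(\<lambda>h. grad g x \<bullet> (h *\<^sub>R t)) = (\<lambda>h. 0)"
    by (rule has_derivative_unique) (rule has_derivative_const)
  then have "grad g x \<bullet> (1 *\<^sub>R t) = 0" by (rule fun_cong)
  then show ?thesis by (simp add: t_def)
qed

lemma grad_diff:
  "f differentiable at x \<Longrightarrow> g differentiable at x \<Longrightarrow> grad (\<lambda>x. f x - g x) x = grad f x - grad g x"
  by (simp add: grad_def pd_diff vec_eq_iff)

lemma vpolys_diff: "f \<in> vpolys k \<Longrightarrow> g \<in> vpolys k \<Longrightarrow> (\<lambda>x. f x - g x) \<in> vpolys k"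
  by (simp add: vpolys_def polys_diff)

lemma grad_vpolys: "p \<in> polys k \<Longrightarrow> grad p \<in> vpolys k"
  by (simp add: vpolys_def grad_def polys_pd)

lemma inner_sq_le: "norm v = 1 \<Longrightarrow> (x \<bullet> v)\<^sup>2 \<le> (norm x)\<^sup>2"
  using Cauchy_Schwarz_ineq2[of x v] by (simp add: abs_le_square_iff[symmetric])

lemma measure_le_diameter:
  assumes "2 simplex (T :: pt set)"
  shows "measure lebesgue T \<le> unit_ball_vol 2 * (diameter T)\<^sup>2"
proof -
  note T = triangle_basics[OF assms]
  obtain x where x: "x \<in> T" using T(3) interior_subset by blast
  have bT: "bounded T" using T(2) by (rule compact_imp_bounded)
  have "T \<subseteq> cball x (diameter T)" using diameter_bounded_bound[OF bT x] by auto
  then have "measure lebesgue T \<le> measure lebesgue (cball x (diameter T))"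
    using T(2) by (intro measure_mono_fmeasurable) (auto simp: T(7))
  also have "\<dots> = unit_ball_vol 2 * (diameter T)\<^sup>2"
    using content_cball[of "diameter T" x] triangle_diameter_pos[OF assms] by simp
  finally show ?thesis .
qed

lemma norm_sq_components: "(norm (v :: pt))\<^sup>2 = (\<Sum>j\<in>UNIV. (v $ j)\<^sup>2)"
  unfolding power2_norm_eq_inner inner_vec_def by (simp add: power2_eq_square)

locale fe_pair = mesh +
  fixes N :: nat and C :: real and \<sigma> :: "pt \<Rightarrow> pt" and u :: "pt \<Rightarrow> real"
    and q :: "pt set \<Rightarrow> pt \<Rightarrow> pt" and p :: "pt set \<Rightarrow> pt \<Rightarrow> real"
  assumes C_pos: "C > 0"
    and inverse0: "\<lbrakk>r \<in> polys N; T \<in> \<T>; y \<in> T\<rbrakk> \<Longrightarrow>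
      (diameter T)\<^sup>2 * (r y)\<^sup>2 \<le> C * (\<integral>x. (r x)\<^sup>2 \<partial>lebesgue_on T)"
    and inverse1: "\<lbrakk>r \<in> polys N; T \<in> \<T>; y \<in> T\<rbrakk> \<Longrightarrow>
      (diameter T)\<^sup>2 * (diameter T * pd i r y)\<^sup>2 \<le> C * (\<integral>x. (r x)\<^sup>2 \<partial>lebesgue_on T)"
    and sigma_Hdiv: "\<sigma> \<in> Hdiv \<Omega>"
    and q: "T \<in> \<T> \<Longrightarrow> q T \<in> vpolys N" "\<lbrakk>T \<in> \<T>; x \<in> interior T\<rbrakk> \<Longrightarrow> \<sigma> x = q T x"
    and p: "T \<in> \<T> \<Longrightarrow> p T \<in> polys N" "\<lbrakk>T \<in> \<T>; x \<in> T\<rbrakk> \<Longrightarrow> u x = p T x"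
    and u_zero: "x \<in> frontier \<Omega> \<Longrightarrow> u x = 0"
begin

definition gap :: "pt set \<Rightarrow> pt \<Rightarrow> pt" where
  "gap T x = q T x - grad (p T) x"

definition gap_sq :: "pt set \<Rightarrow> real" where
  "gap_sq T = (\<integral>x. (norm (gap T x))\<^sup>2 \<partial>lebesgue_on T)"

lemma gap_sq_nonneg: "gap_sq T \<ge> 0"
  unfolding gap_sq_def by (rule integral_nonneg_AE) simp

lemma gap_vpolys: "T \<in> \<T> \<Longrightarrow> gap T \<in> vpolys N"
  unfolding gap_def[abs_def] by (intro vpolys_diff grad_vpolys q p)

lemma gap_polys: "T \<in> \<T> \<Longrightarrow> (\<lambda>x. gap T x $ j) \<in> polys N"
  using gap_vpolys by (simp add: vpolys_def)

lemma gap_sq_components: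
  assumes "T \<in> \<T>"
  shows "gap_sq T = (\<Sum>j\<in>UNIV. \<integral>x. (gap T x $ j)\<^sup>2 \<partial>lebesgue_on T)"
proof -
  have "integrable (lebesgue_on T) (\<lambda>x. (gap T x $ j)\<^sup>2)" for j
    by (intro continuous_integrable_compact triangle_basics(2)[OF triangle[OF assms]] continuous_intros
        polys_continuous[OF gap_polys[OF assms]])
  then show ?thesis unfolding gap_sq_def norm_sq_components by (simp add: Bochner_Integration.integral_sum)
qed

lemma component_le_gap_sq:
  assumes "T \<in> \<T>" shows "(\<integral>x. (gap T x $ j)\<^sup>2 \<partial>lebesgue_on T) \<le> gap_sq T"
  unfolding gap_sq_components[OF assms]
  by (rule member_le_sum) (auto intro: integral_nonneg_AE)

lemma gap_bound:
  assumes "T \<in> \<T>" "x \<in> T" shows "(diameter T)\<^sup>2 * (norm (gap T x))\<^sup>2 \<le> C * gap_sq T"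
proof -
  have "(diameter T)\<^sup>2 * (norm (gap T x))\<^sup>2 = (\<Sum>j\<in>UNIV. (diameter T)\<^sup>2 * (gap T x $ j)\<^sup>2)"
    by (simp only: norm_sq_components sum_distrib_left)
  also have "\<dots> \<le> (\<Sum>j\<in>UNIV. C * (\<integral>x. (gap T x $ j)\<^sup>2 \<partial>lebesgue_on T))"
    by (intro sum_mono inverse0 gap_polys assms)
  also have "\<dots> = C * gap_sq T" by (simp add: gap_sq_components[OF assms(1)] sum_distrib_left)
  finally show ?thesis .
qed

lemma pd_gap_bound:
  assumes "T \<in> \<T>" "x \<in> T"
  shows "(diameter T)\<^sup>2 * (diameter T * pd i (\<lambda>x. gap T x $ j) x)\<^sup>2 \<le> C * gap_sq T"
proof -
  have "(diameter T)\<^sup>2 * (diameter T * pd i (\<lambda>x. gap T x $ j) x)\<^sup>2 \<le>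
      C * (\<integral>x. (gap T x $ j)\<^sup>2 \<partial>lebesgue_on T)"
    by (intro inverse1 gap_polys assms)
  also have "\<dots> \<le> C * gap_sq T" using component_le_gap_sq[OF assms(1)] C_pos by simp
  finally show ?thesis .
qed

lemma pd_gap:
  assumes "T \<in> \<T>"
  shows "pd i (\<lambda>x. gap T x $ j) x = pd i (\<lambda>x. q T x $ j) x - pd i (pd j (p T)) x"
proof -
  have "(\<lambda>x. gap T x $ j) = (\<lambda>x. q T x $ j - pd j (p T) x)" by (simp add: gap_def grad_def)
  then show ?thesis
    using pd_diff[where f = "\<lambda>x. q T x $ j" and g = "pd j (p T)" and x = x and i = i]
      polys_differentiable[OF polys_pd[OF p(1)[OF assms]]]
      polys_differentiable[of "\<lambda>x. q T x $ j" N] q(1)[OF assms]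
    by (simp add: vpolys_def)
qed

lemma AE_interior:
  assumes "T \<in> \<T>" shows "AE x in lebesgue. x \<in> T \<longrightarrow> x \<in> interior T \<and> x \<in> \<Omega>"
proof -
  note B = triangle_basics[OF triangle[OF assms]]
  have "AE x in lebesgue. x \<notin> frontier T"
    using negligible_convex_frontier[OF B(1)] by (intro AE_not_in) (simp add: negligible_iff_null_sets)
  moreover have "AE x in lebesgue. x \<notin> frontier \<Omega>"
    using frontier_null by (intro AE_not_in) (simp add: negligible_iff_null_sets)
  ultimately show ?thesis
  proof eventually_elim
    case (elim x)
    show ?case
    proof
      assume x: "x \<in> T"
      then have "x \<in> closure \<Omega>" using Union_mesh assms by blast
      then show "x \<in> interior T \<and> x \<in> \<Omega>"
        using elim x closure_subset[of T] open_domain by (auto simp: frontier_def interior_open)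
    qed
  qed
qed

lemma grad_u_interior:
  assumes "T \<in> \<T>" "x \<in> interior T" shows "grad u x = grad (p T) x"
proof -
  have "pd i u x = pd i (p T) x" for i
    by (rule pd_cong_open[OF open_interior assms(2)]) (use p(2)[OF assms(1)] interior_subset in blast)
  then show ?thesis by (simp add: grad_def)
qed

lemma volume_bound:
  assumes T: "T \<in> \<T>"
    and g: "AE x in lebesgue. x \<in> T \<longrightarrow>
      (\<exists>i j i' j'. \<bar>g x\<bar> \<le> \<bar>pd i (\<lambda>x. gap T x $ j) x\<bar> + \<bar>pd i' (\<lambda>x. gap T x $ j') x\<bar>)"
  shows "(diameter T)\<^sup>2 * (l2_norm T g)\<^sup>2 \<le> 4 * unit_ball_vol 2 * C * gap_sq T"
proof -
  note B = triangle_basics[OF triangle[OF T]]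
  define d where "d = diameter T"
  have d: "d > 0" unfolding d_def by (rule triangle_diameter_pos[OF triangle[OF T]])
  define B0 where "B0 = 4 * C * gap_sq T / (d\<^sup>2 * d\<^sup>2)"
  have B0: "B0 \<ge> 0" using d C_pos gap_sq_nonneg by (simp add: B0_def)
  have pd: "(pd i (\<lambda>x. gap T x $ j) x)\<^sup>2 \<le> C * gap_sq T / (d\<^sup>2 * d\<^sup>2)" if "x \<in> T" for x i j
    using pd_gap_bound[OF T that, of i j] d by (simp add: d_def[symmetric] field_simps power_mult_distrib)
  have "AE x in lebesgue. x \<in> T \<longrightarrow> (norm (g x))\<^sup>2 \<le> B0"
    using g
  proof eventually_elim
    case (elim x)
    show ?case
    proof
      assume x: "x \<in> T"
      with elim obtain i j i' j' where
        le: "\<bar>g x\<bar> \<le> \<bar>pd i (\<lambda>x. gap T x $ j) x\<bar> + \<bar>pd i' (\<lambda>x. gap T x $ j') x\<bar>" by blast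
      have "(norm (g x))\<^sup>2 \<le> (\<bar>pd i (\<lambda>x. gap T x $ j) x\<bar> + \<bar>pd i' (\<lambda>x. gap T x $ j') x\<bar>)\<^sup>2"
        using le by (intro power_mono) auto
      also have "\<dots> \<le> 2 * (pd i (\<lambda>x. gap T x $ j) x)\<^sup>2 + 2 * (pd i' (\<lambda>x. gap T x $ j') x)\<^sup>2"
        using sum_squares_bound[of "\<bar>pd i (\<lambda>x. gap T x $ j) x\<bar>" "\<bar>pd i' (\<lambda>x. gap T x $ j') x\<bar>"]
        by (simp add: power2_sum)
      also have "\<dots> \<le> B0" using pd[OF x, of i j] pd[OF x, of i' j'] by (simp add: B0_def)
      finally show "(norm (g x))\<^sup>2 \<le> B0" .
    qed
  qed
  then have "AE x in lebesgue_on T. (norm (g x))\<^sup>2 \<le> B0"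
    using B(7) by (simp add: AE_restrict_space_iff)
  then have "(l2_norm T g)\<^sup>2 \<le> B0 * measure lebesgue T"
    unfolding l2_norm_sq by (intro integral_AE_bound B0) (simp_all add: B(2) lmeasurable_compact)
  also have "\<dots> \<le> B0 * (unit_ball_vol 2 * d\<^sup>2)"
    using measure_le_diameter[OF triangle[OF T]] B0 by (simp add: d_def mult_left_mono)
  finally have "d\<^sup>2 * (l2_norm T g)\<^sup>2 \<le> d\<^sup>2 * (B0 * (unit_ball_vol 2 * d\<^sup>2))"
    by (rule mult_left_mono) simp
  also have "\<dots> = 4 * unit_ball_vol 2 * C * gap_sq T" using d by (simp add: B0_def field_simps)
  finally show ?thesis by (simp add: d_def)
qed

lemma div_term:
  assumes T: "T \<in> \<T>"
  shows "(diameter T)\<^sup>2 * (l2_norm T (\<lambda>x. weak_div \<Omega> \<sigma> x - laplacian u x))\<^sup>2 \<le> 4 * unit_ball_vol 2 * C * gap_sq T"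
proof (rule volume_bound[OF T])
  have "AE x in lebesgue. x \<in> interior T \<inter> \<Omega> \<longrightarrow> weak_div \<Omega> \<sigma> x = divg (q T) x"
    by (rule has_weak_div_vpolys_AE[OF weak_divD(2)[OF sigma_Hdiv] weak_divD(1)[OF sigma_Hdiv]
          open_domain bounded_domain _ _ _ q(1)[OF T]])
      (use q(2)[OF T] open_domain in auto)
  with AE_interior[OF T] show "AE x in lebesgue. x \<in> T \<longrightarrow>
      (\<exists>i j i' j'. \<bar>weak_div \<Omega> \<sigma> x - laplacian u x\<bar> \<le>
         \<bar>pd i (\<lambda>x. gap T x $ j) x\<bar> + \<bar>pd i' (\<lambda>x. gap T x $ j') x\<bar>)"
  proof eventually_elim
    case (elim x)
    show ?case
    proof
      assume x: "x \<in> T"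
      then have xi: "x \<in> interior T" and w: "weak_div \<Omega> \<sigma> x = divg (q T) x" using elim by auto
      have "pd i (pd i u) x = pd i (pd i (p T)) x" for i
      proof (rule pd_cong_open[OF open_interior xi])
        fix y assume "y \<in> interior T"
        from grad_u_interior[OF T this] show "pd i u y = pd i (p T) y" by (simp add: grad_def vec_eq_iff)
      qed
      then have "weak_div \<Omega> \<sigma> x - laplacian u x = pd 1 (\<lambda>x. gap T x $ 1) x + pd 2 (\<lambda>x. gap T x $ 2) x"
        by (simp add: w divg_def laplacian_def sum_2 pd_gap[OF T])
      then show "\<exists>i j i' j'. \<bar>weak_div \<Omega> \<sigma> x - laplacian u x\<bar> \<le>
         \<bar>pd i (\<lambda>x. gap T x $ j) x\<bar> + \<bar>pd i' (\<lambda>x. gap T x $ j') x\<bar>"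
        by (metis abs_triangle_ineq)
    qed
  qed
qed

lemma pd_commute_mon: "pd 1 (pd 2 (mon a)) = pd 2 (pd 1 (mon a))"
proof -
  have c: "pd i (\<lambda>x. c * mon b x) = (\<lambda>x. c * pd i (mon b) x)" for i c b
    by (rule ext) (rule pd_cmult[OF mon_differentiable])
  show ?thesis by (simp add: pd_mon c fun_eq_iff)
qed

lemma pd_commute_polys:
  assumes "g \<in> polys k" shows "pd 1 (pd 2 g) x = pd 2 (pd 1 g) x"
proof -
  obtain c where g: "g = (\<lambda>x. \<Sum>a\<in>poly_index k. c a * mon a x)" using assms polys_iff by blast
  have d: "pd j (mon a) differentiable at x" if "a \<in> poly_index k" for a j
    by (rule polys_differentiable[OF polys_pd[OF mon_polys[OF that]]])
  have "pd i (\<lambda>x. \<Sum>a\<in>poly_index k. c a * pd j (mon a) x) x = (\<Sum>a\<in>poly_index k. c a * pd i (pd j (mon a)) x)" for i j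
    using d by (subst pd_sum) (auto intro!: differentiable_mult sum.cong simp: pd_cmult)
  then show ?thesis by (simp add: g pd_polys_eq pd_commute_mon)
qed

lemma curl_term:
  assumes T: "T \<in> \<T>"
  shows "(diameter T)\<^sup>2 * (l2_norm T (curl \<sigma>))\<^sup>2 \<le> 4 * unit_ball_vol 2 * C * gap_sq T"
proof (rule volume_bound[OF T])
  show "AE x in lebesgue. x \<in> T \<longrightarrow>
      (\<exists>i j i' j'. \<bar>curl \<sigma> x\<bar> \<le> \<bar>pd i (\<lambda>x. gap T x $ j) x\<bar> + \<bar>pd i' (\<lambda>x. gap T x $ j') x\<bar>)"
    using AE_interior[OF T]
  proof eventually_elim
    case (elim x)
    show ?case
    proof
      assume x: "x \<in> T"
      then have xi: "x \<in> interior T" using elim by auto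
      have "pd i (\<lambda>y. \<sigma> y $ j) x = pd i (\<lambda>y. q T y $ j) x" for i j
        by (rule pd_cong_open[OF open_interior xi]) (simp add: q(2)[OF T])
      then have "curl \<sigma> x = pd 1 (\<lambda>x. gap T x $ 2) x - pd 2 (\<lambda>x. gap T x $ 1) x"
        using pd_commute_polys[OF p(1)[OF T], of x] by (simp add: curl_def pd_gap[OF T])
      then show "\<exists>i j i' j'. \<bar>curl \<sigma> x\<bar> \<le> \<bar>pd i (\<lambda>x. gap T x $ j) x\<bar> + \<bar>pd i' (\<lambda>x. gap T x $ j') x\<bar>"
        by (metis abs_triangle_ineq4)
    qed
  qed
qed

lemma sigma_trace:
  assumes "T \<in> \<T>" "x \<in> T" shows "edge_trace T (\<lambda>x. \<sigma> x \<bullet> v) x = q T x \<bullet> v"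
  by (rule edge_trace_eq[OF triangle[OF assms(1)] assms(2)])
    (auto intro!: continuous_intros vpolys_continuous[OF q(1)[OF assms(1)]] simp: q(2)[OF assms(1)])

lemma grad_trace:
  assumes "T \<in> \<T>" "x \<in> T" shows "edge_trace T (\<lambda>x. grad u x \<bullet> v) x = grad (p T) x \<bullet> v"
  by (rule edge_trace_eq[OF triangle[OF assms(1)] assms(2)])
    (auto intro!: continuous_intros grad_polys_continuous[OF p(1)[OF assms(1)]] simp: grad_u_interior[OF assms(1)])

lemma normal_jump_zero:
  assumes T: "T \<in> \<T>" "e edge_of T" "\<not> e \<subseteq> frontier \<Omega>" and x: "x \<in> e"
  shows "q T x \<bullet> edge_normal e = q (neighbour \<T> T e) x \<bullet> edge_normal e"
proof -
  define T' where "T' = neighbour \<T> T e"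
  note nb = neighbour[OF T, folded T'_def]
  note ep = edge_parametrization[OF T(2) triangle[OF T(1)]]
  define a where "a = fst (edge_ends e)"
  define t where "t = edge_tangent e"
  define J where "J x = (q T x - q T' x) \<bullet> edge_normal e" for x
  have J: "J \<in> polys N" unfolding J_def[abs_def] by (intro polys_inner vpolys_diff q(1) T(1) nb(1))
  have key: "J y = 0" if y: "y \<in> rel_interior e" "y \<in> \<Omega>" for y
  proof -
    have ye: "y \<in> e" using y(1) rel_interior_subset by blast
    obtain \<nu> where \<nu>: "\<nu> = edge_normal e \<or> \<nu> = - edge_normal e" "interior T \<subseteq> {z. z \<bullet> \<nu> < y \<bullet> \<nu>}"
      using edge_side'[OF T(1,2) ye] by metis
    have \<nu>': "- \<nu> = edge_normal e \<or> - \<nu> = - edge_normal e" using \<nu>(1) by auto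
    have side': "interior T' \<subseteq> {z. z \<bullet> (- \<nu>) < y \<bullet> (- \<nu>)}"
      by (rule opposite_side[OF T(1,2) nb(1,3) nb(2)[symmetric] \<nu>(1) y(1) \<nu>(2)])
    obtain s where s: "norm s = 1" "perp s = \<nu>"
    proof (cases "\<nu> = edge_normal e")
      case True
      then show thesis using that[of t] ep(1) by (simp add: t_def edge_normal_perp)
    next
      case False
      then show thesis using that[of "- t"] ep(1) \<nu>(1) by (simp add: t_def edge_normal_perp perp_uminus)
    qed
    obtain r1 where r1: "r1 > 0" "\<And>z. z \<in> ball y r1 \<Longrightarrow> z \<bullet> \<nu> < y \<bullet> \<nu> \<Longrightarrow> z \<in> interior T"
      using half_ball_in_triangle[OF T(2) triangle[OF T(1)] y(1) \<nu>] by blast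
    obtain r2 where r2: "r2 > 0" "\<And>z. z \<in> ball y r2 \<Longrightarrow> z \<bullet> (- \<nu>) < y \<bullet> (- \<nu>) \<Longrightarrow> z \<in> interior T'"
      using half_ball_in_triangle[OF nb(3) triangle[OF nb(1)] y(1) \<nu>' side'] by blast
    obtain r3 where r3: "r3 > 0" "ball y r3 \<subseteq> \<Omega>" using y(2) open_domain open_contains_ball by blast
    define r where "r = min r1 (min r2 r3)"
    have "q T y \<bullet> perp s = q T' y \<bullet> perp s"
    proof (rule normal_component_continuous[OF weak_divD(2)[OF sigma_Hdiv] weak_divD(1)[OF sigma_Hdiv] _
          open_domain bounded_domain _ _ s(1) q(1)[OF T(1)] _ q(1)[OF nb(1)]])
      show "\<sigma> \<in> L2 \<Omega>" using sigma_Hdiv by (simp add: Hdiv_def)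
      show "r > 0" using r1 r2 r3 by (simp add: r_def)
      show "ball y r \<subseteq> \<Omega>" using r3 by (auto simp: r_def)
      show "\<sigma> z = q T z" if "z \<in> ball y r" "(z - y) \<bullet> perp s < 0" for z
        by (rule q(2)[OF T(1) r1(2)]) (use that s in \<open>auto simp: r_def inner_diff_left\<close>)
      show "\<sigma> z = q T' z" if "z \<in> ball y r" "(z - y) \<bullet> perp s > 0" for z
        by (rule q(2)[OF nb(1) r2(2)]) (use that s in \<open>auto simp: r_def inner_diff_left\<close>)
    qed
    then show ?thesis using s(2) \<nu>(1) by (auto simp: J_def inner_diff_left)
  qed
  obtain x0 where x0: "x0 \<in> rel_interior e" "x0 \<in> \<Omega>" using interior_edge_point[OF T] by blast
  obtain s0 where s0: "x0 = a + s0 *\<^sub>R t" "0 < s0" "s0 < diameter e"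
  proof -
    have "x0 \<in> (\<lambda>s. a + s *\<^sub>R t) ` {0<..<diameter e}" using x0(1) ep(6) by (simp add: a_def t_def)
    then obtain s where "x0 = a + s *\<^sub>R t" "s \<in> {0<..<diameter e}" by (rule imageE)
    then show thesis by (intro that[of s]) simp_all
  qed
  obtain \<epsilon> where \<epsilon>: "\<epsilon> > 0" "ball x0 \<epsilon> \<subseteq> \<Omega>" using x0(2) open_domain open_contains_ball by blast
  have nt: "norm t = 1" using ep(1) by (simp add: t_def)
  have zero: "J (a + s *\<^sub>R t) = 0" for s
  proof (rule polys_zero_on_segment[OF J, of "max 0 (s0 - \<epsilon>)" "min (diameter e) (s0 + \<epsilon>)"])
    show "max 0 (s0 - \<epsilon>) < min (diameter e) (s0 + \<epsilon>)" using s0 \<epsilon>(1) by simp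
    fix s assume s: "max 0 (s0 - \<epsilon>) < s" "s < min (diameter e) (s0 + \<epsilon>)"
    show "J (a + s *\<^sub>R t) = 0"
    proof (rule key)
      have "s \<in> {0<..<diameter e}" using s by simp
      then show "a + s *\<^sub>R t \<in> rel_interior e" unfolding ep(6) a_def t_def by (rule imageI)
      have "a + s *\<^sub>R t - x0 = (s - s0) *\<^sub>R t" by (simp add: s0(1) algebra_simps)
      then have "dist (a + s *\<^sub>R t) x0 = \<bar>s - s0\<bar>" using nt by (simp add: dist_norm)
      then have "a + s *\<^sub>R t \<in> ball x0 \<epsilon>" using s by (simp add: dist_commute abs_less_iff)
      then show "a + s *\<^sub>R t \<in> \<Omega>" using \<epsilon>(2) by blast
    qed
  qed
  have "x \<in> (\<lambda>s. a + s *\<^sub>R t) ` {0..diameter e}" using x by (subst (asm) ep(3)) (simp add: a_def t_def)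
  then obtain s where "x = a + s *\<^sub>R t" by (rule imageE)
  then have "J x = 0" using zero by simp
  then show ?thesis by (simp add: J_def inner_diff_left T'_def)
qed

lemma tangential_jump:
  assumes T: "T \<in> \<T>" "e edge_of T" and x: "x \<in> e"
  shows "jump \<Omega> \<T> T e (\<lambda>x. \<sigma> x \<bullet> edge_tangent e) x =
    (if e \<subseteq> frontier \<Omega> then gap T x \<bullet> edge_tangent e
     else (gap T x - gap (neighbour \<T> T e) x) \<bullet> edge_tangent e)"
proof -
  have xT: "x \<in> T" using edge_of_imp_subset[OF T(2)] x by blast
  show ?thesis
  proof (cases "e \<subseteq> frontier \<Omega>")
    case True
    have "grad (p T) x \<bullet> edge_tangent e = 0"
    proof (rule tangential_derivative_zero[OF T(2) triangle[OF T(1)] p(1)[OF T(1)] _ x])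
      fix y assume "y \<in> e"
      then have "y \<in> T" "y \<in> frontier \<Omega>" using True edge_of_imp_subset[OF T(2)] by auto
      then show "p T y = 0" using p(2)[OF T(1), of y] u_zero[of y] by simp
    qed
    then show ?thesis using True by (simp add: jump_def sigma_trace[OF T(1) xT] gap_def inner_diff_left)
  next
    case False
    define T' where "T' = neighbour \<T> T e"
    note nb = neighbour[OF T False, folded T'_def]
    have xT': "x \<in> T'" using edge_of_imp_subset[OF nb(3)] x by blast
    have "grad (\<lambda>x. p T x - p T' x) x \<bullet> edge_tangent e = 0"
    proof (rule tangential_derivative_zero[OF T(2) triangle[OF T(1)] _ _ x])
      show "(\<lambda>x. p T x - p T' x) \<in> polys N" by (intro polys_diff p T nb)
      fix y assume "y \<in> e"
      then have "y \<in> T" "y \<in> T'" using edge_of_imp_subset[OF T(2)] edge_of_imp_subset[OF nb(3)] by auto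
      then show "p T y - p T' y = 0" using p(2)[OF T(1), of y] p(2)[OF nb(1), of y] by simp
    qed
    moreover have "p T differentiable at x" "p T' differentiable at x"
      using polys_differentiable p(1) T(1) nb(1) by blast+
    ultimately show ?thesis
      using False by (simp add: jump_def T'_def[symmetric] sigma_trace[OF T(1) xT] sigma_trace[OF nb(1) xT']
          gap_def inner_diff_left grad_diff)
  qed
qed

lemma normal_jump:
  assumes T: "T \<in> \<T>" "e edge_of T" "\<not> e \<subseteq> frontier \<Omega>" and x: "x \<in> e"
  shows "jump \<Omega> \<T> T e (\<lambda>x. grad u x \<bullet> edge_normal e) x =
    - ((gap T x - gap (neighbour \<T> T e) x) \<bullet> edge_normal e)"
proof -
  note nb = neighbour[OF T]
  have "x \<in> T" "x \<in> neighbour \<T> T e"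
    using edge_of_imp_subset[OF T(2)] edge_of_imp_subset[OF nb(3)] x by auto
  then show ?thesis
    using T(3) normal_jump_zero[OF T x]
    by (simp add: jump_def grad_trace[OF T(1)] grad_trace[OF nb(1)] gap_def inner_diff_left)
qed

lemma edge_diameter_le:
  assumes "T \<in> \<T>" "e edge_of T" shows "0 < diameter e" "diameter e \<le> diameter T"
  using edge_parametrization(2)[OF assms(2) triangle[OF assms(1)]]
    diameter_subset[OF edge_of_imp_subset[OF assms(2)]
      compact_imp_bounded[OF triangle_basics(2)[OF triangle[OF assms(1)]]]] by auto

lemma gap_edge_bound:
  assumes "T \<in> \<T>" "e edge_of T" "x \<in> e" shows "(norm (gap T x))\<^sup>2 \<le> C * gap_sq T / (diameter e)\<^sup>2"
proof -
  note d = edge_diameter_le[OF assms(1,2)]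
  have "(diameter e)\<^sup>2 * (norm (gap T x))\<^sup>2 \<le> (diameter T)\<^sup>2 * (norm (gap T x))\<^sup>2"
    using d by (intro mult_right_mono power_mono) auto
  also have "\<dots> \<le> C * gap_sq T" using gap_bound assms edge_of_imp_subset by blast
  finally show ?thesis using d(1) by (simp add: field_simps)
qed

lemma edge_term:
  assumes T: "T \<in> \<T>" "e edge_of T"
    and g: "\<And>x. x \<in> e \<Longrightarrow> (g x)\<^sup>2 \<le> 2 * (norm (gap T x))\<^sup>2 +
      (if e \<subseteq> frontier \<Omega> then 0 else 2 * (norm (gap (neighbour \<T> T e) x))\<^sup>2)"
  shows "diameter e * edge_norm_sq e g \<le> 2 * C * gap_sq T +
    (if e \<subseteq> frontier \<Omega> then 0 else 2 * C * gap_sq (neighbour \<T> T e))"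
proof -
  define gap_sq' where "gap_sq' = (if e \<subseteq> frontier \<Omega> then 0 else gap_sq (neighbour \<T> T e))"
  note d = edge_diameter_le[OF T]
  have "(g x)\<^sup>2 \<le> 2 * (C * gap_sq T / (diameter e)\<^sup>2) + 2 * (C * gap_sq' / (diameter e)\<^sup>2)" if x: "x \<in> e" for x
  proof (cases "e \<subseteq> frontier \<Omega>")
    case True
    then show ?thesis using g[OF x] gap_edge_bound[OF T x] by (simp add: gap_sq'_def)
  next
    case False
    then show ?thesis
      using g[OF x] gap_edge_bound[OF T x] gap_edge_bound[OF neighbour(1,3)[OF T False] x]
      by (simp add: gap_sq'_def)
  qed
  from edge_norm_sq_bound[OF T(2) triangle[OF T(1)] this]
  have "diameter e * edge_norm_sq e g \<le>
      diameter e * (diameter e * (2 * (C * gap_sq T / (diameter e)\<^sup>2) + 2 * (C * gap_sq' / (diameter e)\<^sup>2)))"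
    using d(1) by simp
  also have "\<dots> = 2 * C * gap_sq T + 2 * C * gap_sq'" using d(1) by (simp add: field_simps power2_eq_square)
  finally show ?thesis by (simp add: gap_sq'_def split: if_splits)
qed

lemma diff_sq_le:
  assumes "norm v = 1"
  shows "((a - b) \<bullet> v)\<^sup>2 \<le> 2 * (norm a)\<^sup>2 + 2 * (norm (b :: pt))\<^sup>2"
  using inner_sq_le[OF assms, of "a - b"] norm_sq_add_le[of a "- b"] by simp

lemma edge_contribution:
  assumes T: "T \<in> \<T>" "e edge_of T"
  shows "diameter e *
        (edge_norm_sq e (jump \<Omega> \<T> T e (\<lambda>x. \<sigma> x \<bullet> edge_tangent e))
         + (if e \<subseteq> frontier \<Omega> then 0
            else edge_norm_sq e (jump \<Omega> \<T> T e (\<lambda>x. grad u x \<bullet> edge_normal e))))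
     \<le> 4 * C * gap_sq T + (if e \<subseteq> frontier \<Omega> then 0 else 4 * C * gap_sq (neighbour \<T> T e))"
proof -
  have nt: "norm (edge_tangent e) = 1" "norm (edge_normal e) = 1"
    using edge_parametrization(1)[OF T(2) triangle[OF T(1)]] by (simp_all add: edge_normal_perp)
  have tan: "diameter e * edge_norm_sq e (jump \<Omega> \<T> T e (\<lambda>x. \<sigma> x \<bullet> edge_tangent e)) \<le> 2 * C * gap_sq T +
    (if e \<subseteq> frontier \<Omega> then 0 else 2 * C * gap_sq (neighbour \<T> T e))"
  proof (rule edge_term[OF T])
    fix x assume x: "x \<in> e"
    show "(jump \<Omega> \<T> T e (\<lambda>x. \<sigma> x \<bullet> edge_tangent e) x)\<^sup>2 \<le> 2 * (norm (gap T x))\<^sup>2 +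
      (if e \<subseteq> frontier \<Omega> then 0 else 2 * (norm (gap (neighbour \<T> T e) x))\<^sup>2)"
      unfolding tangential_jump[OF T x]
      using diff_sq_le[OF nt(1), of "gap T x" "gap (neighbour \<T> T e) x"] diff_sq_le[OF nt(1), of "gap T x" 0]
      by auto
  qed
  show ?thesis
  proof (cases "e \<subseteq> frontier \<Omega>")
    case True
    then show ?thesis using tan mult_nonneg_nonneg[OF less_imp_le[OF C_pos] gap_sq_nonneg[of T]] by simp
  next
    case False
    have "diameter e * edge_norm_sq e (jump \<Omega> \<T> T e (\<lambda>x. grad u x \<bullet> edge_normal e)) \<le> 2 * C * gap_sq T +
      (if e \<subseteq> frontier \<Omega> then 0 else 2 * C * gap_sq (neighbour \<T> T e))"
    proof (rule edge_term[OF T])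
      fix x assume x: "x \<in> e"
      show "(jump \<Omega> \<T> T e (\<lambda>x. grad u x \<bullet> edge_normal e) x)\<^sup>2 \<le> 2 * (norm (gap T x))\<^sup>2 +
        (if e \<subseteq> frontier \<Omega> then 0 else 2 * (norm (gap (neighbour \<T> T e) x))\<^sup>2)"
        unfolding normal_jump[OF T False x] power2_minus
        using False diff_sq_le[OF nt(2), of "gap T x" "gap (neighbour \<T> T e) x"] by simp
    qed
    then show ?thesis using tan False by (simp add: distrib_left)
  qed
qed

definition interior_edges :: "(pt set \<times> pt set) set" where
  "interior_edges = (SIGMA T:\<T>. {e. e edge_of T \<and> \<not> e \<subseteq> frontier \<Omega>})"

lemma sum_neighbour_gap_sq:
  "(\<Sum>(T, e)\<in>interior_edges. gap_sq (neighbour \<T> T e)) = (\<Sum>(T, e)\<in>interior_edges. gap_sq T)"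
proof -
  define \<rho> where "\<rho> = (\<lambda>(T, e). (neighbour \<T> T e, e))"
  have \<rho>: "\<rho> z \<in> interior_edges" "\<rho> (\<rho> z) = z" if "z \<in> interior_edges" for z
  proof -
    obtain T e where z: "z = (T, e)" by (cases z)
    then have "T \<in> \<T>" "e edge_of T" "\<not> e \<subseteq> frontier \<Omega>" using that by (simp_all add: interior_edges_def)
    then show "\<rho> z \<in> interior_edges" "\<rho> (\<rho> z) = z"
      by (simp_all add: z \<rho>_def interior_edges_def neighbour)
  qed
  show ?thesis
    by (rule sum.reindex_bij_witness[where i = \<rho> and j = \<rho>]) (use \<rho> in \<open>auto simp: \<rho>_def\<close>)
qed

theorem estimator_sq_bound:
  "(estimator \<Omega> \<T> \<sigma> u)\<^sup>2 \<le> (8 * unit_ball_vol 2 + 64) * C * (\<Sum>T\<in>\<T>. gap_sq T)"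
proof -
  define V :: real where "V = unit_ball_vol 2"
  have fin: "finite {e. e edge_of T}" and card: "real (card {e. e edge_of T}) \<le> 8" if "T \<in> \<T>" for T
    using triangle_edges[OF triangle[OF that]] by simp_all
  define I where "I T = {e. e edge_of T \<and> \<not> e \<subseteq> frontier \<Omega>}" for T
  have finI: "finite (I T)" if "T \<in> \<T>" for T
    by (rule finite_subset[OF _ fin[OF that]]) (auto simp: I_def)
  have Sigma: "(\<Sum>T\<in>\<T>. \<Sum>e\<in>I T. F T e) = (\<Sum>(T, e)\<in>interior_edges. F T e)"
    for F :: "pt set \<Rightarrow> pt set \<Rightarrow> real"
  proof -
    have "interior_edges = Sigma \<T> I" by (simp add: interior_edges_def I_def[abs_def])
    then show ?thesis using sum.Sigma[OF finite_mesh, of I F] finI by simp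
  qed
  have loc: "estimator_local_sq \<Omega> \<T> \<sigma> u T \<le> (8 * V + 32) * C * gap_sq T + 4 * C * (\<Sum>e\<in>I T. gap_sq (neighbour \<T> T e))"
    if T: "T \<in> \<T>" for T
  proof -
    have CE: "0 \<le> C * gap_sq T" using C_pos gap_sq_nonneg by simp
    have "(\<Sum>e | e edge_of T. diameter e *
        (edge_norm_sq e (jump \<Omega> \<T> T e (\<lambda>x. \<sigma> x \<bullet> edge_tangent e))
         + (if e \<subseteq> frontier \<Omega> then 0
            else edge_norm_sq e (jump \<Omega> \<T> T e (\<lambda>x. grad u x \<bullet> edge_normal e))))) \<le>
      (\<Sum>e | e edge_of T. 4 * C * gap_sq T + (if e \<subseteq> frontier \<Omega> then 0 else 4 * C * gap_sq (neighbour \<T> T e)))"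
      by (rule sum_mono) (use edge_contribution[OF T] in blast)
    also have "\<dots> = real (card {e. e edge_of T}) * (4 * C * gap_sq T) +
        (\<Sum>e | e edge_of T. (if e \<subseteq> frontier \<Omega> then 0 else 4 * C * gap_sq (neighbour \<T> T e)))"
      by (simp add: sum.distrib)
    also have "(\<Sum>e | e edge_of T. (if e \<subseteq> frontier \<Omega> then 0 else 4 * C * gap_sq (neighbour \<T> T e))) =
        4 * C * (\<Sum>e\<in>I T. gap_sq (neighbour \<T> T e))"
      unfolding sum_distrib_left I_def
      by (rule sum.mono_neutral_cong_right[OF fin[OF T]]) auto
    also have "real (card {e. e edge_of T}) * (4 * C * gap_sq T) \<le> 8 * (4 * C * gap_sq T)"
      using card[OF T] CE by (intro mult_right_mono) auto
    finally show ?thesis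
      using div_term[OF T] curl_term[OF T]
      unfolding estimator_local_sq_def V_def by (simp add: algebra_simps)
  qed
  have S: "(\<Sum>T\<in>\<T>. \<Sum>e\<in>I T. gap_sq (neighbour \<T> T e)) \<le> 8 * (\<Sum>T\<in>\<T>. gap_sq T)"
  proof -
    have "(\<Sum>T\<in>\<T>. \<Sum>e\<in>I T. gap_sq (neighbour \<T> T e)) = (\<Sum>(T, e)\<in>interior_edges. gap_sq (neighbour \<T> T e))"
      by (rule Sigma)
    also have "\<dots> = (\<Sum>(T, e)\<in>interior_edges. gap_sq T)" by (rule sum_neighbour_gap_sq)
    also have "\<dots> = (\<Sum>T\<in>\<T>. \<Sum>e\<in>I T. gap_sq T)"
      by (rule Sigma[symmetric])
    also have "\<dots> \<le> (\<Sum>T\<in>\<T>. 8 * gap_sq T)"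
    proof (rule sum_mono)
      fix T assume T: "T \<in> \<T>"
      have "card (I T) \<le> card {e. e edge_of T}" by (rule card_mono[OF fin[OF T]]) (auto simp: I_def)
      then have "real (card (I T)) \<le> 8" using card[OF T] by linarith
      then show "(\<Sum>e\<in>I T. gap_sq T) \<le> 8 * gap_sq T" using gap_sq_nonneg by (simp add: mult_right_mono)
    qed
    finally show ?thesis by (simp add: sum_distrib_left)
  qed
  have nonneg: "0 \<le> (\<Sum>T\<in>\<T>. estimator_local_sq \<Omega> \<T> \<sigma> u T)"
  proof -
    have "edge_norm_sq e g \<ge> 0" for e g unfolding edge_norm_sq_def by (rule integral_nonneg_AE) simp
    moreover have "diameter e \<ge> 0" if "T \<in> \<T>" "e edge_of T" for T e using edge_diameter_le[OF that] by simp
    ultimately have "estimator_local_sq \<Omega> \<T> \<sigma> u T \<ge> 0" if "T \<in> \<T>" for T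
      unfolding estimator_local_sq_def using that
      by (intro add_nonneg_nonneg sum_nonneg mult_nonneg_nonneg) auto
    then show ?thesis by (rule sum_nonneg)
  qed
  have "(\<Sum>T\<in>\<T>. estimator_local_sq \<Omega> \<T> \<sigma> u T) \<le>
      (\<Sum>T\<in>\<T>. (8 * V + 32) * C * gap_sq T + 4 * C * (\<Sum>e\<in>I T. gap_sq (neighbour \<T> T e)))"
    by (rule sum_mono) (rule loc)
  also have "\<dots> = (8 * V + 32) * C * (\<Sum>T\<in>\<T>. gap_sq T) + 4 * C * (\<Sum>T\<in>\<T>. \<Sum>e\<in>I T. gap_sq (neighbour \<T> T e))"
    by (simp add: sum.distrib sum_distrib_left)
  also have "\<dots> \<le> (8 * V + 32) * C * (\<Sum>T\<in>\<T>. gap_sq T) + 4 * C * (8 * (\<Sum>T\<in>\<T>. gap_sq T))"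
    using S C_pos by simp
  also have "\<dots> = (8 * V + 64) * C * (\<Sum>T\<in>\<T>. gap_sq T)" by (simp add: algebra_simps)
  finally show ?thesis using nonneg by (simp add: estimator_def V_def)
qed

end

section \<open>The efficiency estimate\<close>

lemma lipschitz_polygon_domain:
  assumes "lipschitz_polygon \<Omega>"
  shows "open \<Omega>" "bounded \<Omega>" "negligible (frontier \<Omega>)"
proof -
  show "open \<Omega>" "bounded \<Omega>"
    using assms by (simp_all add: lipschitz_polygon_def lipschitz_domain_def)
  obtain S where S: "finite S" "frontier \<Omega> = (\<Union>(a, b)\<in>S. closed_segment a b)"
    using assms unfolding lipschitz_polygon_def by blast
  have "negligible (closed_segment a b)" for a b :: pt
    by (simp add: negligible_convex_interior interior_closed_segment_ge2)
  then show "negligible (frontier \<Omega>)"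
    unfolding S(2) by (intro negligible_Union) (use S(1) in auto)
qed

context fe_pair
begin

lemma sum_gap_sq_le:
  assumes "u \<in> H1 \<Omega>"
  shows "(\<Sum>T\<in>\<T>. gap_sq T) \<le> (\<integral>x. (norm (\<sigma> x - weak_grad \<Omega> u x))\<^sup>2 \<partial>lebesgue_on \<Omega>)"
proof -
  define F where "F x = (norm (\<sigma> x - weak_grad \<Omega> u x))\<^sup>2" for x
  have \<Omega>: "\<Omega> \<in> sets lebesgue" using open_domain by simp
  define A where "A T = interior T \<inter> \<Omega>" for T
  have A: "A T \<in> sets lebesgue" "open (A T)" for T
    using open_domain by (simp_all add: A_def open_Int)
  have "\<sigma> \<in> L2 \<Omega>" using sigma_Hdiv by (simp add: Hdiv_def)
  then have "(\<lambda>x. \<sigma> x - weak_grad \<Omega> u x) \<in> L2 \<Omega>" by (rule L2_diff[OF _ weak_gradD(1)[OF assms]])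
  then have Fint: "integrable (lebesgue_on \<Omega>) F" by (simp add: L2_def F_def[abs_def])
  have ind: "integrable lebesgue (\<lambda>x. indicator B x * F x)" if "B \<subseteq> \<Omega>" "B \<in> sets lebesgue" for B
    using integrable_lebesgue_on_subset[OF Fint that(1) \<Omega> that(2)] that(2)
    by (simp add: integrable_restrict_space)
  have ET: "gap_sq T = (\<integral>x. indicator (A T) x * F x \<partial>lebesgue)" if T: "T \<in> \<T>" for T
  proof -
    note B = triangle_basics[OF triangle[OF T]]
    have "AE x in lebesgue. x \<in> A T \<longrightarrow> weak_grad \<Omega> u x = grad (p T) x"
      by (rule has_weak_grad_polys_AE[OF weak_gradD(2)[OF assms] weak_gradD(1)[OF assms]
            open_domain bounded_domain A(2) _ _ p(1)[OF T]])
        (use p(2)[OF T] interior_subset in \<open>auto simp: A_def\<close>)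
    with AE_interior[OF T]
    have "AE x in lebesgue. indicator T x * (norm (gap T x))\<^sup>2 = indicator (A T) x * F x"
    proof eventually_elim
      case (elim x)
      show ?case
      proof (cases "x \<in> T")
        case True
        then have "x \<in> A T" "x \<in> interior T" using elim(1) by (auto simp: A_def)
        then show ?thesis using True elim(2) q(2)[OF T] by (simp add: F_def gap_def)
      next
        case False
        then have "x \<notin> A T" using interior_subset by (auto simp: A_def)
        then show ?thesis using False by simp
      qed
    qed
    then have "(\<integral>x. indicator T x * (norm (gap T x))\<^sup>2 \<partial>lebesgue) = (\<integral>x. indicator (A T) x * F x \<partial>lebesgue)"
    proof (rule integral_cong_AE[rotated 2])
      have "integrable (lebesgue_on T) (\<lambda>x. (norm (gap T x))\<^sup>2)"
        by (intro continuous_integrable_compact B(2) continuous_intros vpolys_continuous[OF gap_vpolys[OF T]])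
      then show "(\<lambda>x. indicator T x * (norm (gap T x))\<^sup>2) \<in> borel_measurable lebesgue"
        using B(7) by (simp add: integrable_restrict_space borel_measurable_integrable)
      show "(\<lambda>x. indicator (A T) x * F x) \<in> borel_measurable lebesgue"
        by (rule borel_measurable_integrable[OF ind]) (simp_all add: A, simp add: A_def)
    qed
    then show ?thesis using B(7) by (simp add: gap_sq_def integral_restrict_space)
  qed
  have Asub: "A T \<subseteq> \<Omega>" for T by (simp add: A_def)
  have "(\<Sum>T\<in>\<T>. gap_sq T) = (\<integral>x. (\<Sum>T\<in>\<T>. indicator (A T) x * F x) \<partial>lebesgue)"
    using ind[OF Asub A(1)] by (subst Bochner_Integration.integral_sum) (auto simp: ET)
  also have "\<dots> \<le> (\<integral>x. indicator \<Omega> x * F x \<partial>lebesgue)"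
  proof (rule integral_mono)
    show "integrable lebesgue (\<lambda>x. \<Sum>T\<in>\<T>. indicator (A T) x * F x)"
      using ind[OF Asub A(1)] by auto
    show "integrable lebesgue (\<lambda>x. indicator \<Omega> x * F x)" by (rule ind[OF order_refl \<Omega>])
    fix x
    have "(\<Sum>T\<in>\<T>. indicator (A T) x) = (indicator (\<Union>T\<in>\<T>. A T) x :: real)"
    proof (rule indicator_UN_disjoint[symmetric, OF finite_mesh])
      show "disjoint_family_on A \<T>"
        unfolding disjoint_family_on_def A_def
        using interior_disjoint interior_subset by blast
    qed
    also have "\<dots> \<le> indicator \<Omega> x" using Asub by (auto simp: indicator_def)
    finally have "(\<Sum>T\<in>\<T>. indicator (A T) x) * F x \<le> indicator \<Omega> x * F x"
      by (rule mult_right_mono) (simp add: F_def)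
    then show "(\<Sum>T\<in>\<T>. indicator (A T) x * F x) \<le> indicator \<Omega> x * F x"
      by (simp add: sum_distrib_right)
  qed
  also have "\<dots> = (\<integral>x. F x \<partial>lebesgue_on \<Omega>)" using \<Omega> by (simp add: integral_restrict_space)
  finally show ?thesis by (simp add: F_def)
qed

end

lemma discrepancy_le_error:
  assumes \<Omega>: "open \<Omega>" "bounded \<Omega>" and \<sigma>: "\<sigma> \<in> L2 \<Omega>" "\<sigma>' \<in> L2 \<Omega>" and u: "u \<in> H1 \<Omega>" "u' \<in> H1 \<Omega>"
    and eq: "AE x in lebesgue_on \<Omega>. \<sigma> x = weak_grad \<Omega> u x"
  shows "(\<integral>x. (norm (\<sigma>' x - weak_grad \<Omega> u' x))\<^sup>2 \<partial>lebesgue_on \<Omega>) \<le>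
    2 * (Hdiv_norm \<Omega> (\<lambda>x. \<sigma> x - \<sigma>' x) + H1_norm \<Omega> (\<lambda>x. u x - u' x))\<^sup>2"
proof -
  define a where "a x = \<sigma> x - \<sigma>' x" for x
  define b where "b = weak_grad \<Omega> (\<lambda>x. u x - u' x)"
  note wd = weak_grad_diff[OF \<Omega> u]
  have aL2: "a \<in> L2 \<Omega>" unfolding a_def[abs_def] by (rule L2_diff[OF \<sigma>])
  have bL2: "b \<in> L2 \<Omega>" unfolding b_def by (rule weak_gradD(1)[OF wd(2)])
  have cL2: "(\<lambda>x. \<sigma>' x - weak_grad \<Omega> u' x) \<in> L2 \<Omega>" by (rule L2_diff[OF \<sigma>(2) weak_gradD(1)[OF u(2)]])
  have "(\<integral>x. (norm (\<sigma>' x - weak_grad \<Omega> u' x))\<^sup>2 \<partial>lebesgue_on \<Omega>) \<le>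
      (\<integral>x. 2 * (norm (a x))\<^sup>2 + 2 * (norm (b x))\<^sup>2 \<partial>lebesgue_on \<Omega>)"
  proof (rule integral_mono_AE)
    show "integrable (lebesgue_on \<Omega>) (\<lambda>x. (norm (\<sigma>' x - weak_grad \<Omega> u' x))\<^sup>2)"
      using cL2 by (simp add: L2_def)
    show "integrable (lebesgue_on \<Omega>) (\<lambda>x. 2 * (norm (a x))\<^sup>2 + 2 * (norm (b x))\<^sup>2)"
      using aL2 bL2 by (simp add: L2_def)
    show "AE x in lebesgue_on \<Omega>. (norm (\<sigma>' x - weak_grad \<Omega> u' x))\<^sup>2 \<le> 2 * (norm (a x))\<^sup>2 + 2 * (norm (b x))\<^sup>2"
      using eq wd(1)
    proof eventually_elim
      case (elim x)
      then have "\<sigma>' x - weak_grad \<Omega> u' x = - a x + b x" by (simp add: a_def b_def)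
      then show ?case using norm_sq_add_le[of "- a x" "b x"] by simp
    qed
  qed
  also have "\<dots> = 2 * (l2_norm \<Omega> a)\<^sup>2 + 2 * (l2_norm \<Omega> b)\<^sup>2"
    using aL2 bL2 by (simp add: l2_norm_sq L2_def)
  also have "\<dots> \<le> 2 * (Hdiv_norm \<Omega> a)\<^sup>2 + 2 * (H1_norm \<Omega> (\<lambda>x. u x - u' x))\<^sup>2"
    by (simp add: Hdiv_norm_def H1_norm_def b_def)
  also have "\<dots> \<le> 2 * (Hdiv_norm \<Omega> a + H1_norm \<Omega> (\<lambda>x. u x - u' x))\<^sup>2"
  proof -
    have "Hdiv_norm \<Omega> a \<ge> 0" "H1_norm \<Omega> (\<lambda>x. u x - u' x) \<ge> 0"
      by (simp_all add: Hdiv_norm_def H1_norm_def)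
    then show ?thesis by (simp add: power2_sum)
  qed
  finally show ?thesis by (simp add: a_def[abs_def])
qed

lemma vpolys_mono: "q \<in> vpolys k \<Longrightarrow> k \<le> l \<Longrightarrow> q \<in> vpolys l"
  by (auto simp: vpolys_def intro: polys_mono)

theorem theorem16:
  fixes \<Omega> :: "(real^2) set" and H :: "real set" and \<T> :: "real \<Rightarrow> (real^2) set set"
    and S :: "real \<Rightarrow> (real^2 \<Rightarrow> real^2) set" and U :: "real \<Rightarrow> (real^2 \<Rightarrow> real) set"
    and k m :: nat and lam :: real and lam_h :: "real \<Rightarrow> real"
    and \<sigma> :: "real^2 \<Rightarrow> real^2" and u :: "real^2 \<Rightarrow> real"
    and \<sigma>_h :: "real \<Rightarrow> real^2 \<Rightarrow> real^2" and u_h :: "real \<Rightarrow> real^2 \<Rightarrow> real"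
  assumes "lipschitz_polygon \<Omega>"
    and "shape_regular_family \<Omega> H \<T>"
    and "\<And>h. h \<in> H \<Longrightarrow> mixed_fe_space \<Omega> (\<T> h) k (S h)"
    and "m \<ge> 1"
    and "\<And>h. h \<in> H \<Longrightarrow> U h = lagrange_space \<Omega> (\<T> h) m"
    and "simple_ls_eigenvalue \<Omega> lam"
    and "ls_eigen_solution \<Omega> (Hdiv \<Omega>) (H10 \<Omega>) lam \<sigma> u"
    and "\<And>h. h \<in> H \<Longrightarrow> ls_eigen_solution \<Omega> (S h) (U h) (lam_h h) (\<sigma>_h h) (u_h h)"
    and "(lam_h \<longlongrightarrow> lam) (at 0 within H)"
    and "((\<lambda>h. H1_norm \<Omega> (\<lambda>x. u x - u_h h x)) \<longlongrightarrow> 0) (at 0 within H)"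
    and "((\<lambda>h. Hdiv_norm \<Omega> (\<lambda>x. \<sigma> x - \<sigma>_h h x)) \<longlongrightarrow> 0) (at 0 within H)"
  shows "\<exists>C. \<forall>h\<in>H. estimator \<Omega> (\<T> h) (\<sigma>_h h) (u_h h)
           \<le> C * (Hdiv_norm \<Omega> (\<lambda>x. \<sigma> x - \<sigma>_h h x) + H1_norm \<Omega> (\<lambda>x. u x - u_h h x))"
proof -
  note \<Omega> = lipschitz_polygon_domain[OF assms(1)]
  obtain \<kappa> where \<kappa>: "\<And>h T. h \<in> H \<Longrightarrow> T \<in> \<T> h \<Longrightarrow> diameter T \<le> \<kappa> * disk_diam T"
    and mesh: "\<And>h. h \<in> H \<Longrightarrow> triangle_mesh \<Omega> (\<T> h)"
    using assms(2) unfolding shape_regular_family_def by blast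
  define \<delta> where "\<delta> = 1 / (4 * (\<bar>\<kappa>\<bar> + 1))"
  define N where "N = max (k + 1) m"
  have "\<delta> > 0" unfolding \<delta>_def by (simp add: add_nonneg_pos)
  then obtain C where C: "C > 0"
    "\<And>p T x0 h y. \<lbrakk>p \<in> polys N; h > 0; compact T; cball x0 (h * \<delta>) \<subseteq> T; T \<subseteq> cball x0 h; y \<in> T\<rbrakk> \<Longrightarrow>
       h\<^sup>2 * (p y)\<^sup>2 \<le> C * (\<integral>x. (p x)\<^sup>2 \<partial>lebesgue_on T)"
    "\<And>p T x0 h y i. \<lbrakk>p \<in> polys N; h > 0; compact T; cball x0 (h * \<delta>) \<subseteq> T; T \<subseteq> cball x0 h; y \<in> T\<rbrakk> \<Longrightarrow>
       h\<^sup>2 * (h * pd i p y)\<^sup>2 \<le> C * (\<integral>x. (p x)\<^sup>2 \<partial>lebesgue_on T)"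
    using polys_inverse_estimate[of \<delta> N] by blast
  define K where "K = (8 * unit_ball_vol 2 + 64) * C"
  have K: "K \<ge> 0" unfolding K_def using C(1) by (intro mult_nonneg_nonneg add_nonneg_nonneg) auto
  have u: "\<sigma> \<in> L2 \<Omega>" "u \<in> H1 \<Omega>"
    using assms(7) by (auto simp: ls_eigen_solution_def Hdiv_def H10_def)
  have eq: "AE x in lebesgue_on \<Omega>. \<sigma> x = weak_grad \<Omega> u x"
    by (rule ls_solution_sigma_eq_grad[OF \<Omega>(1,2) assms(7)])
  have "estimator \<Omega> (\<T> h) (\<sigma>_h h) (u_h h) \<le>
      sqrt (2 * K) * (Hdiv_norm \<Omega> (\<lambda>x. \<sigma> x - \<sigma>_h h x) + H1_norm \<Omega> (\<lambda>x. u x - u_h h x))" if h: "h \<in> H" for h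
  proof -
    have sol: "\<sigma>_h h \<in> S h" "u_h h \<in> lagrange_space \<Omega> (\<T> h) m"
      using assms(8)[OF h] assms(5)[OF h] by (auto simp: ls_eigen_solution_def)
    obtain P where P: "\<And>T. T \<in> \<T> h \<Longrightarrow> P T \<subseteq> vpolys (k + 1)" "S h = hdiv_fe \<Omega> (\<T> h) P"
      using assms(3)[OF h] unfolding mixed_fe_space_def by blast
    have \<sigma>h: "\<sigma>_h h \<in> Hdiv \<Omega>" and "\<forall>T\<in>\<T> h. \<exists>q\<in>P T. \<forall>x\<in>interior T. \<sigma>_h h x = q x"
      using sol(1) by (auto simp: P(2) hdiv_fe_def)
    then obtain q where q: "\<And>T. T \<in> \<T> h \<Longrightarrow> q T \<in> P T"
      "\<And>T x. T \<in> \<T> h \<Longrightarrow> x \<in> interior T \<Longrightarrow> \<sigma>_h h x = q T x" by metis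
    have uh: "u_h h \<in> H1 \<Omega>" "\<And>x. x \<in> frontier \<Omega> \<Longrightarrow> u_h h x = 0"
      and "\<forall>T\<in>\<T> h. \<exists>p\<in>polys m. \<forall>x\<in>T. u_h h x = p x"
      using sol(2) by (auto simp: lagrange_space_def H10_def)
    then obtain p where p: "\<And>T. T \<in> \<T> h \<Longrightarrow> p T \<in> polys m"
      "\<And>T x. T \<in> \<T> h \<Longrightarrow> x \<in> T \<Longrightarrow> u_h h x = p T x" by metis
    interpret mesh \<Omega> "\<T> h" by unfold_locales (use mesh[OF h] \<Omega> in auto)
    interpret fe_pair \<Omega> "\<T> h" N C "\<sigma>_h h" "u_h h" q p
    proof unfold_locales
      fix r :: "pt \<Rightarrow> real" and T y i assume r: "r \<in> polys N" "T \<in> \<T> h" "y \<in> T"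
      obtain x where x: "cball x (diameter T * \<delta>) \<subseteq> T" "T \<subseteq> cball x (diameter T)"
        using shape_regular_disk[OF triangle[OF r(2)] \<kappa>[OF h r(2)]] unfolding \<delta>_def by blast
      note C' = triangle_diameter_pos[OF triangle[OF r(2)]] triangle_basics(2)[OF triangle[OF r(2)]]
      show "(diameter T)\<^sup>2 * (r y)\<^sup>2 \<le> C * (\<integral>x. (r x)\<^sup>2 \<partial>lebesgue_on T)"
        by (rule C(2)[OF r(1) C' x r(3)])
      show "(diameter T)\<^sup>2 * (diameter T * pd i r y)\<^sup>2 \<le> C * (\<integral>x. (r x)\<^sup>2 \<partial>lebesgue_on T)"
        by (rule C(3)[OF r(1) C' x r(3)])
    next
      show "q T \<in> vpolys N" if "T \<in> \<T> h" for T
        by (rule vpolys_mono[of _ "k + 1"]) (use q(1)[OF that] P(1)[OF that] in \<open>auto simp: N_def\<close>)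
      show "p T \<in> polys N" if "T \<in> \<T> h" for T
        by (rule polys_mono[OF p(1)[OF that]]) (simp add: N_def)
    qed (use C(1) \<sigma>h q(2) p(2) uh(2) in auto)
    define B where "B = Hdiv_norm \<Omega> (\<lambda>x. \<sigma> x - \<sigma>_h h x) + H1_norm \<Omega> (\<lambda>x. u x - u_h h x)"
    have B: "B \<ge> 0" by (simp add: B_def Hdiv_norm_def H1_norm_def)
    have "(estimator \<Omega> (\<T> h) (\<sigma>_h h) (u_h h))\<^sup>2 \<le> K * (\<Sum>T\<in>\<T> h. gap_sq T)"
      unfolding K_def by (rule estimator_sq_bound)
    also have "\<dots> \<le> K * (\<integral>x. (norm (\<sigma>_h h x - weak_grad \<Omega> (u_h h) x))\<^sup>2 \<partial>lebesgue_on \<Omega>)"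
      using sum_gap_sq_le[OF uh(1)] K by (rule mult_left_mono)
    also have "\<dots> \<le> K * (2 * B\<^sup>2)"
      unfolding B_def using \<sigma>h K
      by (intro mult_left_mono discrepancy_le_error \<Omega> u uh(1) eq) (simp_all add: Hdiv_def)
    also have "\<dots> = (sqrt (2 * K) * B)\<^sup>2" using K by (simp add: power_mult_distrib)
    finally have "estimator \<Omega> (\<T> h) (\<sigma>_h h) (u_h h) \<le> sqrt (2 * K) * B"
      by (rule power2_le_imp_le) (use B K in simp)
    then show ?thesis by (simp add: B_def)
  qed
  then show ?thesis by blast
qed

end
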